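(* There is $R_0>0$ such that for every $R\ge R_0$ and every $\varphi\in C^\infty(\mathbb{R}^3,[0,1])$ with $\varphi(x)=0$ for $|x|\le R$ and $\varphi(x)=1$ for $|x|\ge R+1$, the following holds. For every $u_0\in H^1(\mathbb{R}^3)$ and every $T>0$, there exists a control $h\in C(\mathbb{R};H^1(\mathbb{R}^3))$ with support in $\mathbb{R}\times(\mathbb{R}^3\setminus B_R(0))$ such that the unique solution $u$ of the linear system $$i\partial_t u+\Delta u=\varphi(x)h(x,t)\ \text{ on }\mathbb{R}^3\times[0,+\infty),\qquad u(x,0)=u_0(x),$$ satisfies $u(T,\cdot)=0$.
   Context: Functions are complex-valued, $H^1(\mathbb{R}^3)$ is the usual Sobolev space, and $B_R(0)$ is the open ball of radius $R$ centered at $0$ in $\mathbb{R}^3$. The unique solution of the linear system is the function $u\in C([0,\infty);H^1(\mathbb{R}^3))$ given by $u(t)=e^{it\Delta}u_0-i\int_0^t e^{i(t-\tau)\Delta}\varphi h(\tau)\,d\tau$. *)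

theory Defs
  imports "HOL-Analysis.Analysis"
begin

section \<open>Smooth functions\<close>

primrec C_k :: "nat \<Rightarrow> ('a::real_normed_vector \<Rightarrow> 'b::real_normed_vector) \<Rightarrow> bool" where
  "C_k 0 f \<longleftrightarrow> continuous_on UNIV f"
| "C_k (Suc n) f \<longleftrightarrow> (\<forall>x. f differentiable at x) \<and> (\<forall>v. C_k n (\<lambda>x. frechet_derivative f (at x) v))"

definition smooth :: "('a::real_normed_vector \<Rightarrow> 'b::real_normed_vector) \<Rightarrow> bool" where
  "smooth f \<longleftrightarrow> (\<forall>n. C_k n f)"

definition test_function :: "(real^3 \<Rightarrow> complex) \<Rightarrow> bool" where
  "test_function \<psi> \<longleftrightarrow> smooth \<psi> \<and> compact (closure {x. \<psi> x \<noteq> 0})"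

lemma C_k_SucI:
  assumes "\<And>x. (f has_derivative f' x) (at x)" and "\<And>v. C_k n (\<lambda>x. f' x v)"
  shows "C_k (Suc n) f"
proof -
  have "frechet_derivative f (at x) = f' x" for x
    using assms(1)[of x] frechet_derivative_at by metis
  thus ?thesis using assms by (auto simp: differentiable_def)
qed

lemma C_k_SucD: "C_k (Suc n) f \<Longrightarrow> C_k n f"
proof (induction n arbitrary: f)
  case 0
  thus ?case
    by (auto simp: continuous_on_eq_continuous_at differentiable_imp_continuous_within)
next
  case (Suc n)
  thus ?case by auto
qed

lemma C_k_has_derivative:
  "C_k (Suc n) f \<Longrightarrow> (f has_derivative frechet_derivative f (at x)) (at x)"
  using frechet_derivative_works by fastforce

lemma C_k_const [simp]: "C_k n (\<lambda>x. c)"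
proof (induction n arbitrary: c)
  case (Suc n)
  show ?case by (rule C_k_SucI[where f' = "\<lambda>_ _. 0"]) (auto simp: Suc)
qed auto

lemma C_k_add: "C_k n f \<Longrightarrow> C_k n g \<Longrightarrow> C_k n (\<lambda>x. f x + g x)"
proof (induction n arbitrary: f g)
  case (Suc n)
  show ?case
    by (rule C_k_SucI[where f' = "\<lambda>x v. frechet_derivative f (at x) v + frechet_derivative g (at x) v"])
      (use Suc.prems C_k_has_derivative[OF Suc.prems(1)] C_k_has_derivative[OF Suc.prems(2)]
       in \<open>auto intro!: has_derivative_add Suc.IH\<close>)
qed (auto intro: continuous_intros)

lemma C_k_mult:
  fixes f g :: "'a::real_normed_vector \<Rightarrow> 'b::real_normed_algebra"
  shows "C_k n f \<Longrightarrow> C_k n g \<Longrightarrow> C_k n (\<lambda>x. f x * g x)"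
proof (induction n arbitrary: f g)
  case (Suc n)
  show ?case
  proof (rule C_k_SucI[where f' = "\<lambda>x v. f x * frechet_derivative g (at x) v + frechet_derivative f (at x) v * g x"])
    show "((\<lambda>x. f x * g x) has_derivative
      (\<lambda>v. f x * frechet_derivative g (at x) v + frechet_derivative f (at x) v * g x)) (at x)" for x
      using has_derivative_mult[OF C_k_has_derivative[OF Suc.prems(1)] C_k_has_derivative[OF Suc.prems(2)]] .
    show "C_k n (\<lambda>x. f x * frechet_derivative g (at x) v + frechet_derivative f (at x) v * g x)" for v
      using Suc.prems C_k_SucD[OF Suc.prems(1)] C_k_SucD[OF Suc.prems(2)]
      by (intro C_k_add Suc.IH) auto
  qed
qed (auto intro: continuous_intros)

lemma C_k_prod:
  fixes f :: "'i \<Rightarrow> 'a::real_normed_vector \<Rightarrow> 'b::{real_normed_algebra,comm_ring_1}"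
  assumes "\<And>i. i \<in> S \<Longrightarrow> C_k n (f i)"
  shows "C_k n (\<lambda>x. \<Prod>i\<in>S. f i x)"
  using assms by (induction S rule: infinite_finite_induct) (auto intro!: C_k_mult)

subsection \<open>The flat function and smooth approximations of boxes\<close>

definition flat :: "nat \<Rightarrow> real \<Rightarrow> real" where
  "flat m x = (if x > 0 then inverse x ^ m * exp (- inverse x) else 0)"

lemma flat_tendsto_0: "(flat m \<longlongrightarrow> 0) (at 0)"
proof -
  have "((\<lambda>x. inverse x ^ m / exp (inverse x)) \<longlongrightarrow> (0::real)) (at_right 0)"
    by (rule filterlim_compose[OF tendsto_power_div_exp_0 filterlim_inverse_at_top_right])
  hence "(flat m \<longlongrightarrow> 0) (at_right 0)"
    by (rule Lim_transform_eventually)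
      (auto simp: flat_def exp_minus divide_inverse eventually_at_filter)
  moreover have "(flat m \<longlongrightarrow> 0) (at_left 0)"
    by (rule Lim_transform_eventually[of "\<lambda>_. 0"]) (auto simp: flat_def eventually_at_filter)
  ultimately show ?thesis by (simp add: filterlim_split_at)
qed

lemma flat_has_derivative:
  "(flat m has_real_derivative (- real m * flat (Suc m) x + flat (m + 2) x)) (at x)"
proof -
  consider "x > 0" | "x < 0" | "x = 0" by linarith
  thus ?thesis
  proof cases
    case 1
    have p: "real m * inverse x ^ (m - Suc 0) * (inverse x * inverse x) = real m * inverse x ^ Suc m"
      by (cases m) auto
    have "((\<lambda>x. inverse x ^ m * exp (- inverse x)) has_real_derivative
        - (real m * inverse x ^ (m - Suc 0) * (inverse x * inverse x)) * exp (- inverse x)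
        + inverse x ^ m * (exp (- inverse x) * (inverse x * inverse x))) (at x)"
      using 1 by (auto intro!: derivative_eq_intros)
    hence d: "((\<lambda>x. inverse x ^ m * exp (- inverse x)) has_real_derivative
        (- real m * flat (Suc m) x + flat (m + 2) x)) (at x)"
      unfolding p using 1 by (simp add: flat_def algebra_simps)
    show ?thesis
      by (rule has_field_derivative_transform_within_open[OF d, of "{0<..}"])
        (use 1 in \<open>auto simp: flat_def\<close>)
  next
    case 2
    have d: "((\<lambda>x. 0) has_real_derivative (- real m * flat (Suc m) x + flat (m + 2) x)) (at x)"
      using 2 by (auto simp: flat_def)
    show ?thesis
      by (rule has_field_derivative_transform_within_open[OF d, of "{..<0}"])
        (use 2 in \<open>auto simp: flat_def\<close>)
  next
    case 3
    have "((\<lambda>h. (flat m (0 + h) - flat m 0) / h) \<longlongrightarrow> 0) (at 0)"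
      by (rule Lim_transform_eventually[OF flat_tendsto_0[of "Suc m"]])
        (auto simp: flat_def eventually_at_filter divide_inverse mult_ac)
    thus ?thesis using 3 by (simp add: has_field_derivative_def[symmetric] DERIV_def flat_def)
  qed
qed

lemma C_k_flat:
  "C_k n (\<lambda>x::real^3. complex_of_real (flat m (a * x $ j + c)))"
proof (induction n arbitrary: m)
  case 0
  have "continuous_on UNIV (flat m)"
    using flat_has_derivative DERIV_isCont by (blast intro: continuous_at_imp_continuous_on)
  thus ?case
    by (auto intro!: continuous_intros continuous_on_compose2[of UNIV "flat m"])
next
  case (Suc n)
  let ?F = "\<lambda>m (x::real^3). complex_of_real (flat m (a * x $ j + c))"
  let ?d = "\<lambda>x (v::real^3). complex_of_real (a * v $ j) *
        (complex_of_real (- real m) * ?F (Suc m) x + ?F (m + 2) x)"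
  show ?case
  proof (rule C_k_SucI[where f' = ?d])
    fix x :: "real^3"
    have "((\<lambda>x::real^3. a * x $ j + c) has_derivative (\<lambda>v. a * v $ j)) (at x)"
      by (auto intro!: derivative_eq_intros bounded_linear_imp_has_derivative
          bounded_linear_vec_nth bounded_linear_const_mult)
    from DERIV_compose_FDERIV[OF flat_has_derivative this, of m]
    have "((\<lambda>x. flat m (a * x $ j + c)) has_derivative
       (\<lambda>v. a * v $ j * (- real m * flat (Suc m) (a * x $ j + c) + flat (m + 2) (a * x $ j + c)))) (at x)" .
    from has_derivative_of_real[OF this, where 'a = complex]
    show "(?F m has_derivative ?d x) (at x)" by simp
  next
    fix v :: "real^3"
    show "C_k n (\<lambda>x. ?d x v)"
      by (intro C_k_mult C_k_add C_k_const Suc.IH)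
  qed
qed

definition box_bump :: "real^3 \<Rightarrow> real^3 \<Rightarrow> nat \<Rightarrow> real^3 \<Rightarrow> complex" where
  "box_bump l u n x = (\<Prod>j\<in>UNIV. complex_of_real (flat 0 (real n * x $ j + (- real n * l $ j))) *
      complex_of_real (flat 0 (- real n * x $ j + real n * u $ j)))"

lemma flat_bounds: "0 \<le> flat 0 x" "flat 0 x \<le> 1"
  by (auto simp: flat_def)

lemma norm_box_bump_le: "norm (box_bump l u n x) \<le> 1"
  unfolding box_bump_def prod_norm[symmetric]
  by (intro prod_le_1) (auto simp: norm_mult flat_bounds abs_of_nonneg mult_le_one)

lemma box_bump_eq_0:
  assumes "x \<notin> box l u"
  shows "box_bump l u n x = 0"
proof -
  from assms obtain j where "\<not> (l $ j < x $ j \<and> x $ j < u $ j)"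
    by (auto simp: mem_box_cart)
  hence "real n * x $ j + (- real n * l $ j) \<le> 0 \<or> - real n * x $ j + real n * u $ j \<le> 0"
    using mult_left_mono[of "x $ j" "l $ j" "real n"] mult_left_mono[of "u $ j" "x $ j" "real n"]
    by (simp add: not_less) linarith
  hence "flat 0 (real n * x $ j + (- real n * l $ j)) = 0 \<or> flat 0 (- real n * x $ j + real n * u $ j) = 0"
    by (auto simp: flat_def)
  thus ?thesis unfolding box_bump_def by (intro prod_zero) auto
qed

lemma flat_tendsto_1:
  assumes "y > 0"
  shows "(\<lambda>n. flat 0 (real n * y)) \<longlonglongrightarrow> 1"
proof -
  have "(\<lambda>n. exp (- (inverse (real n) * inverse y))) \<longlonglongrightarrow> exp (- (0 * inverse y))"
    by (intro tendsto_intros lim_inverse_n)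
  hence "(\<lambda>n. exp (- inverse (real n * y))) \<longlonglongrightarrow> 1"
    by (simp add: inverse_mult_distrib)
  thus ?thesis
    by (rule Lim_transform_eventually)
      (use assms in \<open>auto simp: flat_def eventually_at_top_linorder intro!: exI[of _ 1]\<close>)
qed

lemma box_bump_tendsto: "(\<lambda>n. box_bump l u n x) \<longlonglongrightarrow> indicator (box l u) x"
proof (cases "x \<in> box l u")
  case True
  have "(\<lambda>n. box_bump l u n x) \<longlonglongrightarrow> (\<Prod>j\<in>(UNIV::3 set). complex_of_real 1 * complex_of_real 1)"
    unfolding box_bump_def
  proof (intro tendsto_prod tendsto_mult tendsto_of_real)
    fix j :: 3
    have "x $ j - l $ j > 0" "u $ j - x $ j > 0"
      using True by (auto simp: mem_box_cart)
    from this[THEN flat_tendsto_1]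
    show "(\<lambda>n. flat 0 (real n * x $ j + (- real n * l $ j))) \<longlonglongrightarrow> 1"
      and "(\<lambda>n. flat 0 (- real n * x $ j + real n * u $ j)) \<longlonglongrightarrow> 1"
      by (auto simp: algebra_simps)
  qed
  thus ?thesis using True by simp
qed (simp add: box_bump_eq_0)

lemma test_function_box_bump: "test_function (box_bump l u n)"
proof -
  have "C_k k (box_bump l u n)" for k
    unfolding box_bump_def [abs_def] by (intro C_k_prod C_k_mult C_k_flat)
  moreover have "{x. box_bump l u n x \<noteq> 0} \<subseteq> box l u"
    using box_bump_eq_0 by blast
  ultimately show ?thesis
    using bounded_subset[OF bounded_box] by (auto simp: test_function_def smooth_def compact_closure)
qed


section \<open>Square integrable functions\<close>

definition square_integrable :: "(real^3 \<Rightarrow> complex) \<Rightarrow> bool" where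
  "square_integrable f \<longleftrightarrow> f \<in> borel_measurable lborel \<and> integrable lborel (\<lambda>x. (cmod (f x))\<^sup>2)"

lemma square_integrable_measurable:
  "square_integrable f \<Longrightarrow> f \<in> borel_measurable borel"
  by (simp add: square_integrable_def)

lemma square_integrable_bound:
  assumes "square_integrable f" "square_integrable g" "h \<in> borel_measurable borel"
    and "\<And>x. norm (h x) \<le> norm (f x) * norm (g x)"
  shows "integrable lborel (h :: real^3 \<Rightarrow> 'b::{banach,second_countable_topology})"
proof (rule Bochner_Integration.integrable_bound)
  show "integrable lborel (\<lambda>x. (cmod (f x))\<^sup>2 + (cmod (g x))\<^sup>2)"
    using assms by (auto simp: square_integrable_def)
  have "norm (h x) \<le> (cmod (f x))\<^sup>2 + (cmod (g x))\<^sup>2" for x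
    using assms(4)[of x] sum_squares_bound[of "cmod (f x)" "cmod (g x)"]
      mult_nonneg_nonneg[OF norm_ge_zero[of "f x"] norm_ge_zero[of "g x"]] by linarith
  thus "AE x in lborel. norm (h x) \<le> norm ((cmod (f x))\<^sup>2 + (cmod (g x))\<^sup>2)"
    by (auto simp: abs_of_nonneg)
qed (use assms in auto)

lemma square_integrable_mult:
  assumes "square_integrable f" "square_integrable g"
  shows "integrable lborel (\<lambda>x. f x * g x)"
  using assms(1,2)[THEN square_integrable_measurable]
  by (intro square_integrable_bound[OF assms]) (auto simp: norm_mult)

lemma square_integrable_inner:
  assumes "square_integrable f" "square_integrable g"
  shows "integrable lborel (\<lambda>x. f x \<bullet> g x)"
  using assms(1,2)[THEN square_integrable_measurable]
  by (intro square_integrable_bound[OF assms]) (auto simp: Cauchy_Schwarz_ineq2)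

lemma square_integrable_0: "square_integrable (\<lambda>x. 0)"
  by (simp add: square_integrable_def)

lemma square_integrable_scaleR:
  "square_integrable f \<Longrightarrow> square_integrable (\<lambda>x. c *\<^sub>R f x)"
  by (auto simp: square_integrable_def power_mult_distrib)

lemma square_integrable_add:
  assumes "square_integrable f" "square_integrable g"
  shows "square_integrable (\<lambda>x. f x + g x)"
proof -
  have [measurable]: "f \<in> borel_measurable borel" "g \<in> borel_measurable borel"
    using assms by (simp_all add: square_integrable_measurable)
  have "integrable lborel (\<lambda>x. (cmod (f x))\<^sup>2 + (cmod (g x))\<^sup>2 + 2 * (f x \<bullet> g x))"
    using assms square_integrable_inner[OF assms]
    by (intro Bochner_Integration.integrable_add) (auto simp: square_integrable_def)
  moreover have "(cmod (f x + g x))\<^sup>2 = (cmod (f x))\<^sup>2 + (cmod (g x))\<^sup>2 + 2 * (f x \<bullet> g x)" for x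
    by (simp add: power2_norm_eq_inner inner_add inner_commute)
  ultimately show ?thesis by (simp add: square_integrable_def)
qed

lemma square_integrable_uminus: "square_integrable f \<Longrightarrow> square_integrable (\<lambda>x. - f x)"
  by (auto simp: square_integrable_def)

lemma square_integrable_diff:
  "square_integrable f \<Longrightarrow> square_integrable g \<Longrightarrow> square_integrable (\<lambda>x. f x - g x)"
  using square_integrable_add[OF _ square_integrable_uminus, of f g] by simp

lemma square_integrable_compact_support:
  assumes "continuous_on UNIV f" "compact K" "\<And>x. x \<notin> K \<Longrightarrow> f x = 0"
  shows "square_integrable f"
proof -
  have "integrable lborel (\<lambda>x. indicator K x *\<^sub>R (cmod (f x))\<^sup>2)"
    using assms(1,2) by (intro borel_integrable_compact)
      (auto intro!: continuous_intros intro: continuous_on_subset)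
  moreover have "indicator K x *\<^sub>R (cmod (f x))\<^sup>2 = (cmod (f x))\<^sup>2" for x
    using assms(3) by (auto simp: indicator_def)
  ultimately have "integrable lborel (\<lambda>x. (cmod (f x))\<^sup>2)"
    by (simp only:)
  thus ?thesis
    using assms(1) by (simp add: square_integrable_def borel_measurable_continuous_onI)
qed

lemma test_function_derivative:
  assumes "test_function \<psi>"
  shows "square_integrable \<psi>" "square_integrable (\<lambda>x. frechet_derivative \<psi> (at x) v)"
proof -
  define K where "K = closure {x. \<psi> x \<noteq> 0}"
  have K: "compact K" "\<And>x. x \<notin> K \<Longrightarrow> \<psi> x = 0"
    using assms closure_subset[of "{x. \<psi> x \<noteq> 0}"] by (auto simp: K_def test_function_def)
  have C: "C_k 0 \<psi>" "C_k 1 \<psi>"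
    using assms by (auto simp: test_function_def smooth_def)
  show "square_integrable \<psi>"
    using C(1) K by (intro square_integrable_compact_support[of _ K]) auto
  have "frechet_derivative \<psi> (at x) v = 0" if "x \<notin> K" for x
  proof -
    have "(\<psi> has_derivative (\<lambda>_. 0)) (at x)"
      by (rule has_derivative_transform_within_open[of "\<lambda>_. 0" _ _ _ "- K"])
        (use that K in \<open>auto intro: compact_imp_closed\<close>)
    thus ?thesis by (metis frechet_derivative_at)
  qed
  thus "square_integrable (\<lambda>x. frechet_derivative \<psi> (at x) v)"
    using C(2) K by (intro square_integrable_compact_support[of _ K]) auto
qed

lemma AE_eq_0_if_box_integrals_0:
  fixes h :: "real^3 \<Rightarrow> real"
  assumes h [measurable]: "h \<in> borel_measurable borel"
    and int: "\<And>l u. integrable lborel (\<lambda>x. indicator (box l u) x * h x)"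
    and zero: "\<And>l u. (LINT x|lborel. indicator (box l u) x * h x) = 0"
  shows "AE x in lborel. h x = 0"
proof -
  have eq: "(\<integral>\<^sup>+x. ennreal (h x) * indicator (box l u) x \<partial>lborel)
        = (\<integral>\<^sup>+x. ennreal (- h x) * indicator (box l u) x \<partial>lborel)"
    and fin: "(\<integral>\<^sup>+x. ennreal (h x) * indicator (box l u) x \<partial>lborel) \<noteq> \<infinity>" for l u :: "real^3"
  proof -
    obtain r q where rq: "0 \<le> r" "0 \<le> q"
      "(\<integral>\<^sup>+x. ennreal (indicator (box l u) x * h x) \<partial>lborel) = ennreal r"
      "(\<integral>\<^sup>+x. ennreal (- (indicator (box l u) x * h x)) \<partial>lborel) = ennreal q"
      "(LINT x|lborel. indicator (box l u) x * h x) = r - q"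
      by (rule integrableE[OF int[of l u]])
    hence "r = q" using zero[of l u] by simp
    moreover have "ennreal (indicator (box l u) x * h x) = ennreal (h x) * indicator (box l u) x"
      "ennreal (- (indicator (box l u) x * h x)) = ennreal (- h x) * indicator (box l u) x" for x
      by (auto simp: indicator_def)
    ultimately show "(\<integral>\<^sup>+x. ennreal (h x) * indicator (box l u) x \<partial>lborel)
        = (\<integral>\<^sup>+x. ennreal (- h x) * indicator (box l u) x \<partial>lborel)"
      "(\<integral>\<^sup>+x. ennreal (h x) * indicator (box l u) x \<partial>lborel) \<noteq> \<infinity>"
      using rq(3,4) by (simp_all del: ennreal_indicator)
  qed
  have "density lborel (\<lambda>x. ennreal (h x)) = density lborel (\<lambda>x. ennreal (- h x))"
  proof (rule measure_eqI_generator_eq)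
    let ?E = "range (\<lambda>(a, b). box a b::(real^3) set)"
    show "Int_stable ?E"
      by (auto simp: Int_stable_def box_Int_box)
    show "?E \<subseteq> Pow UNIV" "sets (density lborel (\<lambda>x. ennreal (h x))) = sigma_sets UNIV ?E"
      "sets (density lborel (\<lambda>x. ennreal (- h x))) = sigma_sets UNIV ?E"
      by (simp_all add: borel_eq_box)
    let ?A = "\<lambda>n::nat. box (- (real n *\<^sub>R One)) (real n *\<^sub>R One) :: (real^3) set"
    show "range ?A \<subseteq> ?E" "(\<Union>i. ?A i) = UNIV"
      unfolding UN_box_eq_UNIV by auto
    show "emeasure (density lborel (\<lambda>x. ennreal (h x))) (?A i) \<noteq> \<infinity>" for i
      using fin by (simp add: emeasure_density)
    show "emeasure (density lborel (\<lambda>x. ennreal (h x))) X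
        = emeasure (density lborel (\<lambda>x. ennreal (- h x))) X" if "X \<in> ?E" for X
      using that eq by (auto simp: emeasure_density)
  qed
  hence "AE x in lborel. ennreal (h x) = ennreal (- h x)"
    by (intro sigma_finite_measure.density_unique[OF lborel.sigma_finite_measure_axioms]) auto
  thus ?thesis
  proof eventually_elim
    fix x assume "ennreal (h x) = ennreal (- h x)"
    thus "h x = 0"
      using ennreal_neg[of "h x"] ennreal_neg[of "- h x"] ennreal_eq_0_iff[of "h x"] ennreal_eq_0_iff[of "- h x"]
      by (cases "h x \<ge> 0") auto
  qed
qed

lemma AE_eq_0_if_test_integrals_0:
  assumes d: "square_integrable d"
    and zero: "\<And>\<psi>. test_function \<psi> \<Longrightarrow> (LINT x|lborel. d x * \<psi> x) = 0"
  shows "AE x in lborel. d x = 0"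
proof -
  have [measurable]: "d \<in> borel_measurable borel"
    using d by (rule square_integrable_measurable)
  have bump [measurable]: "box_bump l u n \<in> borel_measurable borel" for l u n
    using test_function_derivative(1)[OF test_function_box_bump]
    by (rule square_integrable_measurable)
  have sq: "square_integrable (indicator (box l u))" for l u
  proof -
    have "(cmod (indicator (box l u) x))\<^sup>2 = indicator (box l u) x" for x
      by (auto simp: indicator_def)
    moreover have "integrable lborel (indicator (box l u) :: real^3 \<Rightarrow> real)"
      by (rule integrable_real_indicator) (auto simp: emeasure_lborel_box_eq)
    ultimately show ?thesis by (simp add: square_integrable_def)
  qed
  have int: "integrable lborel (\<lambda>x. d x * indicator (box l u) x)" for l u
    using square_integrable_mult[OF d sq] .
  have lim: "(LINT x|lborel. d x * indicator (box l u) x) = 0" for l u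
  proof -
    have "(\<lambda>n. LINT x|lborel. d x * box_bump l u n x) \<longlonglongrightarrow> (LINT x|lborel. d x * indicator (box l u) x)"
    proof (rule integral_dominated_convergence)
      show "integrable lborel (\<lambda>x. norm (d x * indicator (box l u) x))"
        using int by (rule integrable_norm)
      have "norm (d x * box_bump l u n x) \<le> norm (d x * indicator (box l u) x)" for n x
        using norm_box_bump_le[of l u n x] box_bump_eq_0[of x l u n]
        by (cases "x \<in> box l u") (auto simp: norm_mult mult_left_le)
      thus "AE x in lborel. norm (d x * box_bump l u n x) \<le> norm (d x * indicator (box l u) x)" for n
        by simp
    qed (auto intro!: tendsto_intros box_bump_tendsto)
    thus ?thesis
      using zero[OF test_function_box_bump] LIMSEQ_unique[OF _ tendsto_const] by auto
  qed
  have R: "AE x in lborel. Re (d x) = 0"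
  proof (rule AE_eq_0_if_box_integrals_0)
    fix l u
    have eq: "indicator (box l u) x * Re (d x) = Re (d x * indicator (box l u) x)" for x
      by (auto simp: indicator_def)
    show "integrable lborel (\<lambda>x. indicator (box l u) x * Re (d x))"
      "(LINT x|lborel. indicator (box l u) x * Re (d x)) = 0"
      unfolding eq using integrable_Re[OF int] by (simp_all only: integral_Re[OF int] lim zero_complex.sel)
  qed auto
  have I: "AE x in lborel. Im (d x) = 0"
  proof (rule AE_eq_0_if_box_integrals_0)
    fix l u
    have eq: "indicator (box l u) x * Im (d x) = Im (d x * indicator (box l u) x)" for x
      by (auto simp: indicator_def)
    show "integrable lborel (\<lambda>x. indicator (box l u) x * Im (d x))"
      "(LINT x|lborel. indicator (box l u) x * Im (d x)) = 0"
      unfolding eq using integrable_Im[OF int] by (simp_all only: integral_Im[OF int] lim zero_complex.sel)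
  qed auto
  from R I show ?thesis by eventually_elim (simp add: complex_eq_iff)
qed

section \<open>The Hilbert space of square integrable functions\<close>

definition ae_eq :: "(real^3 \<Rightarrow> complex) \<Rightarrow> (real^3 \<Rightarrow> complex) \<Rightarrow> bool" where
  "ae_eq f g \<longleftrightarrow> square_integrable f \<and> square_integrable g \<and> (AE x in lborel. f x = g x)"

lemma ae_eqI: "square_integrable f \<Longrightarrow> square_integrable g \<Longrightarrow> AE x in lborel. f x = g x \<Longrightarrow> ae_eq f g"
  by (simp add: ae_eq_def)

quotient_type l2 = "real^3 \<Rightarrow> complex" / partial: ae_eq
proof (rule part_equivpI)
  show "\<exists>f. ae_eq f f" by (auto intro!: exI[of _ "\<lambda>_. 0"] ae_eqI square_integrable_0)
  show "symp ae_eq" by (auto simp: symp_def ae_eq_def)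
  show "transp ae_eq"
  proof (rule transpI)
    fix f g h assume fg: "ae_eq f g" and gh: "ae_eq g h"
    hence "AE x in lborel. f x = g x" "AE x in lborel. g x = h x" by (auto simp: ae_eq_def)
    hence "AE x in lborel. f x = h x" by eventually_elim simp
    with fg gh show "ae_eq f h" by (auto simp: ae_eq_def)
  qed
qed

lemma square_integrable_rep: "square_integrable (rep_l2 f)"
  using Quotient3_rep_reflp[OF Quotient3_l2, of f] by (simp add: ae_eq_def)

lemma rep_abs_l2: "square_integrable f \<Longrightarrow> AE x in lborel. rep_l2 (abs_l2 f) x = f x"
  using rep_abs_rsp_left[OF Quotient3_l2, of f f] by (simp add: ae_eq_def)

lemma abs_rep_l2: "abs_l2 (rep_l2 f) = f"
  by (rule Quotient3_abs_rep[OF Quotient3_l2])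

instantiation l2 :: real_inner
begin

lift_definition zero_l2 :: l2 is "\<lambda>x. 0"
  by (auto intro!: ae_eqI square_integrable_0)

lift_definition plus_l2 :: "l2 \<Rightarrow> l2 \<Rightarrow> l2" is "\<lambda>f g x. f x + g x"
  by (auto simp: ae_eq_def square_integrable_add)

lift_definition uminus_l2 :: "l2 \<Rightarrow> l2" is "\<lambda>f x. - f x"
  by (auto simp: ae_eq_def square_integrable_uminus)

lift_definition minus_l2 :: "l2 \<Rightarrow> l2 \<Rightarrow> l2" is "\<lambda>f g x. f x - g x"
  by (auto simp: ae_eq_def square_integrable_diff)

lift_definition scaleR_l2 :: "real \<Rightarrow> l2 \<Rightarrow> l2" is "\<lambda>c f x. c *\<^sub>R f x"
  by (auto simp: ae_eq_def square_integrable_scaleR)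

(* On the complex numbers, \<bullet> is the real inner product Re (z * cnj w). *)
lift_definition inner_l2 :: "l2 \<Rightarrow> l2 \<Rightarrow> real" is "\<lambda>f g. LINT x|lborel. f x \<bullet> g x"
proof -
  fix f f' g g' assume *: "ae_eq f f'" "ae_eq g g'"
  hence [measurable]: "f \<in> borel_measurable borel" "f' \<in> borel_measurable borel"
    "g \<in> borel_measurable borel" "g' \<in> borel_measurable borel"
    by (auto simp: ae_eq_def square_integrable_measurable)
  from * have "AE x in lborel. f x = f' x" "AE x in lborel. g x = g' x"
    by (auto simp: ae_eq_def)
  hence "AE x in lborel. f x \<bullet> g x = f' x \<bullet> g' x" by eventually_elim simp
  thus "(LINT x|lborel. f x \<bullet> g x) = (LINT x|lborel. f' x \<bullet> g' x)"
    by (intro integral_cong_AE) auto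
qed

definition "norm_l2 (f::l2) = sqrt (f \<bullet> f)"
definition "dist_l2 (f::l2) g = norm (f - g)"
definition "sgn_l2 (f::l2) = inverse (norm f) *\<^sub>R f"
definition "(uniformity :: (l2 \<times> l2) filter) = (INF e\<in>{0<..}. principal {(f, g). dist f g < e})"
definition "open_l2 (U :: l2 set) \<longleftrightarrow> (\<forall>f\<in>U. eventually (\<lambda>(f', g). f' = f \<longrightarrow> g \<in> U) uniformity)"

instance
proof
  fix f g h :: l2 and a b :: real
  show "f + g + h = f + (g + h)"
    by transfer (auto intro!: ae_eqI square_integrable_add simp: ae_eq_def add_ac)
  show "f + g = g + f"
    by transfer (auto intro!: ae_eqI square_integrable_add simp: ae_eq_def add_ac)
  show "0 + f = f"
    by transfer (auto simp: ae_eq_def)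
  show "- f + f = 0"
    by transfer (auto simp: ae_eq_def square_integrable_0)
  show "f - g = f + - g"
    by transfer (auto simp: ae_eq_def square_integrable_diff)
  show "a *\<^sub>R (f + g) = a *\<^sub>R f + a *\<^sub>R g"
    by transfer (auto simp: ae_eq_def scaleR_right_distrib intro!: square_integrable_add square_integrable_scaleR
        simp del: scaleR_conv_of_real)
  show "(a + b) *\<^sub>R f = a *\<^sub>R f + b *\<^sub>R f"
    by transfer (auto simp: ae_eq_def scaleR_left_distrib intro!: square_integrable_add square_integrable_scaleR)
  show "a *\<^sub>R b *\<^sub>R f = (a * b) *\<^sub>R f"
    by transfer (auto simp: ae_eq_def intro: square_integrable_scaleR)
  show "1 *\<^sub>R f = f"
    by transfer (auto simp: ae_eq_def)
  show "f \<bullet> g = g \<bullet> f"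
    by transfer (simp add: inner_commute)
  show "(f + g) \<bullet> h = f \<bullet> h + g \<bullet> h"
    by transfer (simp add: ae_eq_def inner_add_left square_integrable_inner)
  show "(a *\<^sub>R f) \<bullet> g = a * (f \<bullet> g)"
    by transfer simp
  show "0 \<le> f \<bullet> f"
    by transfer simp
  show "f \<bullet> f = 0 \<longleftrightarrow> f = 0"
    by transfer (simp add: ae_eq_def integral_nonneg_eq_0_iff_AE square_integrable_inner square_integrable_0)
qed (simp_all add: norm_l2_def dist_l2_def sgn_l2_def uniformity_l2_def open_l2_def)

end

lemma rep_l2_add: "AE x in lborel. rep_l2 (f + g) x = rep_l2 f x + rep_l2 g x"
proof -
  have "f + g = abs_l2 (\<lambda>x. rep_l2 f x + rep_l2 g x)"
    using plus_l2.abs_eq[of "rep_l2 f" "rep_l2 g"]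
    by (simp add: abs_rep_l2 ae_eq_def square_integrable_rep)
  thus ?thesis
    using rep_abs_l2[OF square_integrable_add[OF square_integrable_rep square_integrable_rep]] by simp
qed

lemma rep_l2_scaleR: "AE x in lborel. rep_l2 (c *\<^sub>R f) x = c *\<^sub>R rep_l2 f x"
proof -
  have "c *\<^sub>R f = abs_l2 (\<lambda>x. c *\<^sub>R rep_l2 f x)"
    using scaleR_l2.abs_eq[of "rep_l2 f" c]
    by (simp add: abs_rep_l2 ae_eq_def square_integrable_rep)
  thus ?thesis
    using rep_abs_l2[OF square_integrable_scaleR[OF square_integrable_rep]] by simp
qed

lemma l2_eqI: "AE x in lborel. rep_l2 f x = rep_l2 g x \<Longrightarrow> f = g"
  using Quotient3_rel_rep[OF Quotient3_l2, of f g] by (simp add: ae_eq_def square_integrable_rep)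

lemma integral_rep_l2_add:
  assumes "square_integrable \<psi>"
  shows "(LINT x|lborel. rep_l2 (f + g) x * \<psi> x) = (LINT x|lborel. rep_l2 f x * \<psi> x) + (LINT x|lborel. rep_l2 g x * \<psi> x)"
proof -
  note [measurable] = square_integrable_measurable[OF assms] square_integrable_measurable[OF square_integrable_rep]
  have "AE x in lborel. rep_l2 (f + g) x * \<psi> x = rep_l2 f x * \<psi> x + rep_l2 g x * \<psi> x"
    using rep_l2_add[of f g] by eventually_elim (simp add: algebra_simps)
  hence "(LINT x|lborel. rep_l2 (f + g) x * \<psi> x) = (LINT x|lborel. rep_l2 f x * \<psi> x + rep_l2 g x * \<psi> x)"
    by (intro integral_cong_AE) auto
  also have "\<dots> = (LINT x|lborel. rep_l2 f x * \<psi> x) + (LINT x|lborel. rep_l2 g x * \<psi> x)"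
    using square_integrable_mult[OF square_integrable_rep assms]
    by (intro Bochner_Integration.integral_add)
  finally show ?thesis .
qed

lemma integral_rep_l2_scaleR:
  assumes "square_integrable \<psi>"
  shows "(LINT x|lborel. rep_l2 (c *\<^sub>R f) x * \<psi> x) = c *\<^sub>R (LINT x|lborel. rep_l2 f x * \<psi> x)"
proof -
  note [measurable] = square_integrable_measurable[OF assms] square_integrable_measurable[OF square_integrable_rep]
  have "AE x in lborel. rep_l2 (c *\<^sub>R f) x * \<psi> x = c *\<^sub>R (rep_l2 f x * \<psi> x)"
    using rep_l2_scaleR[of c f] by eventually_elim simp
  hence "(LINT x|lborel. rep_l2 (c *\<^sub>R f) x * \<psi> x) = (LINT x|lborel. c *\<^sub>R (rep_l2 f x * \<psi> x))"
    by (intro integral_cong_AE) auto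
  thus ?thesis by simp
qed

section \<open>The Sobolev space\<close>

definition weak_partial :: "3 \<Rightarrow> l2 \<Rightarrow> l2 \<Rightarrow> bool" where
  "weak_partial j f g \<longleftrightarrow> (\<forall>\<psi>. test_function \<psi> \<longrightarrow>
     (LINT x|lborel. rep_l2 f x * frechet_derivative \<psi> (at x) (axis j 1))
       = - (LINT x|lborel. rep_l2 g x * \<psi> x))"

lemma weak_partial_add:
  "weak_partial j f g \<Longrightarrow> weak_partial j f' g' \<Longrightarrow> weak_partial j (f + f') (g + g')"
  by (simp add: weak_partial_def integral_rep_l2_add test_function_derivative)

lemma weak_partial_scaleR: "weak_partial j f g \<Longrightarrow> weak_partial j (c *\<^sub>R f) (c *\<^sub>R g)"
  by (simp add: weak_partial_def integral_rep_l2_scaleR test_function_derivative)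

lemma weak_partial_0: "weak_partial j 0 0"
  using integral_rep_l2_scaleR[of _ 0 0] by (simp add: weak_partial_def test_function_derivative)

lemma weak_partial_unique:
  assumes "weak_partial j f g" "weak_partial j f g'"
  shows "g = g'"
proof (rule l2_eqI)
  have "(LINT x|lborel. (rep_l2 g x - rep_l2 g' x) * \<psi> x) = 0" if "test_function \<psi>" for \<psi>
  proof -
    have "(LINT x|lborel. rep_l2 g x * \<psi> x) = (LINT x|lborel. rep_l2 g' x * \<psi> x)"
      using assms that by (simp add: weak_partial_def)
    thus ?thesis
      using square_integrable_mult[OF square_integrable_rep test_function_derivative(1)[OF that]]
      by (simp add: left_diff_distrib)
  qed
  hence "AE x in lborel. rep_l2 g x - rep_l2 g' x = 0"
    by (intro AE_eq_0_if_test_integrals_0 square_integrable_diff square_integrable_rep)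
  thus "AE x in lborel. rep_l2 g x = rep_l2 g' x" by simp
qed

typedef h1 = "{f :: l2. \<forall>j. \<exists>g. weak_partial j f g}"
  morphisms l2_of_h1 h1_of_l2
  using weak_partial_0 by blast

setup_lifting type_definition_h1

definition partial :: "3 \<Rightarrow> h1 \<Rightarrow> l2" where
  "partial j f = (THE g. weak_partial j (l2_of_h1 f) g)"

lemma weak_partial_partial: "weak_partial j (l2_of_h1 f) (partial j f)"
proof -
  obtain g where "weak_partial j (l2_of_h1 f) g"
    using l2_of_h1[of f] by blast
  thus ?thesis
    unfolding partial_def by (rule theI) (use \<open>weak_partial j (l2_of_h1 f) g\<close> weak_partial_unique in blast)
qed

lemma partial_eqI: "weak_partial j (l2_of_h1 f) g \<Longrightarrow> partial j f = g"
  using weak_partial_partial weak_partial_unique by blast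

instantiation h1 :: real_inner
begin

lift_definition zero_h1 :: h1 is 0
  using weak_partial_0 by blast

lift_definition plus_h1 :: "h1 \<Rightarrow> h1 \<Rightarrow> h1" is "(+)"
  using weak_partial_add by blast

lift_definition scaleR_h1 :: "real \<Rightarrow> h1 \<Rightarrow> h1" is "(*\<^sub>R)"
  using weak_partial_scaleR by blast

lift_definition uminus_h1 :: "h1 \<Rightarrow> h1" is uminus
  using weak_partial_scaleR[of _ _ _ "-1"] by fastforce

lift_definition minus_h1 :: "h1 \<Rightarrow> h1 \<Rightarrow> h1" is "(-)"
  using weak_partial_add weak_partial_scaleR[of _ _ _ "-1"] by fastforce

definition "inner_h1 f g = l2_of_h1 f \<bullet> l2_of_h1 g + (\<Sum>j\<in>UNIV. partial j f \<bullet> partial j g)"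
definition "norm_h1 (f::h1) = sqrt (f \<bullet> f)"
definition "dist_h1 (f::h1) g = norm (f - g)"
definition "sgn_h1 (f::h1) = inverse (norm f) *\<^sub>R f"
definition "(uniformity :: (h1 \<times> h1) filter) = (INF e\<in>{0<..}. principal {(f, g). dist f g < e})"
definition "open_h1 (U :: h1 set) \<longleftrightarrow> (\<forall>f\<in>U. eventually (\<lambda>(f', g). f' = f \<longrightarrow> g \<in> U) uniformity)"

lemma partial_add: "partial j (f + g) = partial j f + partial j g"
  by (rule partial_eqI) (simp add: plus_h1.rep_eq weak_partial_add weak_partial_partial)

lemma partial_scaleR: "partial j (c *\<^sub>R f) = c *\<^sub>R partial j f"
  by (rule partial_eqI) (simp add: scaleR_h1.rep_eq weak_partial_scaleR weak_partial_partial)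

instance
proof
  fix f g h :: h1 and a b :: real
  show "f + g + h = f + (g + h)" by transfer simp
  show "f + g = g + f" by transfer simp
  show "0 + f = f" by transfer simp
  show "- f + f = 0" by transfer simp
  show "f - g = f + - g" by transfer simp
  show "a *\<^sub>R (f + g) = a *\<^sub>R f + a *\<^sub>R g" by transfer (simp add: scaleR_right_distrib)
  show "(a + b) *\<^sub>R f = a *\<^sub>R f + b *\<^sub>R f" by transfer (simp add: scaleR_left_distrib)
  show "a *\<^sub>R b *\<^sub>R f = (a * b) *\<^sub>R f" by transfer simp
  show "1 *\<^sub>R f = f" by transfer simp
  show "f \<bullet> g = g \<bullet> f" by (simp add: inner_h1_def inner_commute)
  show "(f + g) \<bullet> h = f \<bullet> h + g \<bullet> h"
    by (simp add: inner_h1_def partial_add plus_h1.rep_eq inner_add_left sum.distrib)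
  show "(a *\<^sub>R f) \<bullet> g = a * (f \<bullet> g)"
    by (simp add: inner_h1_def partial_scaleR scaleR_h1.rep_eq distrib_left sum_distrib_left)
  show "0 \<le> f \<bullet> f"
    by (simp add: inner_h1_def sum_nonneg)
  show "f \<bullet> f = 0 \<longleftrightarrow> f = 0"
  proof
    assume "f \<bullet> f = 0"
    hence "l2_of_h1 f \<bullet> l2_of_h1 f = 0"
      unfolding inner_h1_def
      by (smt (verit) inner_ge_zero sum_nonneg)
    thus "f = 0" by (simp add: zero_h1.rep_eq flip: l2_of_h1_inject)
  next
    assume "f = 0"
    moreover have "partial j 0 = 0" for j
      by (rule partial_eqI) (simp add: zero_h1.rep_eq weak_partial_0)
    ultimately show "f \<bullet> f = 0" by (simp add: inner_h1_def zero_h1.rep_eq)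
  qed
qed (simp_all add: norm_h1_def dist_h1_def sgn_h1_def uniformity_h1_def open_h1_def)

end

section \<open>The linear controlled Schroedinger equation\<close>

(* Only meaningful when the product is square integrable (for h1_mult: in the Sobolev space),
   as it is for bounded measurable m (for h1_mult: bounded smooth m with bounded gradient). *)
definition l2_mult :: "(real^3 \<Rightarrow> complex) \<Rightarrow> l2 \<Rightarrow> l2" where
  "l2_mult m f = abs_l2 (\<lambda>x. m x * rep_l2 f x)"

definition h1_mult :: "(real^3 \<Rightarrow> complex) \<Rightarrow> h1 \<Rightarrow> h1" where
  "h1_mult m f = h1_of_l2 (l2_mult m (l2_of_h1 f))"

(* The Fourier transform (s = -1) and its inverse (s = 1) of a square integrable function, as the
   mean square limit of the integrals over expanding balls. *)
definition fourier_sign :: "real \<Rightarrow> l2 \<Rightarrow> l2" where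
  "fourier_sign s f = lim (\<lambda>n. abs_l2 (\<lambda>\<xi>. of_real ((2 * pi) powr (- 3 / 2)) *
     (LINT x:ball 0 (real n)|lborel. rep_l2 f x * cis (s * (x \<bullet> \<xi>)))))"

definition fourier :: "l2 \<Rightarrow> l2" where
  "fourier = fourier_sign (- 1)"

definition inverse_fourier :: "l2 \<Rightarrow> l2" where
  "inverse_fourier = fourier_sign 1"

definition schroedinger_group :: "real \<Rightarrow> h1 \<Rightarrow> h1" where
  "schroedinger_group t f =
     h1_of_l2 (inverse_fourier (l2_mult (\<lambda>\<xi>. cis (- t * (norm \<xi>)\<^sup>2)) (fourier (l2_of_h1 f))))"

(* Mild (Duhamel) solution of i u' + \<Delta>u = \<phi> h, u(0) = u\<^sub>0, with the integral taken in the Sobolev space.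
   Only the values u t for t \<ge> 0 are constrained. *)
definition is_solution :: "(real^3 \<Rightarrow> real) \<Rightarrow> h1 \<Rightarrow> (real \<Rightarrow> h1) \<Rightarrow> (real \<Rightarrow> h1) \<Rightarrow> bool" where
  "is_solution \<phi> u\<^sub>0 h u \<longleftrightarrow> continuous_on {0..} u \<and>
     (\<forall>t\<ge>0. \<exists>I. ((\<lambda>\<tau>. schroedinger_group (t - \<tau>) (h1_mult (\<lambda>x. of_real (\<phi> x)) (h \<tau>)))
                    has_integral I) {0..t} \<and>
       u t = schroedinger_group t u\<^sub>0 - h1_mult (\<lambda>_. \<i>) I)"

lemma is_solution_unique:
  assumes "is_solution \<phi> u\<^sub>0 h u" "is_solution \<phi> u\<^sub>0 h v" "t \<ge> 0"
  shows "u t = v t"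
  using assms unfolding is_solution_def by (metis has_integral_unique)

(* The complement of the largest open subset of space-time on which h vanishes.  For h continuous
   into the Sobolev space, vanishing almost everywhere on an open set U amounts to every
   time slice h s vanishing almost everywhere on the corresponding slice of U. *)
definition spacetime_support :: "(real \<Rightarrow> h1) \<Rightarrow> (real \<times> (real^3)) set" where
  "spacetime_support h =
     - \<Union>{U. open U \<and> (\<forall>s. AE x in lborel. (s, x) \<in> U \<longrightarrow> rep_l2 (l2_of_h1 (h s)) x = 0)}"

end

theory Submission
  imports Defs "HOL-Complex_Analysis.Complex_Analysis" "HOL-Probability.Probability"
begin

text \<open>
  With \<open>\<kappa> = 1 - \<phi>\<^sup>2\<close> and the control \<open>h(t) = - \<i> \<phi> e\<^sup>i\<^sup>t\<^sup>\<Delta> g / T\<close>, Duhamel's formula shows that \<open>u(T) = 0\<close> is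
  equivalent to \<open>g - A g = u\<^sub>0\<close>, where \<open>A\<close> is the mean of \<open>e\<^sup>-\<^sup>i\<^sup>t\<^sup>\<Delta> \<kappa> e\<^sup>i\<^sup>t\<^sup>\<Delta>\<close> over \<open>0 \<le> t \<le> T\<close>. As \<open>\<kappa>\<close> is
  supported in a ball \<open>B\<close>, the equation is solved by a Neumann series once \<open>A\<close> is a contraction.

  On \<open>L\<^sup>2\<close> this follows, by pairing the times \<open>t\<close> and \<open>t + T/2\<close>, from an uncertainty principle: a unit vector
  \<open>w\<close> cannot be almost concentrated on \<open>B\<close> together with \<open>e\<^sup>i\<^sup>s\<^sup>\<Delta> w\<close>, \<open>s = T/2\<close>. Indeed \<open>1\<^sub>B e\<^sup>i\<^sup>s\<^sup>\<Delta> 1\<^sub>B\<close> has a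
  smooth kernel and is compact, so otherwise there would be \<open>w \<noteq> 0\<close> with both \<open>w\<close> and \<open>e\<^sup>i\<^sup>s\<^sup>\<Delta> w\<close> supported in
  \<open>B\<close>. But up to unimodular factors and a dilation \<open>e\<^sup>i\<^sup>s\<^sup>\<Delta> w\<close> is the Fourier transform of a function
  supported in \<open>B\<close>, which is entire and cannot vanish outside a ball.

  Since \<open>\<partial>\<^sub>j\<close> commutes with \<open>A\<close> up to an operator bounded on \<open>L\<^sup>2\<close>, the contraction property carries over to
  \<open>H\<^sup>1\<close> with the norm \<open>\<parallel>f\<parallel> + \<delta> \<Sum>\<^sub>j \<parallel>\<partial>\<^sub>j f\<parallel>\<close> for small \<open>\<delta>\<close>.
\<close>

section \<open>Square integrable functions\<close>

text \<open>The control is the one of the Hilbert uniqueness method. The equation supplies one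
  factor \<phi>, and the support condition puts a second one into h; together they give \<phi>^2 = 1
  - \<kappa>, and g solves the Gramian equation. At a single time the conjugated multiplication by
  \<kappa> has norm one, since \<kappa> = 1 on the ball of radius R; only a combination of different
  times can contract. The constant comes from compactness, so it is not explicit and may depend on
  R, T and \<phi>. The two-time estimate lives in L^2, but h must take values in H^1, which is why
  the Gramian equation has to be solved there. The transform on L^2 is given only as a mean square
  limit, and H^1 only through test integrals, so Plancherel, inversion and the symbol of a weak
  derivative come first. One regularization serves for most of this: insert exp(-z |\<xi>|^2) with
  Re z > 0, exchange the integrals, and move z to the boundary. The limit z = 0 yields Fourier
  inversion, z = it the Schroedinger kernel.\<close>

lemma abs_l2_eqI:
  "square_integrable f \<Longrightarrow> square_integrable g \<Longrightarrow> AE x in lborel. f x = g x \<Longrightarrow> abs_l2 f = abs_l2 g"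
  by (rule Quotient3_rel_abs[OF Quotient3_l2]) (rule ae_eqI)

lemma abs_l2_add:
  "square_integrable f \<Longrightarrow> square_integrable g \<Longrightarrow> abs_l2 f + abs_l2 g = abs_l2 (\<lambda>x. f x + g x)"
  by (rule plus_l2.abs_eq) (simp_all add: ae_eq_def)

lemma abs_l2_diff:
  "square_integrable f \<Longrightarrow> square_integrable g \<Longrightarrow> abs_l2 f - abs_l2 g = abs_l2 (\<lambda>x. f x - g x)"
  by (rule minus_l2.abs_eq) (simp_all add: ae_eq_def)

lemma abs_l2_scaleR: "square_integrable f \<Longrightarrow> c *\<^sub>R abs_l2 f = abs_l2 (\<lambda>x. c *\<^sub>R f x)"
  by (rule scaleR_l2.abs_eq) (simp_all add: ae_eq_def)

lemma measurable_rep_l2 [measurable]: "rep_l2 f \<in> borel_measurable borel"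
  by (rule square_integrable_measurable[OF square_integrable_rep])

lemma inner_abs_l2:
  "square_integrable f \<Longrightarrow> square_integrable g \<Longrightarrow> abs_l2 f \<bullet> abs_l2 g = (LINT x|lborel. f x \<bullet> g x)"
  by (rule inner_l2.abs_eq) (simp_all add: ae_eq_def)

lemma norm_abs_l2_sq: "square_integrable f \<Longrightarrow> (norm (abs_l2 f))\<^sup>2 = (LINT x|lborel. (cmod (f x))\<^sup>2)"
  by (simp add: power2_norm_eq_inner inner_abs_l2)

lemma norm_l2_sq: "(norm f)\<^sup>2 = (LINT x|lborel. (cmod (rep_l2 f x))\<^sup>2)"
  using norm_abs_l2_sq[OF square_integrable_rep] by (simp add: abs_rep_l2)

lemma nn_integral_norm_abs_l2:
  assumes "square_integrable f"
  shows "(\<integral>\<^sup>+x. ennreal ((cmod (f x))\<^sup>2) \<partial>lborel) = ennreal ((norm (abs_l2 f))\<^sup>2)"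
  unfolding norm_abs_l2_sq[OF assms]
  using assms by (intro nn_integral_eq_integral) (auto simp: square_integrable_def)

lemma square_integrable_nnI:
  assumes "f \<in> borel_measurable borel" "(\<integral>\<^sup>+x. ennreal ((cmod (f x))\<^sup>2) \<partial>lborel) \<le> ennreal C"
  shows "square_integrable f"
  unfolding square_integrable_def
proof (intro conjI integrableI_bounded)
  have "(\<integral>\<^sup>+x. ennreal (norm ((cmod (f x))\<^sup>2)) \<partial>lborel) \<le> ennreal C" using assms(2) by simp
  thus "(\<integral>\<^sup>+x. ennreal (norm ((cmod (f x))\<^sup>2)) \<partial>lborel) < \<infinity>"
    by (rule le_less_trans) simp
qed (use assms in auto)

lemma norm_abs_l2_le:
  assumes "f \<in> borel_measurable borel" "(\<integral>\<^sup>+x. ennreal ((cmod (f x))\<^sup>2) \<partial>lborel) \<le> ennreal (C\<^sup>2)" "C \<ge> 0"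
  shows "square_integrable f" "norm (abs_l2 f) \<le> C"
proof -
  show si: "square_integrable f" using assms(1,2) by (rule square_integrable_nnI)
  have "(norm (abs_l2 f))\<^sup>2 \<le> C\<^sup>2"
    using assms(2) unfolding nn_integral_norm_abs_l2[OF si] by simp
  thus "norm (abs_l2 f) \<le> C" using assms(3) by (rule power2_le_imp_le)
qed

lemma square_integrable_bounded_by:
  assumes "square_integrable w" "f \<in> borel_measurable borel" "AE x in lborel. cmod (f x) \<le> C * cmod (w x)"
  shows "square_integrable f"
  unfolding square_integrable_def
proof
  show "integrable lborel (\<lambda>x. (cmod (f x))\<^sup>2)"
  proof (rule Bochner_Integration.integrable_bound)
    show "integrable lborel (\<lambda>x. C\<^sup>2 * (cmod (w x))\<^sup>2)" using assms(1) by (simp add: square_integrable_def)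
    show "AE x in lborel. norm ((cmod (f x))\<^sup>2) \<le> norm (C\<^sup>2 * (cmod (w x))\<^sup>2)"
      using assms(3)
    proof eventually_elim
      case (elim x)
      hence "(cmod (f x))\<^sup>2 \<le> (C * cmod (w x))\<^sup>2" by (rule power_mono) simp
      thus ?case by (simp add: power_mult_distrib)
    qed
  qed (use assms in auto)
qed (use assms in auto)

lemma norm_abs_l2_mono:
  assumes "square_integrable f" "square_integrable g" "AE x in lborel. cmod (f x) \<le> C * cmod (g x)" "C \<ge> 0"
  shows "norm (abs_l2 f) \<le> C * norm (abs_l2 g)"
proof -
  have "(LINT x|lborel. (cmod (f x))\<^sup>2) \<le> (LINT x|lborel. C\<^sup>2 * (cmod (g x))\<^sup>2)"
  proof (rule integral_mono_AE)
    show "AE x in lborel. (cmod (f x))\<^sup>2 \<le> C\<^sup>2 * (cmod (g x))\<^sup>2"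
      using assms(3)
    proof eventually_elim
      case (elim x)
      hence "(cmod (f x))\<^sup>2 \<le> (C * cmod (g x))\<^sup>2" by (rule power_mono) simp
      thus ?case by (simp add: power_mult_distrib)
    qed
  qed (use assms in \<open>auto simp: square_integrable_def\<close>)
  hence "(norm (abs_l2 f))\<^sup>2 \<le> (C * norm (abs_l2 g))\<^sup>2"
    using assms by (simp add: norm_abs_l2_sq power_mult_distrib)
  thus ?thesis by (rule power2_le_imp_le) (use assms in auto)
qed

lemma nn_integral_diff_l2:
  "(\<integral>\<^sup>+x. ennreal ((cmod (rep_l2 f x - rep_l2 g x))\<^sup>2) \<partial>lborel) = ennreal ((norm (f - g))\<^sup>2)"
proof -
  have "f - g = abs_l2 (\<lambda>x. rep_l2 f x - rep_l2 g x)"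
    using abs_l2_diff[OF square_integrable_rep[of f] square_integrable_rep[of g]] by (simp add: abs_rep_l2)
  thus ?thesis
    using nn_integral_norm_abs_l2[OF square_integrable_diff[OF square_integrable_rep[of f] square_integrable_rep[of g]]]
    by simp
qed

lemma l2_tendsto_AE_unique:
  assumes X: "(\<lambda>n. abs_l2 (f n)) \<longlonglongrightarrow> Y" and si: "\<And>n. square_integrable (f n)"
    and ae: "AE x in lborel. (\<lambda>n. f n x) \<longlonglongrightarrow> g x" and [measurable]: "g \<in> borel_measurable borel"
  shows "square_integrable g" "Y = abs_l2 g"
proof -
  have [measurable]: "f n \<in> borel_measurable borel" for n using si by (rule square_integrable_measurable)
  have "(\<integral>\<^sup>+x. ennreal ((cmod (g x - rep_l2 Y x))\<^sup>2) \<partial>lborel)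
      = (\<integral>\<^sup>+x. liminf (\<lambda>n. ennreal ((cmod (f n x - rep_l2 Y x))\<^sup>2)) \<partial>lborel)"
  proof (rule nn_integral_cong_AE)
    show "AE x in lborel. ennreal ((cmod (g x - rep_l2 Y x))\<^sup>2) = liminf (\<lambda>n. ennreal ((cmod (f n x - rep_l2 Y x))\<^sup>2))"
      using ae
    proof eventually_elim
      case (elim x)
      have "(\<lambda>n. ennreal ((cmod (f n x - rep_l2 Y x))\<^sup>2)) \<longlonglongrightarrow> ennreal ((cmod (g x - rep_l2 Y x))\<^sup>2)"
        by (intro tendsto_ennrealI tendsto_intros elim)
      from lim_imp_Liminf[OF sequentially_bot this] show ?case by (rule sym)
    qed
  qed
  also have "\<dots> \<le> liminf (\<lambda>n. \<integral>\<^sup>+x. ennreal ((cmod (f n x - rep_l2 Y x))\<^sup>2) \<partial>lborel)"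
    by (rule nn_integral_liminf) simp
  also have "(\<lambda>n. \<integral>\<^sup>+x. ennreal ((cmod (f n x - rep_l2 Y x))\<^sup>2) \<partial>lborel)
      = (\<lambda>n. ennreal ((norm (abs_l2 (f n) - Y))\<^sup>2))"
  proof
    fix n
    have "abs_l2 (f n) - Y = abs_l2 (\<lambda>x. f n x - rep_l2 Y x)"
      using abs_l2_diff[OF si[of n] square_integrable_rep[of Y]] by (simp add: abs_rep_l2)
    thus "(\<integral>\<^sup>+x. ennreal ((cmod (f n x - rep_l2 Y x))\<^sup>2) \<partial>lborel) = ennreal ((norm (abs_l2 (f n) - Y))\<^sup>2)"
      by (simp add: nn_integral_norm_abs_l2 square_integrable_diff si square_integrable_rep)
  qed
  also have "liminf \<dots> = ennreal 0"
  proof (rule lim_imp_Liminf)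
    have "(\<lambda>n. ennreal ((norm (abs_l2 (f n) - Y))\<^sup>2)) \<longlonglongrightarrow> ennreal ((norm (Y - Y))\<^sup>2)"
      by (intro tendsto_ennrealI tendsto_intros X)
    thus "(\<lambda>n. ennreal ((norm (abs_l2 (f n) - Y))\<^sup>2)) \<longlonglongrightarrow> ennreal 0" by simp
  qed simp
  finally have "(\<integral>\<^sup>+x. ennreal ((cmod (g x - rep_l2 Y x))\<^sup>2) \<partial>lborel) = 0" by simp
  hence "AE x in lborel. ennreal ((cmod (g x - rep_l2 Y x))\<^sup>2) = 0"
    by (subst (asm) nn_integral_0_iff_AE) auto
  hence eq: "AE x in lborel. g x = rep_l2 Y x"
    by eventually_elim simp
  show "square_integrable g"
    by (rule square_integrable_bounded_by[OF square_integrable_rep[of Y], of _ 1]) (use eq in auto)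
  with eq show "Y = abs_l2 g"
    using abs_l2_eqI[of g "rep_l2 Y"] square_integrable_rep by (simp add: abs_rep_l2)
qed

lemma l2_dominated_convergence:
  assumes w: "square_integrable w" and [measurable]: "\<And>n. f n \<in> borel_measurable borel" "g \<in> borel_measurable borel"
    and ae: "AE x in lborel. (\<lambda>n. f n x) \<longlonglongrightarrow> g x"
    and bd: "\<And>n. AE x in lborel. cmod (f n x) \<le> C * cmod (w x)"
  shows "square_integrable (f n)" "square_integrable g" "(\<lambda>n. abs_l2 (f n)) \<longlonglongrightarrow> abs_l2 g"
proof -
  have [measurable]: "w \<in> borel_measurable borel" using w by (rule square_integrable_measurable)
  show si: "square_integrable (f n)" for n
    by (rule square_integrable_bounded_by[OF w _ bd]) simp
  have bd': "AE x in lborel. \<forall>n. cmod (f n x) \<le> C * cmod (w x)"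
    using bd by (simp add: AE_all_countable)
  hence bg: "AE x in lborel. cmod (g x) \<le> C * cmod (w x)"
    using ae
  proof eventually_elim
    case (elim x)
    thus ?case using LIMSEQ_le_const2[OF tendsto_norm[OF elim(2)]] by blast
  qed
  show sg: "square_integrable g"
    by (rule square_integrable_bounded_by[OF w _ bg]) simp
  have "(\<lambda>n. LINT x|lborel. (cmod (f n x - g x))\<^sup>2) \<longlonglongrightarrow> (LINT x|(lborel::(real^3) measure). (0::real))"
  proof (rule integral_dominated_convergence[where w = "\<lambda>x. (2 * C)\<^sup>2 * (cmod (w x))\<^sup>2"])
    show "integrable lborel (\<lambda>x. (2 * C)\<^sup>2 * (cmod (w x))\<^sup>2)" using w by (simp add: square_integrable_def)
    show "AE x in lborel. (\<lambda>n. (cmod (f n x - g x))\<^sup>2) \<longlonglongrightarrow> 0"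
      using ae
    proof eventually_elim
      case (elim x)
      have "(\<lambda>n. (cmod (f n x - g x))\<^sup>2) \<longlonglongrightarrow> (cmod (g x - g x))\<^sup>2"
        by (intro tendsto_intros elim)
      thus ?case by simp
    qed
    show "AE x in lborel. norm ((cmod (f n x - g x))\<^sup>2) \<le> (2 * C)\<^sup>2 * (cmod (w x))\<^sup>2" for n
      using bd[of n] bg
    proof eventually_elim
      case (elim x)
      have "cmod (f n x - g x) \<le> 2 * C * cmod (w x)"
        using norm_triangle_ineq4[of "f n x" "g x"] elim by linarith
      hence "(cmod (f n x - g x))\<^sup>2 \<le> (2 * C * cmod (w x))\<^sup>2" by (rule power_mono) simp
      thus ?case by (simp add: power_mult_distrib)
    qed
  qed auto
  hence "(\<lambda>n. (norm (abs_l2 (f n) - abs_l2 g))\<^sup>2) \<longlonglongrightarrow> 0"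
    by (simp add: abs_l2_diff si sg norm_abs_l2_sq square_integrable_diff)
  hence "(\<lambda>n. sqrt ((norm (abs_l2 (f n) - abs_l2 g))\<^sup>2)) \<longlonglongrightarrow> sqrt 0"
    by (rule tendsto_real_sqrt)
  hence "(\<lambda>n. norm (abs_l2 (f n) - abs_l2 g)) \<longlonglongrightarrow> 0" by simp
  from tendsto_norm_zero_cancel[OF this] show "(\<lambda>n. abs_l2 (f n)) \<longlonglongrightarrow> abs_l2 g"
    by (simp add: LIM_zero_iff)
qed

section \<open>Completeness of L^2 (Riesz-Fischer)\<close>

lemma ennreal_le_suminf: "f k \<le> (\<Sum>k. f k :: ennreal)"
  using sum_le_suminf[of f "{k}"] by simp

text \<open>Along a subsequence with increments at most 4^-k in norm, the weighted sum of 4^k |d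
  k|^2 has integral at most the sum of 4^-k. It is therefore finite almost everywhere, which forces
  |d k| to decay like 2^-k pointwise, and the telescoping series converges. Weighting the squares
  avoids any triangle inequality for infinite sums of norms.\<close>

lemma l2_Cauchy_convergent:
  fixes X :: "nat \<Rightarrow> l2"
  assumes "Cauchy X"
  shows "convergent X"
proof -
  have "\<exists>N. \<forall>m\<ge>N. \<forall>n\<ge>N. norm (X m - X n) < (1/4)^k" for k :: nat
    using assms unfolding Cauchy_iff by (meson zero_less_divide_1_iff zero_less_numeral zero_less_power)
  then obtain N where N: "\<And>k m n. m \<ge> N k \<Longrightarrow> n \<ge> N k \<Longrightarrow> norm (X m - X n) < (1/4)^k"
    by metis
  \<comment> \<open>The sum dominates \<open>N k\<close>, and the summand \<open>k\<close> makes
    \<open>M\<close> strictly increasing.\<close>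
  define M where "M k = (\<Sum>i\<le>k. N i) + k" for k :: nat
  have sm: "strict_mono M" by (simp add: strict_mono_Suc_iff M_def)
  have MN: "M k \<ge> N k" for k
    unfolding M_def by (simp add: member_le_sum trans_le_add1)
  have XM: "norm (X (M k) - X (M j)) \<le> (1/4)^k" if "j \<ge> k" for j k
    using N[of k "M k" "M j"] MN[of k] strict_mono_leD[OF sm that] by force
  define d where "d k x = rep_l2 (X (M (Suc k))) x - rep_l2 (X (M k)) x" for k x
  have [measurable]: "d k \<in> borel_measurable borel" for k unfolding d_def [abs_def] by simp
  have "(\<integral>\<^sup>+x. (\<Sum>k. ennreal (4^k * (cmod (d k x))\<^sup>2)) \<partial>lborel)
      = (\<Sum>k. \<integral>\<^sup>+x. ennreal (4^k * (cmod (d k x))\<^sup>2) \<partial>lborel)"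
    by (rule nn_integral_suminf) simp
  also have "\<dots> \<le> (\<Sum>k. ennreal ((1/4)^k))"
  proof (rule suminf_le)
    fix k
    have "(\<integral>\<^sup>+x. ennreal (4^k * (cmod (d k x))\<^sup>2) \<partial>lborel) = ennreal (4^k) * ennreal ((norm (X (M (Suc k)) - X (M k)))\<^sup>2)"
      by (simp add: ennreal_mult nn_integral_cmult nn_integral_diff_l2 d_def)
    also have "\<dots> = ennreal (4^k * (norm (X (M (Suc k)) - X (M k)))\<^sup>2)"
      by (simp add: ennreal_mult)
    also have "\<dots> \<le> ennreal (4^k * ((1/4)^k)\<^sup>2)"
      using XM[of k "Suc k"] by (intro ennreal_leI mult_left_mono power_mono) (auto simp: norm_minus_commute)
    also have "(4::real)^k * ((1/4)^k)\<^sup>2 = (1/4)^k"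
      by (simp add: power2_eq_square field_simps)
    finally show "(\<integral>\<^sup>+x. ennreal (4^k * (cmod (d k x))\<^sup>2) \<partial>lborel) \<le> ennreal ((1/4)^k)" .
  qed auto
  also have "(\<Sum>k. ennreal ((1/4)^k)) = ennreal (\<Sum>k. (1/4)^k)"
    by (rule suminf_ennreal2) (auto simp: summable_geometric)
  also have "\<dots> < \<infinity>" by simp
  finally have "AE x in lborel. (\<Sum>k. ennreal (4^k * (cmod (d k x))\<^sup>2)) \<noteq> \<infinity>"
    by (intro nn_integral_noteq_infinite) auto
  hence ae: "AE x in lborel. convergent (\<lambda>k. rep_l2 (X (M k)) x)"
  proof eventually_elim
    case (elim x)
    define S where "S = (\<Sum>k. ennreal (4^k * (cmod (d k x))\<^sup>2))"
    have "S \<noteq> \<infinity>" using elim by (simp only: S_def not_False_eq_True)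
    then obtain C where "S = ennreal C" "C \<ge> 0" by (cases S) auto
    hence C: "(\<Sum>k. ennreal (4^k * (cmod (d k x))\<^sup>2)) = ennreal C" "C \<ge> 0" by (simp_all only: S_def)
    have bd: "cmod (d k x) \<le> sqrt C * (1/2)^k" for k
    proof -
      have "ennreal (4^k * (cmod (d k x))\<^sup>2) \<le> ennreal C"
        unfolding C(1)[symmetric] by (rule ennreal_le_suminf)
      hence "4^k * (cmod (d k x))\<^sup>2 \<le> C"
        using C(2) by simp
      moreover have "((2::real)^k)\<^sup>2 = 4^k"
        by (simp add: power2_eq_square flip: power_mult_distrib)
      ultimately have "(2^k * cmod (d k x))\<^sup>2 \<le> (sqrt C)\<^sup>2"
        using C(2) by (simp add: power_mult_distrib)
      hence "2^k * cmod (d k x) \<le> sqrt C"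
        by (rule power2_le_imp_le) (use C in auto)
      thus ?thesis by (simp add: field_simps power_divide)
    qed
    have "summable (\<lambda>k. d k x)"
      by (rule summable_comparison_test[of _ "\<lambda>k. sqrt C * (1/2)^k"])
        (use bd in \<open>auto intro!: summable_mult summable_geometric\<close>)
    hence "convergent (\<lambda>n. \<Sum>k<n. d k x)" by (simp add: summable_iff_convergent)
    hence "convergent (\<lambda>n. (\<Sum>k<n. d k x) + rep_l2 (X (M 0)) x)"
      by (intro convergent_add convergent_const)
    moreover have "(\<Sum>k<n. d k x) + rep_l2 (X (M 0)) x = rep_l2 (X (M n)) x" for n
      using sum_lessThan_telescope[of "\<lambda>k. rep_l2 (X (M k)) x" n] by (simp add: d_def)
    ultimately show ?case by simp
  qed
  define f where "f x = lim (\<lambda>k. rep_l2 (X (M k)) x)" for x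
  have [measurable]: "f \<in> borel_measurable borel" unfolding f_def [abs_def] by simp
  have lim: "AE x in lborel. (\<lambda>k. rep_l2 (X (M k)) x) \<longlonglongrightarrow> f x"
    using ae by eventually_elim (simp add: f_def convergent_LIMSEQ_iff)
  \<comment> \<open>Fatou in \<open>j\<close> with \<open>k\<close> fixed turns the Cauchy estimate
    into an estimate of the distance to the pointwise limit.\<close>
  have est: "(\<integral>\<^sup>+x. ennreal ((cmod (rep_l2 (X (M k)) x - f x))\<^sup>2) \<partial>lborel) \<le> ennreal (((1/4)^k)\<^sup>2)" for k
  proof -
    have "(\<integral>\<^sup>+x. ennreal ((cmod (rep_l2 (X (M k)) x - f x))\<^sup>2) \<partial>lborel)
      = (\<integral>\<^sup>+x. liminf (\<lambda>j. ennreal ((cmod (rep_l2 (X (M k)) x - rep_l2 (X (M j)) x))\<^sup>2)) \<partial>lborel)"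
    proof (rule nn_integral_cong_AE)
      show "AE x in lborel. ennreal ((cmod (rep_l2 (X (M k)) x - f x))\<^sup>2)
          = liminf (\<lambda>j. ennreal ((cmod (rep_l2 (X (M k)) x - rep_l2 (X (M j)) x))\<^sup>2))"
        using lim
      proof eventually_elim
        case (elim x)
        have "(\<lambda>j. ennreal ((cmod (rep_l2 (X (M k)) x - rep_l2 (X (M j)) x))\<^sup>2)) \<longlonglongrightarrow> ennreal ((cmod (rep_l2 (X (M k)) x - f x))\<^sup>2)"
          by (intro tendsto_ennrealI tendsto_intros elim)
        from lim_imp_Liminf[OF sequentially_bot this] show ?case by (rule sym)
      qed
    qed
    also have "\<dots> \<le> liminf (\<lambda>j. \<integral>\<^sup>+x. ennreal ((cmod (rep_l2 (X (M k)) x - rep_l2 (X (M j)) x))\<^sup>2) \<partial>lborel)"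
      by (rule nn_integral_liminf) simp
    also have "\<dots> = liminf (\<lambda>j. ennreal ((norm (X (M k) - X (M j)))\<^sup>2))"
      by (simp add: nn_integral_diff_l2)
    also have "\<dots> \<le> liminf (\<lambda>j. ennreal (((1/4)^k)\<^sup>2))"
      by (rule Liminf_mono) (auto simp: eventually_at_top_linorder intro!: exI[of _ k] ennreal_leI power_mono XM)
    also have "\<dots> = ennreal (((1/4)^k)\<^sup>2)" by (simp add: Liminf_const)
    finally show ?thesis .
  qed
  have sd: "square_integrable (\<lambda>x. rep_l2 (X (M k)) x - f x)"
    and nd: "norm (abs_l2 (\<lambda>x. rep_l2 (X (M k)) x - f x)) \<le> (1/4)^k" for k
    using norm_abs_l2_le[OF _ est] by auto
  have sf: "square_integrable f"
    using square_integrable_diff[OF square_integrable_rep[of "X (M 0)"] sd[of 0]] by simp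
  have "norm (X (M k) - abs_l2 f) \<le> (1/4)^k" for k
    using nd[of k] abs_l2_diff[OF square_integrable_rep[of "X (M k)"] sf] by (simp add: abs_rep_l2)
  moreover have "(\<lambda>k. (1/4::real)^k) \<longlonglongrightarrow> 0"
    by (intro LIMSEQ_power_zero) auto
  ultimately have "(\<lambda>k. X (M k) - abs_l2 f) \<longlonglongrightarrow> 0"
    by (rule_tac Lim_null_comparison[of _ "\<lambda>k. (1/4)^k"]) auto
  hence "(X \<circ> M) \<longlonglongrightarrow> abs_l2 f" by (simp add: LIM_zero_iff o_def)
  from Cauchy_converges_subseq[OF assms sm this] show ?thesis by (auto simp: convergent_def)
qed

instance l2 :: banach
  by intro_classes (rule l2_Cauchy_convergent)

text \<open>Bilinear and complex valued, without conjugation: this is the form in which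
  \<open>weak_partial\<close> tests a function, and multipliers and the Fourier transform are
  symmetric for it. The inner product of \<open>l2\<close> is real and would lose the imaginary
  part.\<close>

definition pair :: "l2 \<Rightarrow> l2 \<Rightarrow> complex" where
  "pair f g = (LINT x|lborel. rep_l2 f x * rep_l2 g x)"

lemma pair_commute: "pair f g = pair g f"
  by (simp add: pair_def mult.commute)

lemma pair_abs:
  assumes "square_integrable f" "square_integrable g"
  shows "pair (abs_l2 f) (abs_l2 g) = (LINT x|lborel. f x * g x)"
  unfolding pair_def
proof (rule integral_cong_AE)
  show "AE x in lborel. rep_l2 (abs_l2 f) x * rep_l2 (abs_l2 g) x = f x * g x"
    using rep_abs_l2[OF assms(1)] rep_abs_l2[OF assms(2)] by eventually_elim simp
qed (use assms[THEN square_integrable_measurable] in auto)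

lemma pair_abs_right: "square_integrable g \<Longrightarrow> pair f (abs_l2 g) = (LINT x|lborel. rep_l2 f x * g x)"
  using pair_abs[OF square_integrable_rep[of f]] by (simp add: abs_rep_l2)

lemma square_integrable_norm: "square_integrable f \<Longrightarrow> square_integrable (\<lambda>x. complex_of_real (cmod (f x)))"
  by (auto simp: square_integrable_def)

text \<open>Replacing both functions by their moduli changes no norm and reduces the claim to
  Cauchy-Schwarz for the real inner product.\<close>

lemma norm_pair_le: "cmod (pair f g) \<le> norm f * norm g"
proof -
  let ?a = "\<lambda>f x. complex_of_real (cmod (rep_l2 f x))"
  have n: "norm (abs_l2 (?a f)) = norm f" for f
    using norm_abs_l2_sq[OF square_integrable_norm[OF square_integrable_rep[of f]]] norm_l2_sq[of f]
    by (simp add: power2_eq_imp_eq)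
  have "cmod (pair f g) \<le> (LINT x|lborel. cmod (rep_l2 f x * rep_l2 g x))"
    unfolding pair_def by (rule integral_norm_bound)
  also have "\<dots> = (LINT x|lborel. ?a f x \<bullet> ?a g x)"
    by (simp add: norm_mult inner_complex_def)
  also have "\<dots> = abs_l2 (?a f) \<bullet> abs_l2 (?a g)"
    by (simp add: inner_abs_l2 square_integrable_norm square_integrable_rep)
  also have "\<dots> \<le> norm (abs_l2 (?a f)) * norm (abs_l2 (?a g))"
    by (rule norm_cauchy_schwarz)
  finally show ?thesis by (simp add: n)
qed

lemma bounded_bilinear_pair: "bounded_bilinear pair"
proof
  show add: "pair (a + a') b = pair a b + pair a' b" for a a' b
    by (simp add: pair_def integral_rep_l2_add[OF square_integrable_rep])
  show scaleR: "pair (r *\<^sub>R a) b = r *\<^sub>R pair a b" for r a b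
    by (simp only: pair_def integral_rep_l2_scaleR[OF square_integrable_rep])
  show "pair a (b + b') = pair a b + pair a b'" for a b b'
    using add[of b b' a] by (simp add: pair_commute)
  show "pair a (r *\<^sub>R b) = r *\<^sub>R pair a b" for r a b
    using scaleR[of r b a] by (simp only: pair_commute)
  show "\<exists>K. \<forall>a b. norm (pair a b) \<le> norm a * norm b * K"
    using norm_pair_le by (intro exI[of _ 1]) simp
qed

lemmas tendsto_pair = bounded_bilinear.tendsto[OF bounded_bilinear_pair]

lemma weak_partial_iff_pair:
  "weak_partial j f g \<longleftrightarrow> (\<forall>\<psi>. test_function \<psi> \<longrightarrow>
     pair f (abs_l2 (\<lambda>x. frechet_derivative \<psi> (at x) (axis j 1))) = - pair g (abs_l2 \<psi>))"
  by (simp add: weak_partial_def pair_abs_right test_function_derivative)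

text \<open>Both sides of the tested identity are continuous in the L^2 norm, so the graph of a weak
  derivative is closed. Completeness of \<open>h1\<close> rests on this.\<close>

lemma weak_partial_closed:
  assumes f: "X \<longlonglongrightarrow> f" and g: "Y \<longlonglongrightarrow> g" and w: "\<And>n. weak_partial j (X n) (Y n)"
  shows "weak_partial j f g"
  unfolding weak_partial_iff_pair
proof (intro allI impI)
  fix \<psi> assume t: "test_function \<psi>"
  let ?d = "abs_l2 (\<lambda>x. frechet_derivative \<psi> (at x) (axis j 1))"
  have "(\<lambda>n. pair (X n) ?d) \<longlonglongrightarrow> pair f ?d" by (intro tendsto_pair tendsto_const f)
  moreover have "(\<lambda>n. - pair (Y n) (abs_l2 \<psi>)) \<longlonglongrightarrow> - pair g (abs_l2 \<psi>)"
    by (intro tendsto_minus tendsto_pair tendsto_const g)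
  moreover have "pair (X n) ?d = - pair (Y n) (abs_l2 \<psi>)" for n
    using w[of n] t by (simp add: weak_partial_iff_pair)
  ultimately show "pair f ?d = - pair g (abs_l2 \<psi>)"
    by (metis (no_types, lifting) LIMSEQ_unique tendsto_cong eventually_sequentiallyI ext)
qed

lemma l2_eqI_pair:
  assumes "\<And>\<psi>. test_function \<psi> \<Longrightarrow> pair f (abs_l2 \<psi>) = pair g (abs_l2 \<psi>)"
  shows "f = g"
proof -
  have "AE x in lborel. rep_l2 f x - rep_l2 g x = 0"
  proof (intro AE_eq_0_if_test_integrals_0 square_integrable_diff square_integrable_rep)
    fix \<psi> :: "real^3 \<Rightarrow> complex" assume t: "test_function \<psi>"
    show "(LINT x|lborel. (rep_l2 f x - rep_l2 g x) * \<psi> x) = 0"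
      using assms[OF t] square_integrable_mult[OF square_integrable_rep test_function_derivative(1)[OF t]]
      by (simp add: left_diff_distrib pair_abs_right test_function_derivative(1)[OF t])
  qed
  thus ?thesis by (intro l2_eqI) simp
qed

section \<open>Norm and completeness of H^1\<close>

lemma norm_h1_sq: "(norm f)\<^sup>2 = (norm (l2_of_h1 f))\<^sup>2 + (\<Sum>j\<in>UNIV. (norm (partial j f))\<^sup>2)"
  by (simp add: power2_norm_eq_inner inner_h1_def)

lemma norm_l2_of_h1_le: "norm (l2_of_h1 f) \<le> norm f"
  by (rule power2_le_imp_le) (auto simp: norm_h1_sq sum_nonneg)

lemma norm_partial_le: "norm (partial j f) \<le> norm f"
proof (rule power2_le_imp_le)
  have "(norm (partial j f))\<^sup>2 \<le> (\<Sum>j\<in>UNIV. (norm (partial j f))\<^sup>2)"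
    by (rule member_le_sum) auto
  thus "(norm (partial j f))\<^sup>2 \<le> (norm f)\<^sup>2" by (simp add: norm_h1_sq add_increasing)
qed simp

lemma norm_h1_le: "norm f \<le> norm (l2_of_h1 f) + (\<Sum>j\<in>UNIV. norm (partial j f))"
proof (rule power2_le_imp_le)
  have "(\<Sum>j\<in>A. (norm (partial j f))\<^sup>2) \<le> (\<Sum>j\<in>A. norm (partial j f))\<^sup>2" if "finite A" for A
    using that by (induction A) (auto simp: power2_sum sum_nonneg add_increasing2 intro!: add_mono)
  hence "(norm f)\<^sup>2 \<le> (norm (l2_of_h1 f))\<^sup>2 + (\<Sum>j\<in>UNIV. norm (partial j f))\<^sup>2"
    by (simp add: norm_h1_sq)
  also have "\<dots> \<le> (norm (l2_of_h1 f) + (\<Sum>j\<in>UNIV. norm (partial j f)))\<^sup>2"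
    by (simp add: power2_sum sum_nonneg)
  finally show "(norm f)\<^sup>2 \<le> (norm (l2_of_h1 f) + (\<Sum>j\<in>UNIV. norm (partial j f)))\<^sup>2" .
qed (simp add: sum_nonneg)

lemma bounded_linear_l2_of_h1: "bounded_linear l2_of_h1"
  by (rule bounded_linear_intro[of _ 1])
    (simp_all add: plus_h1.rep_eq scaleR_h1.rep_eq norm_l2_of_h1_le)

lemma bounded_linear_partial: "bounded_linear (partial j)"
  by (rule bounded_linear_intro[of _ 1]) (simp_all add: partial_add partial_scaleR norm_partial_le)

text \<open>\<open>h1_of_l2\<close> says something only about elements of the Sobolev space. Every
  operator defined through it is unfolded by this lemma, after weak derivatives of its value have
  been exhibited.\<close>

lemma l2_of_h1_of_l2:
  assumes "\<And>j. weak_partial j f (g j)"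
  shows "l2_of_h1 (h1_of_l2 f) = f" "partial j (h1_of_l2 f) = g j"
proof -
  show "l2_of_h1 (h1_of_l2 f) = f" using assms by (intro h1_of_l2_inverse) auto
  thus "partial j (h1_of_l2 f) = g j" using assms by (intro partial_eqI) simp
qed

lemma tendsto_h1I:
  assumes "((\<lambda>n. l2_of_h1 (X n)) \<longlongrightarrow> l2_of_h1 f) F" "\<And>j. ((\<lambda>n. partial j (X n)) \<longlongrightarrow> partial j f) F"
  shows "(X \<longlongrightarrow> f) F"
proof -
  interpret a: bounded_linear l2_of_h1 by (rule bounded_linear_l2_of_h1)
  interpret b: bounded_linear "partial j" for j by (rule bounded_linear_partial)
  have "((\<lambda>n. norm (l2_of_h1 (X n) - l2_of_h1 f) + (\<Sum>j\<in>UNIV. norm (partial j (X n) - partial j f))) \<longlongrightarrow>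
      norm (l2_of_h1 f - l2_of_h1 f) + (\<Sum>j\<in>UNIV. norm (partial j f - partial j f))) F"
    by (intro tendsto_intros assms)
  hence "((\<lambda>n. norm (l2_of_h1 (X n - f)) + (\<Sum>j\<in>UNIV. norm (partial j (X n - f)))) \<longlongrightarrow> 0) F"
    by (simp add: a.diff b.diff)
  hence "((\<lambda>n. X n - f) \<longlongrightarrow> 0) F"
    by (rule Lim_null_comparison[rotated]) (simp add: norm_h1_le)
  thus ?thesis by (simp add: LIM_zero_iff)
qed

lemma h1_Cauchy_convergent:
  fixes X :: "nat \<Rightarrow> h1"
  assumes "Cauchy X"
  shows "convergent X"
proof -
  have "convergent (\<lambda>n. l2_of_h1 (X n))"
    using bounded_linear.Cauchy[OF bounded_linear_l2_of_h1 assms] Cauchy_convergent by blast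
  then obtain f where f: "(\<lambda>n. l2_of_h1 (X n)) \<longlonglongrightarrow> f" by (auto simp: convergent_def)
  have "convergent (\<lambda>n. partial j (X n))" for j
    using bounded_linear.Cauchy[OF bounded_linear_partial assms] Cauchy_convergent by blast
  then obtain g where g: "\<And>j. (\<lambda>n. partial j (X n)) \<longlonglongrightarrow> g j" unfolding convergent_def by metis
  have w: "weak_partial j f (g j)" for j
    by (rule weak_partial_closed[OF f g]) (rule weak_partial_partial)
  have "X \<longlonglongrightarrow> h1_of_l2 f"
    using f g by (intro tendsto_h1I) (simp_all add: l2_of_h1_of_l2[OF w])
  thus ?thesis by (auto simp: convergent_def)
qed

instance h1 :: banach
  by intro_classes (rule h1_Cauchy_convergent)

section \<open>Bounded multiplication operators on L^2\<close>

definition bdd_fun :: "(real^3 \<Rightarrow> complex) \<Rightarrow> bool" where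
  "bdd_fun m \<longleftrightarrow> m \<in> borel_measurable borel \<and> (\<exists>C. \<forall>x. cmod (m x) \<le> C)"

lemma bdd_funI: "m \<in> borel_measurable borel \<Longrightarrow> (\<And>x. cmod (m x) \<le> C) \<Longrightarrow> bdd_fun m"
  by (auto simp: bdd_fun_def)

lemma bdd_fun_measurable: "bdd_fun m \<Longrightarrow> m \<in> borel_measurable borel"
  by (simp add: bdd_fun_def)

lemma bdd_fun_const: "bdd_fun (\<lambda>_. c)"
  by (rule bdd_funI[of _ "cmod c"]) auto

lemma bdd_fun_mult:
  assumes "bdd_fun m" "bdd_fun m'"
  shows "bdd_fun (\<lambda>x. m x * m' x)"
proof -
  obtain C C' where "\<forall>x. cmod (m x) \<le> C" "\<forall>x. cmod (m' x) \<le> C'"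
    using assms by (auto simp: bdd_fun_def)
  thus ?thesis
    using assms by (intro bdd_funI[of _ "C * C'"])
      (auto simp: norm_mult intro!: mult_mono borel_measurable_times intro: bdd_fun_measurable order_trans[OF norm_ge_zero])
qed

lemma bdd_fun_cis: "q \<in> borel_measurable borel \<Longrightarrow> bdd_fun (\<lambda>x. cis (q x))"
  by (rule bdd_funI[of _ 1]) (auto simp: cis_conv_exp)

lemma square_integrable_bdd_mult:
  assumes "bdd_fun m" "square_integrable f"
  shows "square_integrable (\<lambda>x. m x * f x)"
proof -
  obtain C where "\<forall>x. cmod (m x) \<le> C" using assms by (auto simp: bdd_fun_def)
  thus ?thesis
    using assms by (intro square_integrable_bounded_by[OF assms(2), of _ C])
      (auto simp: norm_mult intro!: mult_right_mono borel_measurable_times intro: bdd_fun_measurable square_integrable_measurable)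
qed

text \<open>\<open>l2_mult\<close> is defined on the chosen representative \<open>rep_l2\<close>;
  another representative differs from it on a null set only, so the products have the same
  class.\<close>

lemma l2_mult_abs:
  assumes "square_integrable f" "square_integrable (\<lambda>x. m x * f x)" "m \<in> borel_measurable borel"
  shows "l2_mult m (abs_l2 f) = abs_l2 (\<lambda>x. m x * f x)"
proof -
  have ae: "AE x in lborel. m x * rep_l2 (abs_l2 f) x = m x * f x"
    using rep_abs_l2[OF assms(1)] by eventually_elim simp
  show ?thesis
    unfolding l2_mult_def
  proof (rule abs_l2_eqI[OF _ assms(2) ae])
    show "square_integrable (\<lambda>x. m x * rep_l2 (abs_l2 f) x)"
      by (rule square_integrable_bounded_by[OF assms(2), of _ 1]) (use ae assms(3) in auto)
  qed
qed

lemma l2_mult_bdd_abs: "bdd_fun m \<Longrightarrow> square_integrable f \<Longrightarrow> l2_mult m (abs_l2 f) = abs_l2 (\<lambda>x. m x * f x)"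
  by (simp add: l2_mult_abs square_integrable_bdd_mult bdd_fun_measurable)

lemma l2_mult_mult:
  assumes "bdd_fun m" "bdd_fun m'"
  shows "l2_mult m (l2_mult m' f) = l2_mult (\<lambda>x. m x * m' x) f"
proof -
  have "l2_mult m (l2_mult m' (abs_l2 (rep_l2 f))) = l2_mult (\<lambda>x. m x * m' x) (abs_l2 (rep_l2 f))"
    by (simp add: l2_mult_bdd_abs assms bdd_fun_mult square_integrable_bdd_mult square_integrable_rep mult.assoc)
  thus ?thesis by (simp only: abs_rep_l2)
qed

lemma rep_l2_mult: "bdd_fun m \<Longrightarrow> AE x in lborel. rep_l2 (l2_mult m f) x = m x * rep_l2 f x"
  unfolding l2_mult_def by (intro rep_abs_l2 square_integrable_bdd_mult square_integrable_rep)

lemma norm_l2_mult_le: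
  assumes "m \<in> borel_measurable borel" "\<And>x. cmod (m x) \<le> C"
  shows "norm (l2_mult m f) \<le> C * norm f"
proof -
  have "C \<ge> 0" using assms(2)[of undefined] norm_ge_zero order_trans by blast
  hence "norm (abs_l2 (\<lambda>x. m x * rep_l2 f x)) \<le> C * norm (abs_l2 (rep_l2 f))"
    using assms by (intro norm_abs_l2_mono square_integrable_bdd_mult bdd_funI square_integrable_rep)
      (auto simp: norm_mult intro!: mult_right_mono)
  thus ?thesis by (simp add: l2_mult_def abs_rep_l2)
qed

lemma bounded_linear_l2_mult:
  assumes "bdd_fun m"
  shows "bounded_linear (l2_mult m)"
proof -
  obtain C where C: "\<And>x. cmod (m x) \<le> C" using assms by (auto simp: bdd_fun_def)
  note si = square_integrable_rep square_integrable_bdd_mult[OF assms] square_integrable_add square_integrable_scaleR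
  show ?thesis
  proof (rule bounded_linear_intro[of _ C])
    fix f g :: l2 and r :: real
    have "l2_mult m (abs_l2 (rep_l2 f) + abs_l2 (rep_l2 g)) = l2_mult m (abs_l2 (rep_l2 f)) + l2_mult m (abs_l2 (rep_l2 g))"
      by (simp add: abs_l2_add l2_mult_bdd_abs assms si distrib_left)
    thus "l2_mult m (f + g) = l2_mult m f + l2_mult m g" by (simp only: abs_rep_l2)
    have "l2_mult m (r *\<^sub>R abs_l2 (rep_l2 f)) = r *\<^sub>R l2_mult m (abs_l2 (rep_l2 f))"
      by (simp only: abs_l2_scaleR l2_mult_bdd_abs assms si mult_scaleR_right)
    thus "l2_mult m (r *\<^sub>R f) = r *\<^sub>R l2_mult m f" by (simp only: abs_rep_l2)
    show "norm (l2_mult m f) \<le> norm f * C"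
      using norm_l2_mult_le[OF bdd_fun_measurable[OF assms] C, of f] by (simp add: mult.commute)
  qed
qed

lemma pair_l2_mult:
  assumes "bdd_fun m"
  shows "pair (l2_mult m f) g = pair f (l2_mult m g)"
proof -
  have "pair (l2_mult m (abs_l2 (rep_l2 f))) (abs_l2 (rep_l2 g)) = pair (abs_l2 (rep_l2 f)) (l2_mult m (abs_l2 (rep_l2 g)))"
    by (simp only: l2_mult_bdd_abs[OF assms] square_integrable_rep pair_abs square_integrable_bdd_mult[OF assms] mult_ac)
  thus ?thesis by (simp only: abs_rep_l2)
qed

lemma norm_l2_mult_cis:
  assumes "q \<in> borel_measurable borel"
  shows "norm (l2_mult (\<lambda>x. cis (q x)) f) = norm f"
proof -
  have "(norm (l2_mult (\<lambda>x. cis (q x)) (abs_l2 (rep_l2 f))))\<^sup>2 = (norm (abs_l2 (rep_l2 f)))\<^sup>2"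
    using bdd_fun_cis[OF assms]
    by (simp add: l2_mult_bdd_abs square_integrable_rep norm_abs_l2_sq square_integrable_bdd_mult norm_mult)
  thus ?thesis by (simp add: abs_rep_l2 power2_eq_iff_nonneg)
qed

lemma l2_mult_1: "l2_mult (\<lambda>_. 1) f = f"
  by (simp add: l2_mult_def abs_rep_l2)

section \<open>Gaussian integrals\<close>

text \<open>Cauchy's inequality turns the majorant of \<open>F\<close> into one of its derivative,
  hence of the difference quotients, and dominated convergence differentiates under the integral.
  Thus only \<open>F\<close> itself has to be bounded.\<close>

lemma holomorphic_on_lebesgue_integral:
  fixes F :: "complex \<Rightarrow> 'a \<Rightarrow> complex"
  assumes S: "open S" and holo: "\<And>y. y \<in> space M \<Longrightarrow> (\<lambda>z. F z y) holomorphic_on S"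
    and meas: "\<And>z. z \<in> S \<Longrightarrow> F z \<in> borel_measurable M"
    and b: "integrable M b" and bd: "\<And>z y. z \<in> S \<Longrightarrow> y \<in> space M \<Longrightarrow> cmod (F z y) \<le> b y"
  shows "(\<lambda>z. LINT y|M. F z y) holomorphic_on S"
proof (subst holomorphic_on_open[OF S], intro ballI)
  fix z assume z: "z \<in> S"
  \<comment> \<open>Radius \<open>2 * r\<close>, so that around each point of
    \<open>cball z r\<close> a disc of radius \<open>r\<close> is left for Cauchy's
    inequality.\<close>
  obtain r where r: "r > 0" "cball z (2 * r) \<subseteq> S"
  proof -
    obtain e where "e > 0" "cball z e \<subseteq> S" using S z open_contains_cball by blast
    thus ?thesis by (intro that[of "e / 2"]) auto
  qed
  have sub: "cball w r \<subseteq> S" if "w \<in> cball z r" for w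
  proof
    fix v assume "v \<in> cball w r"
    hence "dist z v \<le> 2 * r" using that dist_triangle[of z v w] by auto
    thus "v \<in> S" using r by auto
  qed
  define F' where "F' y = deriv (\<lambda>z. F z y) z" for y
  have int: "integrable M (F w)" if "w \<in> S" for w
    by (rule Bochner_Integration.integrable_bound[OF b meas[OF that]])
      (use bd that in \<open>auto intro!: AE_I2 order_trans[OF _ abs_ge_self]\<close>)
  have lip: "cmod (F w y - F z y) \<le> (b y / r) * cmod (w - z)" if "w \<in> cball z r" "y \<in> space M" for w y
  proof (rule field_differentiable_bound[where S = "cball z r" and f' = "\<lambda>v. deriv (\<lambda>z. F z y) v"])
    fix v assume v: "v \<in> cball z r"
    have h: "(\<lambda>z. F z y) holomorphic_on cball v r"
      using holo[OF that(2)] sub[OF v] holomorphic_on_subset by blast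
    have "v \<in> S" using v sub r(1) by fastforce
    thus "((\<lambda>z. F z y) has_field_derivative deriv (\<lambda>z. F z y) v) (at v within cball z r)"
      using holomorphic_derivI[OF holo[OF that(2)] S] by blast
    have "cmod ((deriv ^^ 1) (\<lambda>z. F z y) v) \<le> fact 1 * b y / r ^ 1"
    proof (rule Cauchy_inequality)
      show "(\<lambda>z. F z y) holomorphic_on ball v r" using h holomorphic_on_subset ball_subset_cball by blast
      show "continuous_on (cball v r) (\<lambda>z. F z y)" using h by (rule holomorphic_on_imp_continuous_on)
      show "cmod (F x y) \<le> b y" if "cmod (v - x) = r" for x
        by (rule bd) (use sub[OF v] that \<open>y \<in> space M\<close> in \<open>auto simp: dist_norm\<close>)
    qed (rule r)
    thus "cmod (deriv (\<lambda>z. F z y) v) \<le> b y / r" by simp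
  qed (use that r in auto)
  have quot: "(\<lambda>n. (F (X n) y - F z y) / (X n - z)) \<longlonglongrightarrow> F' y"
    if "y \<in> space M" "X \<longlonglongrightarrow> z" "\<And>n. X n \<noteq> z" for X y
  proof -
    have "((\<lambda>z. F z y) has_field_derivative F' y) (at z)"
      unfolding F'_def using holomorphic_derivI[OF holo[OF that(1)] S z] .
    hence "((\<lambda>w. (F w y - F z y) / (w - z)) \<longlongrightarrow> F' y) (at z)"
      by (simp add: has_field_derivative_iff)
    thus ?thesis
      unfolding tendsto_at_iff_sequentially using that by (auto simp: o_def)
  qed
  have main: "(\<lambda>n. ((LINT y|M. F (X n) y) - (LINT y|M. F z y)) / (X n - z)) \<longlonglongrightarrow> (LINT y|M. F' y)"
    if X: "X \<longlonglongrightarrow> z" "\<And>n. X n \<noteq> z" for X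
  proof -
    \<comment> \<open>The Lipschitz bound holds only near \<open>z\<close>, so the sequence is
      shifted to lie there from the first index; the shift is undone by
      \<open>LIMSEQ_offset\<close>.\<close>
    obtain N where N: "\<And>n. n \<ge> N \<Longrightarrow> X n \<in> cball z r"
      using X(1) r(1) unfolding LIMSEQ_iff by (metis dist_commute dist_norm less_imp_le mem_cball)
    define Y where "Y n = X (n + N)" for n
    have Y: "Y \<longlonglongrightarrow> z" "\<And>n. Y n \<noteq> z"
      using LIMSEQ_ignore_initial_segment[OF X(1), of N] X(2) by (simp_all add: Y_def [abs_def])
    have Y': "Y n \<in> cball z r" for n using N[of "n + N"] by (simp add: Y_def)
    have Y'': "Y n \<in> S" for n using sub[OF Y'[of n]] r(1) by (auto simp: subset_iff)
    note Y = Y Y' Y''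
    have zS: "z \<in> S" by fact
    have "(\<lambda>n. LINT y|M. (F (Y n) y - F z y) / (Y n - z)) \<longlonglongrightarrow> (LINT y|M. F' y)"
    proof (rule integral_dominated_convergence[where w = "\<lambda>y. b y / r"])
      show ms: "(\<lambda>y. (F (Y n) y - F z y) / (Y n - z)) \<in> borel_measurable M" for n
        using meas[OF Y(4)[of n]] meas[OF zS] by measurable
      show "F' \<in> borel_measurable M"
        by (rule borel_measurable_LIMSEQ_metric[OF ms]) (rule quot[OF _ Y(1,2)])
      show "integrable M (\<lambda>y. b y / r)" using b by simp
      show "AE y in M. (\<lambda>n. (F (Y n) y - F z y) / (Y n - z)) \<longlonglongrightarrow> F' y"
        using quot[OF _ Y(1,2)] by auto
      show "AE y in M. cmod ((F (Y n) y - F z y) / (Y n - z)) \<le> b y / r" for n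
        using lip[OF Y(3)] Y(2)[of n] by (auto simp: norm_divide pos_divide_le_eq)
    qed
    also have "(\<lambda>n. LINT y|M. (F (Y n) y - F z y) / (Y n - z))
        = (\<lambda>n. ((LINT y|M. F (Y n) y) - (LINT y|M. F z y)) / (Y n - z))"
      using int[OF Y(4)] int[OF zS] by simp
    finally show ?thesis
      unfolding Y_def by (rule LIMSEQ_offset)
  qed
  have "((\<lambda>z. LINT y|M. F z y) has_field_derivative (LINT y|M. F' y)) (at z)"
    unfolding has_field_derivative_iff tendsto_at_iff_sequentially using main by (auto simp: o_def)
  thus "\<exists>f'. ((\<lambda>z. LINT y|M. F z y) has_field_derivative f') (at z)" by blast
qed

lemma islimpt_of_real_interval:
  assumes "a < x" "x < b"
  shows "complex_of_real x islimpt complex_of_real ` {a<..<b}"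
proof (rule islimpt_isCont_image)
  show "x islimpt {a<..<b}" using assms by (intro interior_limit_point) simp
  show "\<forall>\<^sub>F y in at x. complex_of_real y \<noteq> complex_of_real x" by (simp add: eventually_at_filter)
qed simp

lemma measurable_cis [measurable]: "cis \<in> borel_measurable borel"
  by (intro borel_measurable_continuous_onI continuous_intros)

lemma integrable_exp_square_real: "z > 0 \<Longrightarrow> integrable lborel (\<lambda>x. exp (- (z * x\<^sup>2)) :: real)"
proof -
  assume z: "z > 0"
  define s where "s = sqrt (1 / (2 * z))"
  have s: "s > 0" "s\<^sup>2 = 1 / (2 * z)" using z by (auto simp: s_def)
  have "integrable lborel (\<lambda>x. sqrt (2 * pi * s\<^sup>2) * normal_density 0 s x)"
    by (intro integrable_mult_right integrable_normal_density s)
  moreover have "sqrt (2 * pi * s\<^sup>2) * normal_density 0 s x = exp (- (z * x\<^sup>2))" for x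
    using s z by (simp add: normal_density_def mult.commute)
  ultimately show ?thesis by simp
qed

text \<open>This is the characteristic function of the standard normal law after a rescaling of the
  variable.\<close>

lemma integral_cis_exp_square_real:
  assumes z: "z > 0"
  shows "(LINT x|lborel. cis (y * x) * complex_of_real (exp (- (z * x\<^sup>2)))) = of_real (sqrt (pi / z) * exp (- y\<^sup>2 / (4 * z)))"
proof -
  \<comment> \<open>Chosen such that (c x)^2 / 2 = z x^2.\<close>
  define c where "c = sqrt (2 * z)"
  have c: "c > 0" "c\<^sup>2 = 2 * z" using z by (auto simp: c_def)
  have "of_real (exp (- (y / c)\<^sup>2 / 2)) = char std_normal_distribution (y / c)"
    by (simp add: char_std_normal_distribution)
  also have "\<dots> = (LINT x|lborel. std_normal_density x *\<^sub>R cis (y / c * x))"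
    unfolding char_def by (subst integral_density) (auto simp: cis_conv_exp)
  also have "\<dots> = c *\<^sub>R (LINT x|lborel. std_normal_density (c * x) *\<^sub>R cis (y / c * (c * x)))"
    using lborel_integral_real_affine[of c "\<lambda>x. std_normal_density x *\<^sub>R cis (y / c * x)" 0] c by simp
  also have "(\<lambda>x. std_normal_density (c * x) *\<^sub>R cis (y / c * (c * x)))
      = (\<lambda>x. of_real (1 / sqrt (2 * pi)) * (cis (y * x) * complex_of_real (exp (- (z * x\<^sup>2)))))"
    using c by (auto simp: std_normal_density_def power_mult_distrib scaleR_conv_of_real mult_ac)
  also have "c *\<^sub>R (LINT x|lborel. of_real (1 / sqrt (2 * pi)) * (cis (y * x) * complex_of_real (exp (- (z * x\<^sup>2)))))
      = of_real (c / sqrt (2 * pi)) * (LINT x|lborel. cis (y * x) * complex_of_real (exp (- (z * x\<^sup>2))))"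
    by (simp add: scaleR_conv_of_real)
  finally have "(LINT x|lborel. cis (y * x) * complex_of_real (exp (- (z * x\<^sup>2))))
      = of_real (sqrt (2 * pi) / c) * of_real (exp (- (y / c)\<^sup>2 / 2))"
    using c by (simp add: field_simps)
  also have "sqrt (2 * pi) / c = sqrt (pi / z)"
    using z by (simp add: c_def real_sqrt_divide[symmetric])
  also have "- (y / c)\<^sup>2 / 2 = - y\<^sup>2 / (4 * z)" using c by (simp add: power_divide)
  finally show ?thesis by simp
qed

text \<open>Lebesgue measure is the image of a product measure under the coordinates, so a product
  of functions of single coordinates integrates factor by factor.\<close>

lemma integral_lborel_prod:
  fixes f :: "'a::euclidean_space \<Rightarrow> real \<Rightarrow> complex"
  assumes "\<And>b. b \<in> Basis \<Longrightarrow> integrable lborel (f b)"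
  shows "integrable lborel (\<lambda>x. \<Prod>b\<in>Basis. f b (x \<bullet> b))"
    and "(LINT x|lborel. (\<Prod>b\<in>Basis. f b (x \<bullet> b))) = (\<Prod>b\<in>Basis. LINT t|lborel. f b t)"
proof -
  interpret product_sigma_finite "\<lambda>_::'a. lborel :: real measure" ..
  have m: "(\<lambda>x. \<Prod>b\<in>Basis. f b (x \<bullet> b)) \<in> borel_measurable borel"
  proof (rule borel_measurable_prod)
    fix b :: 'a assume "b \<in> Basis"
    from borel_measurable_integrable[OF assms[OF this]] have [measurable]: "f b \<in> borel_measurable borel" by simp
    show "(\<lambda>x. f b (x \<bullet> b)) \<in> borel_measurable borel" by measurable
  qed
  have eq: "(\<Prod>b\<in>Basis. f b ((\<Sum>b\<in>Basis. x b *\<^sub>R b) \<bullet> b)) = (\<Prod>b\<in>Basis. f b (x b))" for x :: "'a \<Rightarrow> real"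
    by (intro prod.cong refl) simp
  have d: "(\<lambda>x. \<Sum>b\<in>Basis. x b *\<^sub>R b) \<in> (\<Pi>\<^sub>M b\<in>Basis. lborel) \<rightarrow>\<^sub>M (borel :: 'a measure)"
    by measurable
  show "integrable lborel (\<lambda>x. \<Prod>b\<in>Basis. f b (x \<bullet> b))"
    by (subst lborel_eq, subst integrable_distr_eq[OF d m]) (simp add: eq product_integrable_prod assms)
  show "(LINT x|lborel. (\<Prod>b\<in>Basis. f b (x \<bullet> b))) = (\<Prod>b\<in>Basis. LINT t|lborel. f b t)"
    by (subst lborel_eq, subst integral_distr[OF d m]) (simp add: eq product_integral_prod assms)
qed

lemma cis_sum: "finite A \<Longrightarrow> cis (\<Sum>i\<in>A. f i) = (\<Prod>i\<in>A. cis (f i))"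
  by (induction A rule: finite_induct) (auto simp: cis_mult[symmetric])

lemma card_Basis_3: "card (Basis :: (real^3) set) = 3"
  by simp

lemma norm_sq_Basis: "(norm x)\<^sup>2 = (\<Sum>b\<in>Basis. (x \<bullet> b)\<^sup>2)"
  unfolding power2_norm_eq_inner by (subst euclidean_inner) (simp add: power2_eq_square)

lemma gaussian_prod:
  fixes x y :: "real^3"
  shows "cis (y \<bullet> x) * complex_of_real (exp (- (z * (norm x)\<^sup>2)))
    = (\<Prod>b\<in>Basis. cis ((y \<bullet> b) * (x \<bullet> b)) * complex_of_real (exp (- (z * (x \<bullet> b)\<^sup>2))))"
proof -
  have "cis (y \<bullet> x) = (\<Prod>b\<in>Basis. cis ((y \<bullet> b) * (x \<bullet> b)))"
    by (subst euclidean_inner) (simp add: cis_sum)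
  moreover have "exp (- (z * (norm x)\<^sup>2)) = (\<Prod>b\<in>Basis. exp (- (z * (x \<bullet> b)\<^sup>2)))"
    by (simp add: exp_sum[symmetric] sum_negf sum_distrib_left[symmetric] norm_sq_Basis)
  ultimately show ?thesis by (simp add: prod.distrib)
qed

lemma gaussian_real:
  fixes y :: "real^3"
  assumes z: "z > 0"
  shows "integrable lborel (\<lambda>x::real^3. exp (- (z * (norm x)\<^sup>2)))"
    and "(LINT x|lborel. cis (y \<bullet> x) * complex_of_real (exp (- (z * (norm x)\<^sup>2))))
      = of_real (sqrt (pi / z) ^ 3 * exp (- (norm y)\<^sup>2 / (4 * z)))"
proof -
  let ?f = "\<lambda>y b t. cis ((y \<bullet> b) * t) * complex_of_real (exp (- (z * t\<^sup>2)))"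
  have int: "integrable lborel (?f y b)" for y b :: "real^3"
    by (rule Bochner_Integration.integrable_bound[OF integrable_exp_square_real[OF z]]) (auto simp: norm_mult)
  from integral_lborel_prod(1)[of "?f 0", OF int]
  have "integrable lborel (\<lambda>x. cis (0 \<bullet> x) * complex_of_real (exp (- (z * (norm (x::real^3))\<^sup>2))))"
    unfolding gaussian_prod .
  hence "integrable lborel (\<lambda>x. cmod (cis (0 \<bullet> x) * complex_of_real (exp (- (z * (norm (x::real^3))\<^sup>2)))))"
    by (rule integrable_norm)
  thus "integrable lborel (\<lambda>x::real^3. exp (- (z * (norm x)\<^sup>2)))" by (simp add: norm_mult)
  have "(LINT x|lborel. cis (y \<bullet> x) * complex_of_real (exp (- (z * (norm x)\<^sup>2))))
      = (\<Prod>b\<in>Basis. LINT t|lborel. ?f y b t)"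
    unfolding gaussian_prod by (rule integral_lborel_prod(2)[OF int])
  also have "\<dots> = (\<Prod>b\<in>Basis. of_real (sqrt (pi / z) * exp (- (y \<bullet> b)\<^sup>2 / (4 * z))))"
    by (simp only: integral_cis_exp_square_real[OF z])
  also have "\<dots> = of_real ((\<Prod>b\<in>(Basis::(real^3) set). sqrt (pi / z)) * (\<Prod>b\<in>Basis. exp (- (y \<bullet> b)\<^sup>2 / (4 * z))))"
    by (simp only: of_real_prod[symmetric] prod.distrib)
  also have "(\<Prod>b\<in>Basis. exp (- (y \<bullet> b)\<^sup>2 / (4 * z))) = exp (- (norm y)\<^sup>2 / (4 * z))"
    by (simp add: exp_sum[symmetric] sum_negf sum_divide_distrib[symmetric] norm_sq_Basis)
  also have "(\<Prod>b\<in>(Basis::(real^3) set). sqrt (pi / z)) = sqrt (pi / z) ^ 3"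
    by (simp only: prod_constant card_Basis_3)
  finally show "(LINT x|lborel. cis (y \<bullet> x) * complex_of_real (exp (- (z * (norm x)\<^sup>2))))
      = of_real (sqrt (pi / z) ^ 3 * exp (- (norm y)\<^sup>2 / (4 * z)))" .
qed

text \<open>Both sides are holomorphic in \<open>z\<close> on a half-plane and agree on a real
  interval, so they agree everywhere there. In this form the parameter may later approach the
  imaginary axis.\<close>

lemma gaussian_complex:
  fixes y :: "real^3" and z :: complex
  assumes z: "Re z > 0"
  shows "(LINT x|lborel. cis (y \<bullet> x) * exp (- z * of_real ((norm x)\<^sup>2))) = csqrt (of_real pi / z) ^ 3 * exp (- of_real ((norm y)\<^sup>2) / (4 * z))"
proof -
  \<comment> \<open>Half of \<open>Re z\<close>: the half-plane then contains \<open>z\<close> and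
    has the common Gaussian majorant exp(-a |x|^2).\<close>
  define a where "a = Re z / 2"
  define S where "S = {w. Re w > a}"
  have a: "a > 0" using z by (simp add: a_def)
  have S: "open S" "connected S"
    unfolding S_def by (rule open_halfspace_Re_gt, rule convex_connected[OF convex_halfspace_Re_gt])
  have zS: "z \<in> S" using z by (simp add: S_def a_def)
  let ?I = "\<lambda>z::complex. LINT x|lborel. cis (y \<bullet> x) * exp (- z * of_real ((norm x)\<^sup>2))"
  let ?R = "\<lambda>z. csqrt (of_real pi / z) ^ 3 * exp (- of_real ((norm y)\<^sup>2) / (4 * z))"
  have "?I holomorphic_on S"
  proof (rule holomorphic_on_lebesgue_integral[OF S(1)])
    show "integrable lborel (\<lambda>x::real^3. exp (- (a * (norm x)\<^sup>2)))" by (rule gaussian_real[OF a])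
    show "cmod (cis (y \<bullet> x) * exp (- w * of_real ((norm x)\<^sup>2))) \<le> exp (- (a * (norm x)\<^sup>2))" if "w \<in> S" for w x
      using that by (auto simp: norm_mult S_def intro!: mult_right_mono)
  qed (auto intro!: holomorphic_intros)
  moreover have "?R holomorphic_on S"
  proof -
    \<comment> \<open>The quotient stays in the right half-plane, away from the branch cut of
      \<open>csqrt\<close>.\<close>
    have "complex_of_real pi / w \<notin> \<real>\<^sub>\<le>\<^sub>0" "w \<noteq> 0" if "w \<in> S" for w
    proof -
      have w: "Re w > 0" using that a by (auto simp: S_def)
      hence "Re (pi / w) > 0" by (auto simp: Re_divide intro!: divide_pos_pos add_pos_nonneg)
      thus "complex_of_real pi / w \<notin> \<real>\<^sub>\<le>\<^sub>0" by (auto simp: complex_nonpos_Reals_iff)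
      show "w \<noteq> 0" using w by auto
    qed
    thus ?thesis by (intro holomorphic_intros) auto
  qed
  ultimately have h: "(\<lambda>w. ?I w - ?R w) holomorphic_on S" by (rule holomorphic_on_diff)
  have real: "?I w - ?R w = 0" if "w \<in> complex_of_real ` {a<..<a + 2}" for w
  proof -
    obtain t where t: "w = of_real t" "t > a" using \<open>w \<in> _\<close> by auto
    have "?I w = of_real (sqrt (pi / t) ^ 3 * exp (- (norm y)\<^sup>2 / (4 * t)))"
      using gaussian_real(2)[of t y] t a by (simp add: exp_of_real[symmetric])
    also have "\<dots> = ?R w"
    proof -
      have "csqrt (of_real pi / w) = of_real (sqrt (pi / t))"
        using t a csqrt_of_real_nonneg[of "of_real (pi / t)"] by simp
      thus ?thesis using t by (simp add: exp_of_real[symmetric])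
    qed
    finally show ?thesis by simp
  qed
  have "?I z - ?R z = 0"
  proof (rule analytic_continuation[OF h S(1,2) _ _ _ real zS])
    show "complex_of_real ` {a<..<a + 2} \<subseteq> S" by (auto simp: S_def)
    show "complex_of_real (a + 1) \<in> S" by (simp add: S_def)
    show "complex_of_real (a + 1) islimpt complex_of_real ` {a<..<a + 2}"
      by (rule islimpt_of_real_interval) simp_all
  qed
  thus ?thesis by simp
qed

section \<open>The Fourier transform and Plancherel's theorem\<close>

abbreviation unitary_factor :: real where "unitary_factor \<equiv> (2 * pi) powr (- 3 / 2)"

text \<open>The transform as a genuine integral, to be used for integrable functions;
  \<open>fourier_sign\<close> is its extension to L^2. Keeping the sign as a parameter makes each
  statement cover the transform and its inverse together.\<close>

definition ft :: "real \<Rightarrow> (real^3 \<Rightarrow> complex) \<Rightarrow> real^3 \<Rightarrow> complex" where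
  "ft s g \<xi> = of_real unitary_factor * (LINT x|lborel. g x * cis (s * (x \<bullet> \<xi>)))"

text \<open>The convolution kernel of the multiplier exp(-z |\<xi>|^2): the heat kernel for real z >
  0 and the Schroedinger kernel for z = it.\<close>

definition gauss_kernel :: "complex \<Rightarrow> real^3 \<Rightarrow> complex" where
  "gauss_kernel z w = of_real (unitary_factor\<^sup>2) * (csqrt (of_real pi / z) ^ 3 * exp (- of_real ((norm w)\<^sup>2) / (4 * z)))"

lemma measurable_ft [measurable]:
  assumes [measurable]: "g \<in> borel_measurable borel"
  shows "ft s g \<in> borel_measurable borel"
  unfolding ft_def [abs_def] by measurable

lemma integrable_mult_cis:
  fixes g :: "real^3 \<Rightarrow> complex"
  assumes "integrable lborel g"
  shows "integrable lborel (\<lambda>x. g x * cis (s * (x \<bullet> \<xi>)))"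
proof (rule Bochner_Integration.integrable_bound[OF assms])
  have [measurable]: "g \<in> borel_measurable borel" using borel_measurable_integrable[OF assms] by simp
  show "(\<lambda>x. g x * cis (s * (x \<bullet> \<xi>))) \<in> borel_measurable lborel" by measurable
qed (simp add: norm_mult)

lemma ft_bound: "cmod (ft s g \<xi>) \<le> unitary_factor * (LINT x|lborel. cmod (g x))"
proof -
  have "cmod (LINT x|lborel. g x * cis (s * (x \<bullet> \<xi>))) \<le> (LINT x|lborel. cmod (g x * cis (s * (x \<bullet> \<xi>))))"
    by (rule integral_norm_bound)
  thus ?thesis by (simp add: ft_def norm_mult mult_left_mono)
qed

lemma ft_diff:
  assumes "integrable lborel f" "integrable lborel g"
  shows "ft s (\<lambda>x. f x - g x) \<xi> = ft s f \<xi> - ft s g \<xi>"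
  by (simp add: ft_def left_diff_distrib Bochner_Integration.integral_diff integrable_mult_cis assms right_diff_distrib)

lemma ft_add:
  assumes "integrable lborel f" "integrable lborel g"
  shows "ft s (\<lambda>x. f x + g x) \<xi> = ft s f \<xi> + ft s g \<xi>"
  by (simp add: ft_def distrib_right Bochner_Integration.integral_add integrable_mult_cis assms distrib_left)

lemma ft_cmult: "ft s (\<lambda>x. c * f x) \<xi> = c * ft s f \<xi>"
  by (simp add: ft_def mult.assoc)

lemma ft_cong_AE:
  assumes [measurable]: "f \<in> borel_measurable borel" "g \<in> borel_measurable borel" and "AE x in lborel. f x = g x"
  shows "ft s f \<xi> = ft s g \<xi>"
  unfolding ft_def by (intro arg_cong2[of _ _ _ _ "(*)"] refl integral_cong_AE) (use assms(3) in auto)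

lemma fubini_kernel:
  fixes f g :: "real^3 \<Rightarrow> complex" and K :: "real^3 \<Rightarrow> real^3 \<Rightarrow> complex"
  assumes f: "integrable lborel f" and g: "integrable lborel g"
    and K [measurable]: "(\<lambda>(x, y). K x y) \<in> borel_measurable (borel \<Otimes>\<^sub>M borel)" and bd: "\<And>x y. cmod (K x y) \<le> 1"
  shows "(LINT x|lborel. f x * (LINT y|lborel. g y * K x y)) = (LINT y|lborel. g y * (LINT x|lborel. f x * K x y))"
proof -
  have [measurable]: "f \<in> borel_measurable borel" "g \<in> borel_measurable borel"
    using f g borel_measurable_integrable by fastforce+
  have "integrable (lborel \<Otimes>\<^sub>M lborel) (\<lambda>(x, y). f x * g y)"
  proof (rule lborel_pair.Fubini_integrable)
    show "integrable lborel (\<lambda>x. LINT y|lborel. norm (case (x, y) of (x, y) \<Rightarrow> f x * g y))"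
      using f by (simp add: norm_mult)
  qed (use g in auto)
  hence "integrable (lborel \<Otimes>\<^sub>M lborel) (\<lambda>(x, y). f x * g y * K x y)"
    by (rule Bochner_Integration.integrable_bound)
      (use bd in \<open>auto simp: norm_mult intro!: AE_I2 mult_left_le\<close>)
  from lborel_pair.Fubini_integral[OF this]
  have "(LINT x|lborel. (LINT y|lborel. f x * g y * K x y)) = (LINT y|lborel. (LINT x|lborel. f x * g y * K x y))" by simp
  moreover have "(LINT y|lborel. f x * g y * K x y) = f x * (LINT y|lborel. g y * K x y)" for x
    by (simp add: mult.assoc)
  moreover have "(LINT x|lborel. f x * g y * K x y) = g y * (LINT x|lborel. f x * K x y)" for y
    by (subst integral_mult_right_zero[symmetric]) (simp add: mult_ac)
  ultimately show ?thesis by simp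
qed

lemma integrable_gauss: "Re z > 0 \<Longrightarrow> integrable lborel (\<lambda>x::real^3. exp (- z * of_real ((norm x)\<^sup>2)))"
  by (rule Bochner_Integration.integrable_bound[OF gaussian_real(1)[of "Re z"]]) auto

text \<open>The Gaussian factor makes the frequency integral absolutely convergent, so that Fubini
  applies although the transform of \<open>g\<close> need not be integrable. The inner integral is
  then \<open>gaussian_complex\<close>.\<close>

lemma ft_gauss_ft:
  assumes g: "integrable lborel g" and z: "Re z > 0" and s: "s\<^sup>2 = 1"
  shows "ft (- s) (\<lambda>\<xi>. exp (- z * of_real ((norm \<xi>)\<^sup>2)) * ft s g \<xi>) x = (LINT y|lborel. g y * gauss_kernel z (y - x))"
proof -
  let ?e = "\<lambda>\<xi>::real^3. exp (- z * of_real ((norm \<xi>)\<^sup>2))"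
  let ?c = "complex_of_real unitary_factor"
  have "ft (- s) (\<lambda>\<xi>. ?e \<xi> * ft s g \<xi>) x
      = ?c * (LINT \<xi>|lborel. ?c * (?e \<xi> * (LINT y|lborel. g y * cis (s * ((y - x) \<bullet> \<xi>)))))"
    unfolding ft_def
  proof (rule arg_cong2[of _ _ _ _ "(*)"], rule refl, rule Bochner_Integration.integral_cong)
    fix \<xi> :: "real^3"
    have "(LINT y|lborel. g y * cis (s * ((y - x) \<bullet> \<xi>))) = (LINT y|lborel. (g y * cis (s * (y \<bullet> \<xi>))) * cis (- s * (\<xi> \<bullet> x)))"
      by (simp add: mult.assoc cis_mult inner_diff_left inner_commute[of x] algebra_simps)
    also have "\<dots> = (LINT y|lborel. g y * cis (s * (y \<bullet> \<xi>))) * cis (- s * (\<xi> \<bullet> x))" by simp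
    finally show "?e \<xi> * (?c * (LINT x|lborel. g x * cis (s * (x \<bullet> \<xi>)))) * cis (- s * (\<xi> \<bullet> x))
        = ?c * (?e \<xi> * (LINT y|lborel. g y * cis (s * ((y - x) \<bullet> \<xi>))))" by simp
  qed simp
  also have "\<dots> = ?c * (?c * (LINT \<xi>|lborel. ?e \<xi> * (LINT y|lborel. g y * cis (s * ((y - x) \<bullet> \<xi>)))))"
    by simp
  also have "(LINT \<xi>|lborel. ?e \<xi> * (LINT y|lborel. g y * cis (s * ((y - x) \<bullet> \<xi>))))
      = (LINT y|lborel. g y * (LINT \<xi>|lborel. ?e \<xi> * cis (s * ((y - x) \<bullet> \<xi>))))"
    by (rule fubini_kernel[OF integrable_gauss[OF z] g]) auto
  also have "(\<lambda>y. LINT \<xi>|lborel. ?e \<xi> * cis (s * ((y - x) \<bullet> \<xi>)))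
      = (\<lambda>y. csqrt (of_real pi / z) ^ 3 * exp (- of_real ((norm (y - x))\<^sup>2) / (4 * z)))"
  proof
    fix y
    have "\<bar>s\<bar> = 1" using s by (auto simp: power2_eq_1_iff)
    hence "norm (s *\<^sub>R (y - x)) = norm (y - x)" by simp
    with gaussian_complex[OF z, of "s *\<^sub>R (y - x)"]
    show "(LINT \<xi>|lborel. ?e \<xi> * cis (s * ((y - x) \<bullet> \<xi>)))
        = csqrt (of_real pi / z) ^ 3 * exp (- of_real ((norm (y - x))\<^sup>2) / (4 * z))"
      by (simp only: inner_scaleR_left mult.commute[of "cis _"])
  qed
  also have "?c * (?c * (LINT y|lborel. g y * (csqrt (of_real pi / z) ^ 3 * exp (- of_real ((norm (y - x))\<^sup>2) / (4 * z)))))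
      = (LINT y|lborel. ?c * (?c * (g y * (csqrt (of_real pi / z) ^ 3 * exp (- of_real ((norm (y - x))\<^sup>2) / (4 * z))))))"
    by (simp only: integral_mult_right_zero)
  also have "\<dots> = (LINT y|lborel. g y * gauss_kernel z (y - x))"
    by (simp add: gauss_kernel_def power2_eq_square mult_ac)
  finally show ?thesis .
qed

lemma unitary_factor_sq: "unitary_factor\<^sup>2 = 1 / (2 * pi) ^ 3"
proof -
  have "unitary_factor\<^sup>2 = (2 * pi) powr (- 3)" by (simp add: power2_eq_square powr_add[symmetric])
  also have "\<dots> = 1 / (2 * pi) ^ 3" by (simp add: powr_minus_divide powr_numeral)
  finally show ?thesis .
qed

definition heat_kernel :: "real \<Rightarrow> real^3 \<Rightarrow> real" where
  "heat_kernel e w = unitary_factor\<^sup>2 * (sqrt (pi / e) ^ 3 * exp (- (norm w)\<^sup>2 / (4 * e)))"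

lemma measurable_heat_kernel [measurable]: "heat_kernel e \<in> borel_measurable borel"
  unfolding heat_kernel_def [abs_def] by measurable

lemma gauss_kernel_of_real: "e > 0 \<Longrightarrow> gauss_kernel (of_real e) w = of_real (heat_kernel e w)"
proof -
  assume e: "e > 0"
  have "csqrt (of_real pi / of_real e) = of_real (sqrt (pi / e))"
    using e csqrt_of_real_nonneg[of "of_real (pi / e)"] by simp
  thus ?thesis by (simp add: gauss_kernel_def heat_kernel_def exp_of_real[symmetric])
qed

lemma heat_kernel_nonneg: "e > 0 \<Longrightarrow> heat_kernel e w \<ge> 0"
  by (simp add: heat_kernel_def)

lemma integrable_heat_kernel: "e > 0 \<Longrightarrow> integrable lborel (heat_kernel e)"
  using gaussian_real(1)[of "1 / (4 * e)"] by (simp add: heat_kernel_def [abs_def])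

lemma integral_heat_kernel:
  assumes e: "e > 0"
  shows "(LINT w|lborel. heat_kernel e w) = 1"
proof -
  have "complex_of_real (LINT w|lborel. exp (- (1 / (4 * e) * (norm (w::real^3))\<^sup>2)))
      = (LINT w|lborel. cis (0 \<bullet> w) * complex_of_real (exp (- (1 / (4 * e) * (norm (w::real^3))\<^sup>2))))"
    by simp
  also have "\<dots> = of_real (sqrt (4 * pi * e) ^ 3)"
    using e by (subst gaussian_real(2)) (auto simp: mult_ac)
  finally have G: "(LINT w|lborel. exp (- (1 / (4 * e) * (norm (w::real^3))\<^sup>2))) = sqrt (4 * pi * e) ^ 3"
    by (simp only: of_real_eq_iff)
  have "(LINT w|lborel. heat_kernel e w)
      = unitary_factor\<^sup>2 * (sqrt (pi / e) ^ 3 * (LINT w|lborel. exp (- (1 / (4 * e) * (norm (w::real^3))\<^sup>2))))"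
    by (simp add: heat_kernel_def [abs_def])
  also have "\<dots> = unitary_factor\<^sup>2 * (sqrt (pi / e) * sqrt (4 * pi * e)) ^ 3"
    unfolding G by (simp add: power_mult_distrib)
  also have "sqrt (pi / e) * sqrt (4 * pi * e) = 2 * pi"
    using e by (simp add: real_sqrt_mult[symmetric]) (simp add: real_sqrt_mult)
  finally have "(LINT w|lborel. heat_kernel e w) = unitary_factor\<^sup>2 * (2 * pi) ^ 3" .
  thus ?thesis unfolding unitary_factor_sq by simp
qed

lemma lborel_translate:
  fixes f :: "'a::euclidean_space \<Rightarrow> 'b::{banach, second_countable_topology}"
  assumes [measurable]: "f \<in> borel_measurable borel"
  shows "integrable lborel (\<lambda>x. f (c + x)) \<longleftrightarrow> integrable lborel f"
    and "(LINT x|lborel. f (c + x)) = (LINT x|lborel. f x)"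
proof -
  have "integrable lborel f \<longleftrightarrow> integrable (distr lborel borel ((+) c)) f"
    and *: "(LINT x|lborel. f x) = (LINT x|distr lborel borel ((+) c). f x)"
    by (simp_all add: lborel_distr_plus)
  thus "integrable lborel (\<lambda>x. f (c + x)) \<longleftrightarrow> integrable lborel f"
    by (simp add: integrable_distr_eq)
  show "(LINT x|lborel. f (c + x)) = (LINT x|lborel. f x)"
    unfolding * by (simp add: integral_distr)
qed

lemma nn_integral_heat_kernel:
  assumes "e > 0"
  shows "(\<integral>\<^sup>+w. ennreal (heat_kernel e (w - x)) \<partial>lborel) = 1"
proof -
  have "(\<integral>\<^sup>+w. ennreal (heat_kernel e (w - x)) \<partial>lborel)
      = (\<integral>\<^sup>+w. ennreal (heat_kernel e (w - x)) \<partial>distr lborel borel ((+) x))"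
    by (simp add: lborel_distr_plus)
  also have "\<dots> = (\<integral>\<^sup>+w. ennreal (heat_kernel e w) \<partial>lborel)"
    by (subst nn_integral_distr) auto
  also have "\<dots> = ennreal (LINT w|lborel. heat_kernel e w)"
    using assms by (intro nn_integral_eq_integral) (auto simp: integrable_heat_kernel heat_kernel_nonneg)
  finally show ?thesis using assms by (simp add: integral_heat_kernel)
qed

lemma norm_integral_le_nn:
  "ennreal (norm (LINT x|M. f x)) \<le> (\<integral>\<^sup>+x. ennreal (norm (f x)) \<partial>M)"
  by (cases "integrable M f") (auto simp: integral_norm_bound_ennreal not_integrable_integral_eq)

text \<open>Half of Plancherel's theorem; equality follows later from inversion. With a Gaussian
  weight the squared norm of the transform becomes a quadratic form in \<open>g\<close> with the
  heat kernel. As that kernel is nonnegative with total mass one, Schur's test bounds the form by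
  the squared norm of \<open>g\<close>, and Fatou removes the weight.\<close>

lemma ft_contraction:
  assumes int: "integrable lborel g" and si: "square_integrable g" and s: "s\<^sup>2 = 1"
  shows "square_integrable (ft s g)" "norm (abs_l2 (ft s g)) \<le> norm (abs_l2 g)"
proof -
  have [measurable]: "g \<in> borel_measurable borel" using si by (rule square_integrable_measurable)
  let ?N = "norm (abs_l2 g)"
  define C where "C = unitary_factor * (LINT x|lborel. cmod (g x))"
  have C: "cmod (ft s g \<xi>) \<le> C" for \<xi> unfolding C_def by (rule ft_bound)
  \<comment> \<open>The weight supplies the integrability needed for Fubini; the bound does not
    depend on \<open>e\<close>.\<close>
  have gauss: "(\<integral>\<^sup>+\<xi>. ennreal ((cmod (ft s g \<xi>))\<^sup>2 * exp (- (e * (norm \<xi>)\<^sup>2))) \<partial>lborel) \<le> ennreal (?N\<^sup>2)"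
    if e: "e > 0" for e
  proof -
    let ?e = "\<lambda>\<xi>::real^3. exp (- of_real e * of_real ((norm \<xi>)\<^sup>2)) :: complex"
    have ie: "integrable lborel (\<lambda>\<xi>. ?e \<xi> * ft s g \<xi>)"
    proof (rule Bochner_Integration.integrable_bound)
      show "integrable lborel (\<lambda>\<xi>::real^3. C * exp (- (e * (norm \<xi>)\<^sup>2)))"
        by (intro integrable_mult_right gaussian_real e)
      show "AE \<xi> in lborel. norm (?e \<xi> * ft s g \<xi>) \<le> norm (C * exp (- (e * (norm \<xi>)\<^sup>2)))"
        using C by (auto simp: norm_mult mult.commute abs_mult intro!: AE_I2 mult_right_mono order_trans[OF _ abs_ge_self])
    qed measurable
    have "complex_of_real (LINT \<xi>|lborel. (cmod (ft s g \<xi>))\<^sup>2 * exp (- (e * (norm \<xi>)\<^sup>2)))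
        = (LINT \<xi>|lborel. complex_of_real ((cmod (ft s g \<xi>))\<^sup>2 * exp (- (e * (norm \<xi>)\<^sup>2))))"
      by (rule integral_complex_of_real[symmetric])
    also have "\<dots> = (LINT \<xi>|lborel. of_real unitary_factor * ((?e \<xi> * ft s g \<xi>) * (LINT x|lborel. cnj (g x) * cis (- s * (x \<bullet> \<xi>)))))"
    proof (rule Bochner_Integration.integral_cong)
      fix \<xi> :: "real^3"
      have "cnj (ft s g \<xi>) = of_real unitary_factor * (LINT x|lborel. cnj (g x) * cis (- s * (x \<bullet> \<xi>)))"
        by (simp add: ft_def cis_cnj flip: Bochner_Integration.integral_cnj)
      moreover have "complex_of_real ((cmod (ft s g \<xi>))\<^sup>2 * exp (- (e * (norm \<xi>)\<^sup>2))) = ?e \<xi> * ft s g \<xi> * cnj (ft s g \<xi>)"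
        by (simp only: of_real_mult complex_norm_square) (simp add: exp_of_real[symmetric])
      ultimately show "complex_of_real ((cmod (ft s g \<xi>))\<^sup>2 * exp (- (e * (norm \<xi>)\<^sup>2)))
         = of_real unitary_factor * ((?e \<xi> * ft s g \<xi>) * (LINT x|lborel. cnj (g x) * cis (- s * (x \<bullet> \<xi>))))"
        by simp
    qed simp
    also have "\<dots> = of_real unitary_factor * (LINT \<xi>|lborel. (?e \<xi> * ft s g \<xi>) * (LINT x|lborel. cnj (g x) * cis (- s * (x \<bullet> \<xi>))))"
      by simp
    also have "(LINT \<xi>|lborel. (?e \<xi> * ft s g \<xi>) * (LINT x|lborel. cnj (g x) * cis (- s * (x \<bullet> \<xi>))))
        = (LINT x|lborel. cnj (g x) * (LINT \<xi>|lborel. (?e \<xi> * ft s g \<xi>) * cis (- s * (x \<bullet> \<xi>))))"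
      using int by (intro fubini_kernel ie) auto
    also have "of_real unitary_factor * \<dots> = (LINT x|lborel. of_real unitary_factor * (cnj (g x) * (LINT \<xi>|lborel. (?e \<xi> * ft s g \<xi>) * cis (- s * (x \<bullet> \<xi>)))))"
      by (simp only: integral_mult_right_zero)
    also have "\<dots> = (LINT x|lborel. cnj (g x) * (LINT y|lborel. g y * heat_kernel e (y - x)))"
    proof (rule Bochner_Integration.integral_cong)
      fix x :: "real^3"
      have "of_real unitary_factor * (LINT \<xi>|lborel. (?e \<xi> * ft s g \<xi>) * cis (- s * (x \<bullet> \<xi>)))
          = ft (- s) (\<lambda>\<xi>. ?e \<xi> * ft s g \<xi>) x"
        unfolding ft_def[of "- s"] by (simp add: inner_commute[of x])
      also have "\<dots> = (LINT y|lborel. g y * heat_kernel e (y - x))"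
        using ft_gauss_ft[OF int _ s, of "of_real e"] e by (simp add: gauss_kernel_of_real)
      finally show "of_real unitary_factor * (cnj (g x) * (LINT \<xi>|lborel. (?e \<xi> * ft s g \<xi>) * cis (- s * (x \<bullet> \<xi>))))
          = cnj (g x) * (LINT y|lborel. g y * heat_kernel e (y - x))"
        by (simp add: mult.left_commute)
    qed simp
    finally have eq: "complex_of_real (LINT \<xi>|lborel. (cmod (ft s g \<xi>))\<^sup>2 * exp (- (e * (norm \<xi>)\<^sup>2)))
        = (LINT x|lborel. cnj (g x) * (LINT y|lborel. g y * heat_kernel e (y - x)))" .
    have "(\<integral>\<^sup>+\<xi>. ennreal ((cmod (ft s g \<xi>))\<^sup>2 * exp (- (e * (norm \<xi>)\<^sup>2))) \<partial>lborel)
        = ennreal (LINT \<xi>|lborel. (cmod (ft s g \<xi>))\<^sup>2 * exp (- (e * (norm \<xi>)\<^sup>2)))"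
    proof (rule nn_integral_eq_integral)
      show "integrable lborel (\<lambda>\<xi>. (cmod (ft s g \<xi>))\<^sup>2 * exp (- (e * (norm \<xi>)\<^sup>2)))"
      proof (rule Bochner_Integration.integrable_bound)
        show "integrable lborel (\<lambda>\<xi>::real^3. C\<^sup>2 * exp (- (e * (norm \<xi>)\<^sup>2)))"
          by (intro integrable_mult_right gaussian_real e)
        show "AE \<xi> in lborel. norm ((cmod (ft s g \<xi>))\<^sup>2 * exp (- (e * (norm \<xi>)\<^sup>2))) \<le> norm (C\<^sup>2 * exp (- (e * (norm \<xi>)\<^sup>2)))"
          using C by (auto intro!: AE_I2 mult_right_mono power_mono simp: abs_mult)
      qed measurable
    qed simp
    also have "\<dots> \<le> ennreal (cmod (LINT x|lborel. cnj (g x) * (LINT y|lborel. g y * heat_kernel e (y - x))))"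
      unfolding eq[symmetric] by (simp add: ennreal_leI)
    also have "\<dots> \<le> (\<integral>\<^sup>+x. ennreal (cmod (cnj (g x) * (LINT y|lborel. g y * heat_kernel e (y - x)))) \<partial>lborel)"
      by (rule norm_integral_le_nn)
    also have "\<dots> \<le> (\<integral>\<^sup>+x. (\<integral>\<^sup>+y. ennreal (cmod (g x)) * ennreal (cmod (g y) * heat_kernel e (y - x)) \<partial>lborel) \<partial>lborel)"
    proof (rule nn_integral_mono)
      fix x :: "real^3"
      have "ennreal (cmod (LINT y|lborel. g y * heat_kernel e (y - x))) \<le> (\<integral>\<^sup>+y. ennreal (cmod (g y * heat_kernel e (y - x))) \<partial>lborel)"
        by (rule norm_integral_le_nn)
      hence "ennreal (cmod (g x)) * ennreal (cmod (LINT y|lborel. g y * heat_kernel e (y - x)))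
          \<le> ennreal (cmod (g x)) * (\<integral>\<^sup>+y. ennreal (cmod (g y) * heat_kernel e (y - x)) \<partial>lborel)"
        using e by (intro mult_left_mono) (simp_all add: norm_mult heat_kernel_nonneg)
      thus "ennreal (cmod (cnj (g x) * (LINT y|lborel. g y * heat_kernel e (y - x))))
          \<le> (\<integral>\<^sup>+y. ennreal (cmod (g x)) * ennreal (cmod (g y) * heat_kernel e (y - x)) \<partial>lborel)"
        by (simp add: norm_mult ennreal_mult nn_integral_cmult)
    qed
    also have "\<dots> \<le> (\<integral>\<^sup>+x. (\<integral>\<^sup>+y. ennreal ((cmod (g x))\<^sup>2 / 2) * ennreal (heat_kernel e (y - x))
        + ennreal ((cmod (g y))\<^sup>2 / 2) * ennreal (heat_kernel e (y - x)) \<partial>lborel) \<partial>lborel)"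
    \<comment> \<open>Schur's test: split |g x| |g y| into half the sum of the squares. In each half
      one variable occurs in the kernel alone and integrates to one.\<close>
    proof (intro nn_integral_mono)
      fix x y :: "real^3"
      have k: "heat_kernel e (y - x) \<ge> 0" using e by (rule heat_kernel_nonneg)
      have "cmod (g x) * cmod (g y) \<le> (cmod (g x))\<^sup>2 / 2 + (cmod (g y))\<^sup>2 / 2"
        using sum_squares_bound[of "cmod (g x)" "cmod (g y)"] by simp
      from mult_right_mono[OF this k]
      have "cmod (g x) * (cmod (g y) * heat_kernel e (y - x)) \<le> (cmod (g x))\<^sup>2 / 2 * heat_kernel e (y - x) + (cmod (g y))\<^sup>2 / 2 * heat_kernel e (y - x)"
        by (simp add: algebra_simps)
      thus "ennreal (cmod (g x)) * ennreal (cmod (g y) * heat_kernel e (y - x))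
        \<le> ennreal ((cmod (g x))\<^sup>2 / 2) * ennreal (heat_kernel e (y - x)) + ennreal ((cmod (g y))\<^sup>2 / 2) * ennreal (heat_kernel e (y - x))"
        using k by (simp add: ennreal_mult[symmetric] ennreal_plus[symmetric] del: ennreal_plus)
    qed
    also have "\<dots> = (\<integral>\<^sup>+x. (\<integral>\<^sup>+y. ennreal ((cmod (g x))\<^sup>2 / 2) * ennreal (heat_kernel e (y - x)) \<partial>lborel) \<partial>lborel)
        + (\<integral>\<^sup>+x. (\<integral>\<^sup>+y. ennreal ((cmod (g y))\<^sup>2 / 2) * ennreal (heat_kernel e (y - x)) \<partial>lborel) \<partial>lborel)"
      by (simp add: nn_integral_add)
    also have "(\<integral>\<^sup>+x. (\<integral>\<^sup>+y. ennreal ((cmod (g y))\<^sup>2 / 2) * ennreal (heat_kernel e (y - x)) \<partial>lborel) \<partial>lborel)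
        = (\<integral>\<^sup>+y. (\<integral>\<^sup>+x. ennreal ((cmod (g y))\<^sup>2 / 2) * ennreal (heat_kernel e (x - y)) \<partial>lborel) \<partial>lborel)"
      by (subst lborel_pair.Fubini') (simp_all add: heat_kernel_def norm_minus_commute)
    also have "(\<lambda>y. \<integral>\<^sup>+x. ennreal ((cmod (g y))\<^sup>2 / 2) * ennreal (heat_kernel e (x - y)) \<partial>lborel) = (\<lambda>y. ennreal ((cmod (g y))\<^sup>2 / 2))"
      using e by (simp add: nn_integral_cmult nn_integral_heat_kernel)
    also have "(\<integral>\<^sup>+y. ennreal ((cmod (g y))\<^sup>2 / 2) \<partial>lborel) + (\<integral>\<^sup>+y. ennreal ((cmod (g y))\<^sup>2 / 2) \<partial>lborel)
        = (\<integral>\<^sup>+y. ennreal ((cmod (g y))\<^sup>2) \<partial>lborel)"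
      by (subst nn_integral_add[symmetric]) (auto simp: ennreal_plus[symmetric] simp del: ennreal_plus)
    also have "\<dots> = ennreal (?N\<^sup>2)" by (rule nn_integral_norm_abs_l2[OF si])
    finally show ?thesis .
  qed
  have "(\<integral>\<^sup>+\<xi>. ennreal ((cmod (ft s g \<xi>))\<^sup>2) \<partial>lborel)
      = (\<integral>\<^sup>+\<xi>. liminf (\<lambda>n. ennreal ((cmod (ft s g \<xi>))\<^sup>2 * exp (- (inverse (real (Suc n)) * (norm \<xi>)\<^sup>2)))) \<partial>lborel)"
  proof (rule nn_integral_cong)
    fix \<xi> :: "real^3"
    have "(\<lambda>n. ennreal ((cmod (ft s g \<xi>))\<^sup>2 * exp (- (inverse (real (Suc n)) * (norm \<xi>)\<^sup>2)))) \<longlonglongrightarrow> ennreal ((cmod (ft s g \<xi>))\<^sup>2 * exp (- (0 * (norm \<xi>)\<^sup>2)))"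
      by (intro tendsto_ennrealI tendsto_intros LIMSEQ_inverse_real_of_nat)
    from lim_imp_Liminf[OF sequentially_bot this]
    show "ennreal ((cmod (ft s g \<xi>))\<^sup>2) = liminf (\<lambda>n. ennreal ((cmod (ft s g \<xi>))\<^sup>2 * exp (- (inverse (real (Suc n)) * (norm \<xi>)\<^sup>2))))"
      by simp
  qed
  \<comment> \<open>Fatou as the weight exp(-|\<xi>|^2 / (n + 1)) increases to one.\<close>
  also have "\<dots> \<le> liminf (\<lambda>n. \<integral>\<^sup>+\<xi>. ennreal ((cmod (ft s g \<xi>))\<^sup>2 * exp (- (inverse (real (Suc n)) * (norm \<xi>)\<^sup>2))) \<partial>lborel)"
    by (rule nn_integral_liminf) measurable
  also have "\<dots> \<le> liminf (\<lambda>n. ennreal (?N\<^sup>2))"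
    by (intro Liminf_mono always_eventually allI gauss) simp
  also have "\<dots> = ennreal (?N\<^sup>2)" by (simp add: Liminf_const)
  finally have "(\<integral>\<^sup>+\<xi>. ennreal ((cmod (ft s g \<xi>))\<^sup>2) \<partial>lborel) \<le> ennreal (?N\<^sup>2)" .
  from norm_abs_l2_le[OF _ this]
  show "square_integrable (ft s g)" "norm (abs_l2 (ft s g)) \<le> norm (abs_l2 g)" by auto
qed

section \<open>Extension of the transform to L^2\<close>

definition trunc :: "nat \<Rightarrow> l2 \<Rightarrow> real^3 \<Rightarrow> complex" where
  "trunc n f x = indicator (ball 0 (real n)) x *\<^sub>R rep_l2 f x"

lemma measurable_trunc [measurable]: "trunc n f \<in> borel_measurable borel"
  unfolding trunc_def [abs_def]
  by (intro borel_measurable_scaleR borel_measurable_indicator measurable_rep_l2) auto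

lemma square_integrable_indicator:
  assumes "bounded S" "S \<in> sets borel"
  shows "square_integrable (indicator S)"
proof -
  have "(cmod (indicator S x))\<^sup>2 = indicator S x" for x :: "real^3"
    by (auto simp: indicator_def)
  moreover have "integrable lborel (indicator S :: real^3 \<Rightarrow> real)"
    using assms emeasure_bounded_finite[OF assms(1)] by (intro integrable_real_indicator) auto
  ultimately show ?thesis using assms by (simp add: square_integrable_def)
qed

lemma integrable_bounded_support:
  assumes "square_integrable f" "bounded S" "S \<in> sets borel" "\<And>x. x \<notin> S \<Longrightarrow> f x = 0"
  shows "integrable lborel f"
proof -
  have "indicator S x * f x = f x" for x using assms(4) by (auto simp: indicator_def)
  with square_integrable_mult[OF square_integrable_indicator[OF assms(2,3)] assms(1)] show ?thesis by simp
qed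

lemma square_integrable_trunc: "square_integrable (trunc n f)"
  by (rule square_integrable_bounded_by[OF square_integrable_rep[of f], of _ 1])
    (auto simp: trunc_def indicator_def)

lemma integrable_trunc: "integrable lborel (trunc n f)"
  by (rule integrable_bounded_support[OF square_integrable_trunc, of "ball 0 (real n)"])
    (auto simp: trunc_def)

lemma trunc_tendsto: "(\<lambda>n. abs_l2 (trunc n f)) \<longlonglongrightarrow> f"
proof -
  have "(\<lambda>n. abs_l2 (trunc n f)) \<longlonglongrightarrow> abs_l2 (rep_l2 f)"
  proof (rule l2_dominated_convergence(3)[OF square_integrable_rep[of f], where C = 1])
    have "(\<lambda>n. trunc n f x) \<longlonglongrightarrow> rep_l2 f x" for x
    proof (rule tendsto_eventually)
      obtain N :: nat where "norm x < real N" using reals_Archimedean2 by blast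
      thus "\<forall>\<^sub>F n in sequentially. trunc n f x = rep_l2 f x"
        by (auto simp: eventually_at_top_linorder trunc_def intro!: exI[of _ N])
    qed
    thus "AE x in lborel. (\<lambda>n. trunc n f x) \<longlonglongrightarrow> rep_l2 f x" by simp
  qed (auto simp: trunc_def indicator_def)
  thus ?thesis by (simp add: abs_rep_l2)
qed

lemma fourier_sign_eq_lim: "fourier_sign s f = lim (\<lambda>n. abs_l2 (ft s (trunc n f)))"
  by (simp add: fourier_sign_def set_lebesgue_integral_def ft_def [abs_def] trunc_def)

lemma norm_ft_diff_le:
  assumes "integrable lborel f" "integrable lborel g" "square_integrable f" "square_integrable g" "s\<^sup>2 = 1"
  shows "norm (abs_l2 (ft s f) - abs_l2 (ft s g)) \<le> norm (abs_l2 f - abs_l2 g)"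
proof -
  have "ft s (\<lambda>x. f x - g x) = (\<lambda>\<xi>. ft s f \<xi> - ft s g \<xi>)"
    by (intro ext ft_diff assms)
  hence "abs_l2 (ft s f) - abs_l2 (ft s g) = abs_l2 (ft s (\<lambda>x. f x - g x))"
    by (simp add: abs_l2_diff ft_contraction assms)
  also have "norm \<dots> \<le> norm (abs_l2 (\<lambda>x. f x - g x))"
    using assms by (intro ft_contraction) (auto intro: square_integrable_diff)
  finally show ?thesis using assms by (simp add: abs_l2_diff)
qed

text \<open>The contraction carries the Cauchy property of the truncations over to their transforms;
  by completeness the \<open>lim\<close> in the definition of \<open>fourier_sign\<close> is a true
  limit.\<close>

lemma fourier_sign_tendsto:
  assumes s: "s\<^sup>2 = 1"
  shows "(\<lambda>n. abs_l2 (ft s (trunc n f))) \<longlonglongrightarrow> fourier_sign s f"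
proof -
  have "Cauchy (\<lambda>n. abs_l2 (trunc n f))"
    using trunc_tendsto LIMSEQ_imp_Cauchy by blast
  hence "Cauchy (\<lambda>n. abs_l2 (ft s (trunc n f)))"
    unfolding Cauchy_iff
    using norm_ft_diff_le[OF integrable_trunc integrable_trunc square_integrable_trunc square_integrable_trunc s]
    by (meson le_less_trans)
  hence "convergent (\<lambda>n. abs_l2 (ft s (trunc n f)))" by (rule Cauchy_convergent)
  thus ?thesis by (simp add: convergent_LIMSEQ_iff fourier_sign_eq_lim)
qed

lemma norm_fourier_sign_le:
  assumes s: "s\<^sup>2 = 1"
  shows "norm (fourier_sign s f) \<le> norm f"
  by (rule LIMSEQ_le[OF tendsto_norm[OF fourier_sign_tendsto[OF s]] tendsto_norm[OF trunc_tendsto]])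
    (auto intro: ft_contraction integrable_trunc square_integrable_trunc s)

text \<open>The transforms of the truncations converge pointwise to the integral by dominated
  convergence and in L^2 to \<open>fourier_sign\<close>; the two limits coincide.\<close>

lemma fourier_sign_abs:
  assumes int: "integrable lborel g" and si: "square_integrable g" and s: "s\<^sup>2 = 1"
  shows "fourier_sign s (abs_l2 g) = abs_l2 (ft s g)"
proof (rule l2_tendsto_AE_unique(2)[OF fourier_sign_tendsto[OF s]])
  have [measurable]: "g \<in> borel_measurable borel" using si by (rule square_integrable_measurable)
  show "square_integrable (ft s (trunc n (abs_l2 g)))" for n
    by (intro ft_contraction integrable_trunc square_integrable_trunc s)
  show "ft s g \<in> borel_measurable borel" by measurable
  have "(\<lambda>n. ft s (trunc n (abs_l2 g)) \<xi>) \<longlonglongrightarrow> ft s g \<xi>" for \<xi>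
    unfolding ft_def
  proof (intro tendsto_mult tendsto_const integral_dominated_convergence[where w = "\<lambda>x. cmod (g x)"])
    show "integrable lborel (\<lambda>x. cmod (g x))" using int by (rule integrable_norm)
    show "AE x in lborel. (\<lambda>n. trunc n (abs_l2 g) x * cis (s * (x \<bullet> \<xi>))) \<longlonglongrightarrow> g x * cis (s * (x \<bullet> \<xi>))"
      using rep_abs_l2[OF si]
    proof eventually_elim
      case (elim x)
      obtain N :: nat where "norm x < real N" using reals_Archimedean2 by blast
      thus ?case
        by (intro tendsto_eventually)
          (auto simp: eventually_at_top_linorder trunc_def elim intro!: exI[of _ N])
    qed
    show "AE x in lborel. cmod (trunc n (abs_l2 g) x * cis (s * (x \<bullet> \<xi>))) \<le> cmod (g x)" for n
      using rep_abs_l2[OF si] by eventually_elim (auto simp: norm_mult trunc_def indicator_def)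
  qed measurable
  thus "AE \<xi> in lborel. (\<lambda>n. ft s (trunc n (abs_l2 g)) \<xi>) \<longlonglongrightarrow> ft s g \<xi>" by simp
qed

lemma l2_mult_scaleR: "r *\<^sub>R f = l2_mult (\<lambda>_. of_real r) f"
  using abs_l2_scaleR[OF square_integrable_rep[of f], of r]
  by (simp add: abs_rep_l2 l2_mult_def scaleR_conv_of_real)

text \<open>\<open>l2\<close> is only a real vector space, so complex homogeneity is expressed by
  multiplication with a constant function.\<close>

lemma fourier_sign_cmult:
  assumes s: "s\<^sup>2 = 1"
  shows "fourier_sign s (l2_mult (\<lambda>_. c) f) = l2_mult (\<lambda>_. c) (fourier_sign s f)"
proof (rule LIMSEQ_unique[OF fourier_sign_tendsto[OF s]])
  have "ft s (trunc n (l2_mult (\<lambda>_. c) f)) \<xi> = c * ft s (trunc n f) \<xi>" for n \<xi>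
    unfolding ft_cmult[symmetric]
  proof (rule ft_cong_AE)
    show "AE x in lborel. trunc n (l2_mult (\<lambda>_. c) f) x = c * trunc n f x"
      using rep_l2_mult[OF bdd_fun_const[of c], of f] by eventually_elim (simp add: trunc_def)
  qed measurable
  hence "ft s (trunc n (l2_mult (\<lambda>_. c) f)) = (\<lambda>\<xi>. c * ft s (trunc n f) \<xi>)" for n by (intro ext)
  hence eq: "abs_l2 (ft s (trunc n (l2_mult (\<lambda>_. c) f))) = l2_mult (\<lambda>_. c) (abs_l2 (ft s (trunc n f)))" for n
    by (simp add: l2_mult_bdd_abs bdd_fun_const ft_contraction integrable_trunc square_integrable_trunc s)
  show "(\<lambda>n. abs_l2 (ft s (trunc n (l2_mult (\<lambda>_. c) f)))) \<longlonglongrightarrow> l2_mult (\<lambda>_. c) (fourier_sign s f)"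
    unfolding eq
    by (intro bounded_linear.tendsto[OF bounded_linear_l2_mult[OF bdd_fun_const]] fourier_sign_tendsto s)
qed

lemma bounded_linear_fourier_sign:
  assumes s: "s\<^sup>2 = 1"
  shows "bounded_linear (fourier_sign s)"
proof (rule bounded_linear_intro[of _ 1])
  fix f g :: l2 and r :: real
  have "ft s (trunc n (f + g)) \<xi> = ft s (trunc n f) \<xi> + ft s (trunc n g) \<xi>" for n \<xi>
    unfolding ft_add[OF integrable_trunc integrable_trunc, symmetric]
  proof (rule ft_cong_AE)
    show "AE x in lborel. trunc n (f + g) x = trunc n f x + trunc n g x"
      using rep_l2_add[of f g] by eventually_elim (simp add: trunc_def scaleR_add_right)
  qed measurable
  hence "ft s (trunc n (f + g)) = (\<lambda>\<xi>. ft s (trunc n f) \<xi> + ft s (trunc n g) \<xi>)" for n by (intro ext)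
  hence eq: "abs_l2 (ft s (trunc n (f + g))) = abs_l2 (ft s (trunc n f)) + abs_l2 (ft s (trunc n g))" for n
    by (simp add: abs_l2_add ft_contraction integrable_trunc square_integrable_trunc s)
  show "fourier_sign s (f + g) = fourier_sign s f + fourier_sign s g"
    by (rule LIMSEQ_unique[OF fourier_sign_tendsto[OF s]])
      (unfold eq, intro tendsto_add fourier_sign_tendsto s)
  show "fourier_sign s (r *\<^sub>R f) = r *\<^sub>R fourier_sign s f"
    by (simp add: l2_mult_scaleR fourier_sign_cmult s)
  show "norm (fourier_sign s f) \<le> norm f * 1" using norm_fourier_sign_le[OF s] by simp
qed

text \<open>The kernel cis(s x \<xi>) is symmetric in its two variables. Fubini needs integrable
  functions, hence the detour over truncations of both arguments.\<close>

lemma pair_fourier_sign: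
  assumes s: "s\<^sup>2 = 1"
  shows "pair (fourier_sign s f) g = pair f (fourier_sign s g)"
proof -
  have eq: "pair (abs_l2 (ft s (trunc n f))) (abs_l2 (trunc n g)) = pair (abs_l2 (trunc n f)) (abs_l2 (ft s (trunc n g)))" for n
  proof -
    have "(LINT \<xi>|lborel. ft s (trunc n f) \<xi> * trunc n g \<xi>)
        = (LINT \<xi>|lborel. of_real unitary_factor * (trunc n g \<xi> * (LINT x|lborel. trunc n f x * cis (s * (x \<bullet> \<xi>)))))"
      by (rule Bochner_Integration.integral_cong) (simp_all only: ft_def mult_ac)
    also have "\<dots> = of_real unitary_factor * (LINT \<xi>|lborel. trunc n g \<xi> * (LINT x|lborel. trunc n f x * cis (s * (x \<bullet> \<xi>))))"
      by (rule integral_mult_right_zero)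
    also have "(LINT \<xi>|lborel. trunc n g \<xi> * (LINT x|lborel. trunc n f x * cis (s * (x \<bullet> \<xi>))))
        = (LINT x|lborel. trunc n f x * (LINT \<xi>|lborel. trunc n g \<xi> * cis (s * (x \<bullet> \<xi>))))"
      by (rule fubini_kernel[OF integrable_trunc integrable_trunc]) auto
    also have "of_real unitary_factor * \<dots>
        = (LINT x|lborel. of_real unitary_factor * (trunc n f x * (LINT \<xi>|lborel. trunc n g \<xi> * cis (s * (x \<bullet> \<xi>)))))"
      by (rule integral_mult_right_zero[symmetric])
    also have "\<dots> = (LINT x|lborel. trunc n f x * ft s (trunc n g) x)"
      by (rule Bochner_Integration.integral_cong) (simp_all only: ft_def mult_ac inner_commute)
    finally show ?thesis
      by (simp add: pair_abs ft_contraction integrable_trunc square_integrable_trunc s)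
  qed
  have "(\<lambda>n. pair (abs_l2 (ft s (trunc n f))) (abs_l2 (trunc n g))) \<longlonglongrightarrow> pair (fourier_sign s f) g"
    by (intro tendsto_pair fourier_sign_tendsto trunc_tendsto s)
  moreover have "(\<lambda>n. pair (abs_l2 (ft s (trunc n f))) (abs_l2 (trunc n g))) \<longlonglongrightarrow> pair f (fourier_sign s g)"
    unfolding eq by (intro tendsto_pair fourier_sign_tendsto trunc_tendsto s)
  ultimately show ?thesis by (rule LIMSEQ_unique)
qed

section \<open>Gaussian regularization and Fourier inversion\<close>

lemma bdd_fun_gauss: "Re z \<ge> 0 \<Longrightarrow> bdd_fun (\<lambda>\<xi>. exp (- z * of_real ((norm \<xi>)\<^sup>2)))"
  by (rule bdd_funI[of _ 1]) auto

text \<open>On the frequency side the multipliers converge with the transform of \<open>g\<close> as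
  majorant; on the space side they are convolutions with an explicit kernel. The limit point may lie
  on the imaginary axis, which is how the same lemma serves inversion and the Schroedinger
  kernel.\<close>

lemma gauss_regularization:
  assumes int: "integrable lborel g" and si: "square_integrable g" and s: "s\<^sup>2 = 1"
    and zn: "\<And>n. Re (z n) > 0" "z \<longlonglongrightarrow> z\<^sub>0" and z0: "Re z\<^sub>0 \<ge> 0"
  shows "square_integrable (\<lambda>x. LINT y|lborel. g y * gauss_kernel (z n) (y - x))"
    and "(\<lambda>n. abs_l2 (\<lambda>x. LINT y|lborel. g y * gauss_kernel (z n) (y - x)))
      \<longlonglongrightarrow> fourier_sign (- s) (l2_mult (\<lambda>\<xi>. exp (- z\<^sub>0 * of_real ((norm \<xi>)\<^sup>2))) (fourier_sign s (abs_l2 g)))"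
proof -
  have s': "(- s)\<^sup>2 = 1" using s by simp
  have [measurable]: "g \<in> borel_measurable borel" using si by (rule square_integrable_measurable)
  define h where "h w \<xi> = exp (- w * of_real ((norm \<xi>)\<^sup>2)) * ft s g \<xi>" for w \<xi>
  note fsi = ft_contraction(1)[OF int si s]
  have hsi: "square_integrable (h w)" if "Re w \<ge> 0" for w
    unfolding h_def [abs_def] by (rule square_integrable_bdd_mult[OF bdd_fun_gauss[OF that] fsi])
  have hint: "integrable lborel (h (z n))" for n
  proof -
    let ?C = "unitary_factor * (LINT x|lborel. cmod (g x))"
    show ?thesis
    proof (rule Bochner_Integration.integrable_bound)
      show "integrable lborel (\<lambda>\<xi>::real^3. ?C * exp (- (Re (z n) * (norm \<xi>)\<^sup>2)))"
        by (intro integrable_mult_right gaussian_real zn)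
      show "AE \<xi> in lborel. norm (h (z n) \<xi>) \<le> norm (?C * exp (- (Re (z n) * (norm \<xi>)\<^sup>2)))"
        using ft_bound[of s g]
        by (auto simp: h_def norm_mult abs_mult mult.commute[of "exp _"] intro!: AE_I2 mult_right_mono order_trans[OF _ abs_ge_self])
    qed (unfold h_def [abs_def], measurable)
  qed
  have eq: "(\<lambda>x. LINT y|lborel. g y * gauss_kernel (z n) (y - x)) = ft (- s) (h (z n))" for n
    using ft_gauss_ft[OF int zn(1) s] unfolding h_def [abs_def] by auto
  show "square_integrable (\<lambda>x. LINT y|lborel. g y * gauss_kernel (z n) (y - x))"
    unfolding eq using zn(1)[of n] by (intro ft_contraction hint hsi s') auto
  have "(\<lambda>n. abs_l2 (h (z n))) \<longlonglongrightarrow> abs_l2 (h z\<^sub>0)"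
  proof (rule l2_dominated_convergence(3)[OF fsi, where C = 1])
    show "AE \<xi> in lborel. (\<lambda>n. h (z n) \<xi>) \<longlonglongrightarrow> h z\<^sub>0 \<xi>"
      unfolding h_def by (intro AE_I2 tendsto_intros zn)
    show "AE \<xi> in lborel. cmod (h (z n) \<xi>) \<le> 1 * cmod (ft s g \<xi>)" for n
      using zn(1)[of n] by (auto simp: h_def norm_mult intro!: AE_I2 mult_left_le_one_le)
  qed (unfold h_def [abs_def], measurable)
  from bounded_linear.tendsto[OF bounded_linear_fourier_sign[OF s'] this]
  have "(\<lambda>n. fourier_sign (- s) (abs_l2 (h (z n)))) \<longlonglongrightarrow> fourier_sign (- s) (abs_l2 (h z\<^sub>0))" .
  also have "(\<lambda>n. fourier_sign (- s) (abs_l2 (h (z n)))) = (\<lambda>n. abs_l2 (ft (- s) (h (z n))))"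
    using zn(1) by (intro ext fourier_sign_abs hint hsi s') (auto intro: less_imp_le)
  also have "abs_l2 (h z\<^sub>0) = l2_mult (\<lambda>\<xi>. exp (- z\<^sub>0 * of_real ((norm \<xi>)\<^sup>2))) (fourier_sign s (abs_l2 g))"
    unfolding h_def [abs_def] fourier_sign_abs[OF int si s] l2_mult_bdd_abs[OF bdd_fun_gauss[OF z0] fsi] ..
  finally show "(\<lambda>n. abs_l2 (\<lambda>x. LINT y|lborel. g y * gauss_kernel (z n) (y - x)))
      \<longlonglongrightarrow> fourier_sign (- s) (l2_mult (\<lambda>\<xi>. exp (- z\<^sub>0 * of_real ((norm \<xi>)\<^sup>2))) (fourier_sign s (abs_l2 g)))"
    unfolding eq .
qed

lemma heat_kernel_scale: "d > 0 \<Longrightarrow> d ^ 3 * heat_kernel (d\<^sup>2) (d *\<^sub>R w) = heat_kernel 1 w"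
proof -
  assume d: "d > 0"
  have "sqrt (pi / d\<^sup>2) = sqrt pi / d" using d by (simp add: real_sqrt_divide)
  thus ?thesis using d by (simp add: heat_kernel_def power_divide power_mult_distrib)
qed

text \<open>Taking the parameter to be a square d^2 makes y = x + d w a linear substitution after
  which the kernel no longer depends on d; only the argument of \<psi> does, and it tends to
  x.\<close>

lemma heat_kernel_approx_identity:
  assumes cont: "continuous_on UNIV \<psi>" and bd: "\<And>x. cmod (\<psi> x) \<le> B"
  shows "(\<lambda>n. LINT y|lborel. \<psi> y * of_real (heat_kernel ((inverse (real (Suc n)))\<^sup>2) (y - x))) \<longlonglongrightarrow> \<psi> x"
proof -
  have [measurable]: "\<psi> \<in> borel_measurable borel" using cont by (rule borel_measurable_continuous_onI)
  have sub: "(LINT y|lborel. \<psi> y * of_real (heat_kernel (d\<^sup>2) (y - x)))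
      = (LINT w|lborel. \<psi> (x + d *\<^sub>R w) * of_real (heat_kernel 1 w))" if d: "d > 0" for d
  proof -
    have "(LINT y|lborel. \<psi> y * of_real (heat_kernel (d\<^sup>2) (y - x)))
        = (LINT y|density (distr lborel borel (\<lambda>w. x + d *\<^sub>R w)) (\<lambda>_. ennreal (\<bar>d\<bar> ^ 3)). \<psi> y * of_real (heat_kernel (d\<^sup>2) (y - x)))"
      using lborel_affine[of d x] d by simp
    also have "\<dots> = (LINT y|distr lborel borel (\<lambda>w. x + d *\<^sub>R w). (\<bar>d\<bar> ^ 3) *\<^sub>R (\<psi> y * of_real (heat_kernel (d\<^sup>2) (y - x))))"
      by (subst integral_density) auto
    also have "\<dots> = (LINT w|lborel. (\<bar>d\<bar> ^ 3) *\<^sub>R (\<psi> (x + d *\<^sub>R w) * of_real (heat_kernel (d\<^sup>2) (d *\<^sub>R w))))"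
      by (subst integral_distr) auto
    also have "\<dots> = (LINT w|lborel. \<psi> (x + d *\<^sub>R w) * of_real (d ^ 3 * heat_kernel (d\<^sup>2) (d *\<^sub>R w)))"
      using d by (simp add: scaleR_conv_of_real mult_ac)
    finally show ?thesis by (simp only: heat_kernel_scale[OF d])
  qed
  have "(\<lambda>n. LINT w|lborel. \<psi> (x + inverse (real (Suc n)) *\<^sub>R w) * of_real (heat_kernel 1 w))
      \<longlonglongrightarrow> (LINT w|lborel. \<psi> x * of_real (heat_kernel 1 w))"
  proof (rule integral_dominated_convergence[where w = "\<lambda>w. B * heat_kernel 1 w"])
    show "integrable lborel (\<lambda>w. B * heat_kernel 1 w)" by (intro integrable_mult_right integrable_heat_kernel) simp
    have "(\<lambda>n. \<psi> (x + inverse (real (Suc n)) *\<^sub>R w) * of_real (heat_kernel 1 w)) \<longlonglongrightarrow> \<psi> x * of_real (heat_kernel 1 w)" for w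
    proof (intro tendsto_mult tendsto_const)
      have "(\<lambda>n. x + inverse (real (Suc n)) *\<^sub>R w) \<longlonglongrightarrow> x + 0 *\<^sub>R w"
        by (intro tendsto_intros LIMSEQ_inverse_real_of_nat)
      thus "(\<lambda>n. \<psi> (x + inverse (real (Suc n)) *\<^sub>R w)) \<longlonglongrightarrow> \<psi> x"
        using continuous_on_tendsto_compose[OF cont, of _ x] by simp
    qed
    thus "AE w in lborel. (\<lambda>n. \<psi> (x + inverse (real (Suc n)) *\<^sub>R w) * of_real (heat_kernel 1 w)) \<longlonglongrightarrow> \<psi> x * of_real (heat_kernel 1 w)"
      by simp
    show "AE w in lborel. cmod (\<psi> (x + inverse (real (Suc n)) *\<^sub>R w) * of_real (heat_kernel 1 w)) \<le> B * heat_kernel 1 w" for n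
      using bd heat_kernel_nonneg[of 1] by (auto simp: norm_mult abs_of_nonneg intro!: AE_I2 mult_right_mono)
  qed measurable
  also have "(LINT w|lborel. \<psi> x * of_real (heat_kernel 1 w)) = \<psi> x"
    by (simp add: integral_heat_kernel)
  finally show ?thesis by (simp only: sub positive_imp_inverse_positive of_nat_0_less_iff zero_less_Suc)
qed

lemma test_function_compact:
  assumes "test_function \<psi>"
  obtains K where "compact K" "\<And>x. x \<notin> K \<Longrightarrow> \<psi> x = 0"
proof (rule that[of "closure {x. \<psi> x \<noteq> 0}"])
  show "compact (closure {x. \<psi> x \<noteq> 0})" using assms by (simp add: test_function_def)
  show "\<psi> x = 0" if "x \<notin> closure {x. \<psi> x \<noteq> 0}" for x
    using that closure_subset[of "{x. \<psi> x \<noteq> 0}"] by blast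
qed

lemma test_function_continuous: "test_function \<psi> \<Longrightarrow> continuous_on UNIV \<psi>"
  unfolding test_function_def smooth_def using C_k.simps(1) by blast

lemma test_function_bounded:
  assumes "test_function \<psi>"
  obtains B where "\<And>x. cmod (\<psi> x) \<le> B"
proof -
  obtain K where K: "compact K" "\<And>x. x \<notin> K \<Longrightarrow> \<psi> x = 0" using test_function_compact[OF assms] by blast
  have "bounded (\<psi> ` K)"
    by (intro compact_imp_bounded compact_continuous_image K continuous_on_subset[OF test_function_continuous[OF assms]]) auto
  then obtain B where B: "\<And>x. x \<in> K \<Longrightarrow> cmod (\<psi> x) \<le> B" by (auto simp: bounded_iff)
  have "cmod (\<psi> x) \<le> max B 0" for x using B[of x] K(2)[of x] by (cases "x \<in> K") auto
  thus ?thesis by (rule that)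
qed

lemma test_function_integrable:
  assumes "test_function \<psi>"
  shows "integrable lborel \<psi>"
proof -
  obtain K where K: "compact K" "\<And>x. x \<notin> K \<Longrightarrow> \<psi> x = 0" using test_function_compact[OF assms] by blast
  show ?thesis
    by (rule integrable_bounded_support[OF test_function_derivative(1)[OF assms], of K])
      (use K in \<open>auto intro: compact_imp_bounded borel_compact\<close>)
qed

text \<open>Regularize with z tending to 0: in L^2 the limit is the double transform, while
  pointwise the heat kernel reproduces \<psi>. Continuity and boundedness of \<psi> are what the
  pointwise limit uses.\<close>

lemma fourier_sign_inverse_test:
  assumes t: "test_function \<psi>" and s: "s\<^sup>2 = 1"
  shows "fourier_sign (- s) (fourier_sign s (abs_l2 \<psi>)) = abs_l2 \<psi>"
proof -
  define z where "z n = complex_of_real ((inverse (real (Suc n)))\<^sup>2)" for n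
  note int = test_function_integrable[OF t] and si = test_function_derivative(1)[OF t]
  have z: "Re (z n) > 0" for n by (simp add: z_def)
  have "z \<longlonglongrightarrow> of_real (0\<^sup>2)"
    unfolding z_def by (intro tendsto_intros LIMSEQ_inverse_real_of_nat)
  hence z': "z \<longlonglongrightarrow> 0" by simp
  note reg = gauss_regularization[OF int si s z z', simplified]
  obtain B where B: "\<And>x. cmod (\<psi> x) \<le> B" using test_function_bounded[OF t] by blast
  have "(\<lambda>n. LINT y|lborel. \<psi> y * gauss_kernel (z n) (y - x)) \<longlonglongrightarrow> \<psi> x" for x
    using heat_kernel_approx_identity[OF test_function_continuous[OF t] B, of x]
    by (simp add: z_def gauss_kernel_of_real del: of_real_power)
  hence "fourier_sign (- s) (l2_mult (\<lambda>_. 1) (fourier_sign s (abs_l2 \<psi>))) = abs_l2 \<psi>"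
    by (intro l2_tendsto_AE_unique(2)[OF reg(2) reg(1)]) (auto intro: square_integrable_measurable si)
  thus ?thesis by (simp add: l2_mult_1)
qed

text \<open>Symmetry of \<open>pair\<close> moves both transforms onto a test function. They arrive
  there in the reverse order, so the case of test functions enters with the opposite sign.\<close>

lemma fourier_sign_inverse:
  assumes s: "s\<^sup>2 = 1"
  shows "fourier_sign (- s) (fourier_sign s f) = f"
proof (rule l2_eqI_pair)
  fix \<psi> :: "real^3 \<Rightarrow> complex" assume t: "test_function \<psi>"
  have s': "(- s)\<^sup>2 = 1" using s by simp
  have "pair (fourier_sign (- s) (fourier_sign s f)) (abs_l2 \<psi>) = pair f (fourier_sign s (fourier_sign (- s) (abs_l2 \<psi>)))"
    by (simp only: pair_fourier_sign s s')
  also have "fourier_sign s (fourier_sign (- s) (abs_l2 \<psi>)) = abs_l2 \<psi>"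
    using fourier_sign_inverse_test[OF t s'] by simp
  finally show "pair (fourier_sign (- s) (fourier_sign s f)) (abs_l2 \<psi>) = pair f (abs_l2 \<psi>)" .
qed

text \<open>A contraction whose inverse is a contraction is an isometry.\<close>

lemma norm_fourier_sign:
  assumes s: "s\<^sup>2 = 1"
  shows "norm (fourier_sign s f) = norm f"
proof (rule antisym)
  have "norm (fourier_sign (- s) (fourier_sign s f)) \<le> norm (fourier_sign s f)"
    by (rule norm_fourier_sign_le) (simp add: s)
  thus "norm f \<le> norm (fourier_sign s f)" by (simp add: fourier_sign_inverse s)
qed (rule norm_fourier_sign_le[OF s])

section \<open>Derivatives and the Fourier transform\<close>

lemma C_k_bounded_linear: "bounded_linear q \<Longrightarrow> C_k n q"
proof (induction n)
  case 0
  thus ?case by (simp add: linear_continuous_on)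
next
  case (Suc n)
  show ?case
    by (rule C_k_SucI[where f' = "\<lambda>_. q"]) (use Suc.prems in \<open>auto intro: bounded_linear_imp_has_derivative\<close>)
qed

lemma C_k_exp:
  fixes q :: "'a::real_normed_vector \<Rightarrow> complex"
  shows "C_k n q \<Longrightarrow> C_k n (\<lambda>x. exp (q x))"
proof (induction n)
  case 0
  thus ?case by (auto intro: continuous_intros)
next
  case (Suc n)
  show ?case
  proof (rule C_k_SucI[where f' = "\<lambda>x v. exp (q x) * frechet_derivative q (at x) v"])
    show "((\<lambda>x. exp (q x)) has_derivative (\<lambda>v. exp (q x) * frechet_derivative q (at x) v)) (at x)" for x
      using has_derivative_compose[OF C_k_has_derivative[OF Suc.prems], of exp "(*) (exp (q x))" x] DERIV_exp[of "q x"]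
      by (simp add: has_field_derivative_def)
    show "C_k n (\<lambda>x. exp (q x) * frechet_derivative q (at x) v)" for v
      using Suc.prems C_k_SucD[OF Suc.prems] by (intro C_k_mult Suc.IH) auto
  qed
qed

lemma C_k_scaleR_arg:
  fixes f :: "'a::real_normed_vector \<Rightarrow> 'b::real_normed_algebra_1"
  shows "C_k n f \<Longrightarrow> C_k n (\<lambda>x. f (c *\<^sub>R x))"
proof (induction n arbitrary: f)
  case 0
  thus ?case by (auto intro!: continuous_intros continuous_on_compose2[of UNIV f])
next
  case (Suc n)
  show ?case
  proof (rule C_k_SucI[where f' = "\<lambda>x v. of_real c * frechet_derivative f (at (c *\<^sub>R x)) v"])
    fix x :: 'a
    have lin: "linear (frechet_derivative f (at (c *\<^sub>R x)))"
      using C_k_has_derivative[OF Suc.prems] has_derivative_linear by blast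
    have "((\<lambda>x. c *\<^sub>R x) has_derivative (\<lambda>v. c *\<^sub>R v)) (at x)"
      by (rule bounded_linear_imp_has_derivative[OF bounded_linear_scaleR_right])
    from has_derivative_compose[OF this C_k_has_derivative[OF Suc.prems]]
    show "((\<lambda>x. f (c *\<^sub>R x)) has_derivative (\<lambda>v. of_real c * frechet_derivative f (at (c *\<^sub>R x)) v)) (at x)"
      by (simp add: linear_scale[OF lin] scaleR_conv_of_real)
    show "C_k n (\<lambda>x. of_real c * frechet_derivative f (at (c *\<^sub>R x)) v)" for v
      using Suc.prems Suc.IH[of "\<lambda>x. frechet_derivative f (at x) v"] by (intro C_k_mult) auto
  qed
qed

lemma frechet_derivative_scaleR_arg:
  fixes f :: "'a::real_normed_vector \<Rightarrow> complex"
  assumes "smooth f"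
  shows "frechet_derivative (\<lambda>x. f (c *\<^sub>R x)) (at x) v = of_real c * frechet_derivative f (at (c *\<^sub>R x)) v"
proof -
  have C: "C_k (Suc 0) f" using assms by (simp only: smooth_def)
  have lin: "linear (frechet_derivative f (at (c *\<^sub>R x)))"
    using C_k_has_derivative[OF C] has_derivative_linear by blast
  have "((\<lambda>x. c *\<^sub>R x) has_derivative (\<lambda>v. c *\<^sub>R v)) (at x)"
    by (rule bounded_linear_imp_has_derivative[OF bounded_linear_scaleR_right])
  from has_derivative_compose[OF this C_k_has_derivative[OF C]]
  have "((\<lambda>x. f (c *\<^sub>R x)) has_derivative (\<lambda>v. of_real c * frechet_derivative f (at (c *\<^sub>R x)) v)) (at x)"
    by (simp add: linear_scale[OF lin] scaleR_conv_of_real)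
  from frechet_derivative_at[OF this] show ?thesis by (metis)
qed

lemma frechet_derivative_times:
  fixes f g :: "'a::real_normed_vector \<Rightarrow> complex"
  assumes "C_k (Suc 0) f" "C_k (Suc 0) g"
  shows "frechet_derivative (\<lambda>x. f x * g x) (at x) v
    = f x * frechet_derivative g (at x) v + frechet_derivative f (at x) v * g x"
  using frechet_derivative_at[OF has_derivative_mult[OF C_k_has_derivative[OF assms(1)] C_k_has_derivative[OF assms(2)]]]
  by metis

lemma test_function_iff: "test_function \<psi> \<longleftrightarrow> smooth \<psi> \<and> bounded {x. \<psi> x \<noteq> 0}"
  by (simp add: test_function_def compact_closure)

lemma smooth_C_k: "smooth f \<Longrightarrow> C_k n f"
  by (simp add: smooth_def)

lemma test_function_smooth: "test_function \<psi> \<Longrightarrow> smooth \<psi>"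
  by (simp add: test_function_def)

lemma smooth_mult:
  fixes f g :: "'a::real_normed_vector \<Rightarrow> complex"
  shows "smooth f \<Longrightarrow> smooth g \<Longrightarrow> smooth (\<lambda>x. f x * g x)"
  by (simp add: smooth_def C_k_mult)

lemma smooth_frechet: "smooth f \<Longrightarrow> smooth (\<lambda>x. frechet_derivative f (at x) v)"
  unfolding smooth_def using C_k.simps(2) by blast

lemma smooth_continuous: "smooth f \<Longrightarrow> continuous_on UNIV f"
  unfolding smooth_def using C_k.simps(1) by blast

lemma smooth_measurable:
  fixes f :: "real^3 \<Rightarrow> complex"
  shows "smooth f \<Longrightarrow> f \<in> borel_measurable borel"
  by (rule borel_measurable_continuous_onI[OF smooth_continuous])

lemma test_function_mult:
  assumes "test_function \<theta>" "smooth \<psi>"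
  shows "test_function (\<lambda>x. \<theta> x * \<psi> x)"
proof -
  have "{x. \<theta> x * \<psi> x \<noteq> 0} \<subseteq> {x. \<theta> x \<noteq> 0}" by auto
  thus ?thesis using assms bounded_subset by (auto simp: test_function_iff smooth_mult)
qed

lemma test_function_frechet:
  assumes "test_function \<psi>"
  shows "test_function (\<lambda>x. frechet_derivative \<psi> (at x) v)"
proof -
  obtain K where K: "compact K" "\<And>x. x \<notin> K \<Longrightarrow> \<psi> x = 0" using test_function_compact[OF assms] by blast
  have "frechet_derivative \<psi> (at x) v = 0" if "x \<notin> K" for x
  proof -
    have "(\<psi> has_derivative (\<lambda>_. 0)) (at x)"
      by (rule has_derivative_transform_within_open[of "\<lambda>_. 0" _ _ _ "- K"])
        (use that K in \<open>auto intro: compact_imp_closed\<close>)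
    thus ?thesis by (metis frechet_derivative_at)
  qed
  hence "{x. frechet_derivative \<psi> (at x) v \<noteq> 0} \<subseteq> K" by auto
  from bounded_subset[OF compact_imp_bounded[OF K(1)] this] show ?thesis
    using assms by (simp add: test_function_iff smooth_frechet)
qed

text \<open>The difference quotients have integral zero by translation invariance. The mean value
  inequality bounds them uniformly, and they converge to the derivative under dominated
  convergence.\<close>

lemma integral_frechet_test:
  assumes t: "test_function f"
  shows "(LINT x|lborel. frechet_derivative f (at x) v) = 0"
proof -
  define D where "D x = frechet_derivative f (at x) v" for x
  have C1: "C_k (Suc 0) f" using t by (intro smooth_C_k test_function_smooth)
  have tD: "test_function D" unfolding D_def [abs_def] by (rule test_function_frechet[OF t])
  obtain B where B: "\<And>x. cmod (D x) \<le> B" using test_function_bounded[OF tD] by blast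
  have B0: "B \<ge> 0" using B[of 0] norm_ge_zero order_trans by blast
  have int: "integrable lborel f" by (rule test_function_integrable[OF t])
  have [measurable]: "f \<in> borel_measurable borel" "D \<in> borel_measurable borel"
    using t tD by (auto intro: smooth_measurable test_function_smooth)
  obtain r where r: "\<And>x. f x \<noteq> 0 \<Longrightarrow> norm x \<le> r" using t by (auto simp: test_function_iff bounded_iff)
  define h where "h n = inverse (real (Suc n))" for n
  have h: "h n > 0" "h n \<le> 1" for n by (auto simp: h_def field_simps)
  have h0: "h \<longlonglongrightarrow> 0" unfolding h_def by (rule LIMSEQ_inverse_real_of_nat)
  have shift: "integrable lborel (\<lambda>x. f (x + c))" "(LINT x|lborel. f (x + c)) = (LINT x|lborel. f x)" for c
    using lborel_translate[of f c] int by (simp_all add: add.commute)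
  have gd: "((\<lambda>t. f (x + t *\<^sub>R v)) has_derivative (\<lambda>t. t *\<^sub>R D (x + s *\<^sub>R v))) (at s)" for x s
  proof -
    have lin: "linear (frechet_derivative f (at (x + s *\<^sub>R v)))"
      using C_k_has_derivative[OF C1] has_derivative_linear by blast
    have "((\<lambda>t. x + t *\<^sub>R v) has_derivative (\<lambda>t. t *\<^sub>R v)) (at s)"
      by (auto intro!: derivative_eq_intros)
    from has_derivative_compose[OF this C_k_has_derivative[OF C1]]
    show ?thesis by (simp add: linear_scale[OF lin] D_def)
  qed
  have lip: "cmod (f (x + h n *\<^sub>R v) - f x) \<le> h n * B" for x n
  proof -
    have "\<exists>s\<in>{0<..<h n}. norm (f (x + h n *\<^sub>R v) - f (x + 0 *\<^sub>R v)) \<le> norm ((h n - 0) *\<^sub>R D (x + s *\<^sub>R v))"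
      by (rule mvt_general[OF h(1), where f = "\<lambda>t. f (x + t *\<^sub>R v)" and f' = "\<lambda>s t. t *\<^sub>R D (x + s *\<^sub>R v)"])
        (auto intro!: gd has_derivative_continuous_on[OF has_derivative_at_withinI[OF gd]])
    then obtain s where "norm (f (x + h n *\<^sub>R v) - f x) \<le> h n * norm (D (x + s *\<^sub>R v))"
      using h(1)[of n] by auto
    also have "\<dots> \<le> h n * B" using h(1)[of n] B by (intro mult_left_mono) auto
    finally show ?thesis .
  qed
  have "(\<lambda>n. LINT x|lborel. (1 / h n) *\<^sub>R (f (x + h n *\<^sub>R v) - f x)) \<longlonglongrightarrow> (LINT x|lborel. D x)"
  \<comment> \<open>All quotients vanish outside a common ball: the support lies in radius
    \<open>r\<close>, and since \<open>h n\<close> is at most 1 the shift adds at most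
    \<open>norm v\<close>.\<close>
  proof (rule integral_dominated_convergence[where w = "\<lambda>x. B * indicator (cball 0 (r + norm v)) x"])
    show "integrable lborel (\<lambda>x::real^3. B * indicator (cball 0 (r + norm v)) x)"
      using emeasure_bounded_finite[of "cball (0::real^3) (r + norm v)"]
      by (intro integrable_mult_right integrable_real_indicator) auto
    have "(\<lambda>n. (1 / h n) *\<^sub>R (f (x + h n *\<^sub>R v) - f x)) \<longlonglongrightarrow> D x" for x
    proof -
      have "((\<lambda>t. norm (f (x + t *\<^sub>R v) - f x - t *\<^sub>R D x) / norm t) \<longlongrightarrow> 0) (at 0)"
        using gd[of x 0] by (simp add: has_derivative_at)
      hence "(\<lambda>n. norm (f (x + h n *\<^sub>R v) - f x - h n *\<^sub>R D x) / norm (h n)) \<longlonglongrightarrow> 0"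
        unfolding tendsto_at_iff_sequentially using h0 h(1) by (auto simp: o_def less_imp_neq[THEN not_sym])
      also have "(\<lambda>n. norm (f (x + h n *\<^sub>R v) - f x - h n *\<^sub>R D x) / norm (h n))
          = (\<lambda>n. norm ((1 / h n) *\<^sub>R (f (x + h n *\<^sub>R v) - f x) - D x))"
      proof
        fix n
        have "(1 / h n) *\<^sub>R (f (x + h n *\<^sub>R v) - f x) - D x = (1 / h n) *\<^sub>R (f (x + h n *\<^sub>R v) - f x - h n *\<^sub>R D x)"
          using h(1)[of n] by (simp add: scaleR_diff_right)
        thus "norm (f (x + h n *\<^sub>R v) - f x - h n *\<^sub>R D x) / norm (h n) = norm ((1 / h n) *\<^sub>R (f (x + h n *\<^sub>R v) - f x) - D x)"
          by simp
      qed
      finally show ?thesis by (simp add: LIM_zero_iff tendsto_norm_zero_iff)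
    qed
    thus "AE x in lborel. (\<lambda>n. (1 / h n) *\<^sub>R (f (x + h n *\<^sub>R v) - f x)) \<longlonglongrightarrow> D x" by simp
    have "norm ((1 / h n) *\<^sub>R (f (x + h n *\<^sub>R v) - f x)) \<le> B * indicator (cball 0 (r + norm v)) x" for n x
    proof (cases "norm x \<le> r + norm v")
      case True
      have "norm ((1 / h n) *\<^sub>R (f (x + h n *\<^sub>R v) - f x)) = norm (f (x + h n *\<^sub>R v) - f x) / h n"
        using h(1)[of n] by simp
      also have "\<dots> \<le> B" using lip[of x n] h(1)[of n] by (simp add: pos_divide_le_eq mult.commute)
      finally show ?thesis using True by simp
    next
      case False
      have nr: "norm (h n *\<^sub>R v) \<le> norm v" using h[of n] by (simp add: mult_left_le_one_le)
      have "norm x > r" using False norm_ge_zero[of v] by linarith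
      moreover have "norm (x + h n *\<^sub>R v) > r"
        using norm_triangle_ineq4[of "x + h n *\<^sub>R v" "h n *\<^sub>R v"] nr False by simp
      ultimately have "f x = 0" "f (x + h n *\<^sub>R v) = 0" using r by force+
      thus ?thesis using B0 by simp
    qed
    thus "AE x in lborel. norm ((1 / h n) *\<^sub>R (f (x + h n *\<^sub>R v) - f x)) \<le> B * indicator (cball 0 (r + norm v)) x" for n
      by simp
  qed measurable
  moreover have "(LINT x|lborel. (1 / h n) *\<^sub>R (f (x + h n *\<^sub>R v) - f x)) = 0" for n
    using shift int by simp
  ultimately have "(\<lambda>n. 0::complex) \<longlonglongrightarrow> (LINT x|lborel. D x)" by (simp only:)
  from LIMSEQ_unique[OF this tendsto_const] show ?thesis by (simp add: D_def)
qed

text \<open>Dilations of one fixed bump. They tend pointwise to the constant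
  \<open>cutoff 0 0\<close>, the value of the bump at the origin, which is exp(-6) and not 1; in the
  limits it appears as a nonzero factor and is cancelled.\<close>

definition cutoff :: "nat \<Rightarrow> real^3 \<Rightarrow> complex" where
  "cutoff n x = box_bump (- 1) 1 1 (inverse (real (Suc n)) *\<^sub>R x)"

lemma test_function_cutoff: "test_function (cutoff n)"
proof -
  let ?c = "inverse (real (Suc n))"
  have t: "test_function (box_bump (- 1) 1 1)" by (rule test_function_box_bump)
  have "{x. cutoff n x \<noteq> 0} \<subseteq> (\<lambda>x. (1 / ?c) *\<^sub>R x) ` {x. box_bump (- 1) 1 1 x \<noteq> 0}"
  proof
    fix x assume "x \<in> {x. cutoff n x \<noteq> 0}"
    hence "?c *\<^sub>R x \<in> {x. box_bump (- 1) 1 1 x \<noteq> 0}" by (simp add: cutoff_def)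
    moreover have "x = (1 / ?c) *\<^sub>R (?c *\<^sub>R x)" by simp
    ultimately show "x \<in> (\<lambda>x. (1 / ?c) *\<^sub>R x) ` {x. box_bump (- 1) 1 1 x \<noteq> 0}" by blast
  qed
  moreover have "bounded ((\<lambda>x. (1 / ?c) *\<^sub>R x) ` {x. box_bump (- 1) 1 1 x \<noteq> 0})"
    using t by (intro bounded_scaling) (simp add: test_function_iff)
  moreover have "smooth (cutoff n)"
    unfolding smooth_def cutoff_def [abs_def]
    by (intro allI C_k_scaleR_arg smooth_C_k test_function_smooth[OF t])
  ultimately show ?thesis using bounded_subset by (auto simp: test_function_iff)
qed

lemma norm_cutoff_le: "cmod (cutoff n x) \<le> 1"
  by (simp add: cutoff_def norm_box_bump_le)

lemma inverse_Suc_scaleR_tendsto: "(\<lambda>n. inverse (real (Suc n)) *\<^sub>R x) \<longlonglongrightarrow> (0::'a::real_normed_vector)"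
proof -
  have "(\<lambda>n. inverse (real (Suc n)) *\<^sub>R x) \<longlonglongrightarrow> 0 *\<^sub>R x"
    by (intro tendsto_intros LIMSEQ_inverse_real_of_nat)
  thus ?thesis by simp
qed

lemma cutoff_tendsto: "(\<lambda>n. cutoff n x) \<longlonglongrightarrow> cutoff 0 0"
  using continuous_on_tendsto_compose[OF smooth_continuous[OF test_function_smooth[OF test_function_box_bump[of "- 1" 1 1]]] inverse_Suc_scaleR_tendsto[of x]]
  by (simp add: cutoff_def)

lemma cutoff_0_nonzero: "cutoff 0 0 \<noteq> 0"
  by (simp add: cutoff_def box_bump_def Defs.flat_def)

lemma frechet_cutoff:
  obtains B where "\<And>n x. cmod (frechet_derivative (cutoff n) (at x) v) \<le> B * inverse (real (Suc n))" "B \<ge> 0"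
proof -
  let ?b = "box_bump (- 1) 1 1"
  obtain B where B: "\<And>x. cmod (frechet_derivative ?b (at x) v) \<le> B"
    using test_function_bounded[OF test_function_frechet[OF test_function_box_bump]] by blast
  have "cmod (frechet_derivative (cutoff n) (at x) v) \<le> B * inverse (real (Suc n))" for n x
    unfolding cutoff_def [abs_def] frechet_derivative_scaleR_arg[OF test_function_smooth[OF test_function_box_bump]]
    unfolding norm_mult norm_of_real
    using mult_left_mono[OF B[of "inverse (real (Suc n)) *\<^sub>R x"], of "inverse (real (Suc n))"]
    by (simp only: mult.commute abs_inverse abs_of_nat inverse_nonnegative_iff_nonnegative of_nat_0_le_iff)
  moreover have "B \<ge> 0" using B[of 0] norm_ge_zero order_trans by blast
  ultimately show ?thesis by (rule that)
qed

lemma frechet_cutoff_mult: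
  assumes "smooth \<psi>"
  shows "frechet_derivative (\<lambda>x. cutoff n x * \<psi> x) (at x) v
    = cutoff n x * frechet_derivative \<psi> (at x) v + frechet_derivative (cutoff n) (at x) v * \<psi> x"
  by (intro frechet_derivative_times smooth_C_k assms test_function_smooth test_function_cutoff)

lemma frechet_cutoff_tendsto: "(\<lambda>n. frechet_derivative (cutoff n) (at x) v) \<longlonglongrightarrow> 0"
proof -
  obtain B where B: "\<And>n x. cmod (frechet_derivative (cutoff n) (at x) v) \<le> B * inverse (real (Suc n))"
    using frechet_cutoff by blast
  have "(\<lambda>n. B * inverse (real (Suc n))) \<longlonglongrightarrow> B * 0"
    by (intro tendsto_intros LIMSEQ_inverse_real_of_nat)
  hence "(\<lambda>n. B * inverse (real (Suc n))) \<longlonglongrightarrow> 0" by simp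
  thus ?thesis by (rule Lim_null_comparison[OF always_eventually, rotated]) (use B in blast)
qed

lemma frechet_cutoff_bounded:
  obtains B where "\<And>n x. cmod (frechet_derivative (cutoff n) (at x) v) \<le> B"
proof -
  obtain B where B: "\<And>n x. cmod (frechet_derivative (cutoff n) (at x) v) \<le> B * inverse (real (Suc n))" "B \<ge> 0"
    using frechet_cutoff by blast
  have "B * inverse (real (Suc n)) \<le> B" for n
    using B(2) by (intro mult_left_le) (auto simp: field_simps)
  thus ?thesis using B(1) order_trans by (intro that[of B]) blast
qed

text \<open>Multiply by \<open>cutoff n\<close>: the product is a test function, and the extra term
  of the product rule disappears in the limit because the gradient of the cutoff decays like 1 / (n
  + 1).\<close>

lemma integral_frechet_0:
  fixes f :: "real^3 \<Rightarrow> complex"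
  assumes sm: "smooth f" and int: "integrable lborel f" "integrable lborel (\<lambda>x. frechet_derivative f (at x) v)"
  shows "(LINT x|lborel. frechet_derivative f (at x) v) = 0"
proof -
  obtain B where B: "\<And>n x. cmod (frechet_derivative (cutoff n) (at x) v) \<le> B"
    using frechet_cutoff_bounded by blast
  note [measurable] = smooth_measurable[OF sm] smooth_measurable[OF smooth_frechet[OF sm]]
    smooth_measurable[OF test_function_smooth[OF test_function_cutoff]]
    smooth_measurable[OF smooth_frechet[OF test_function_smooth[OF test_function_cutoff]]]
  have "(\<lambda>n. LINT x|lborel. frechet_derivative (\<lambda>x. cutoff n x * f x) (at x) v)
      \<longlonglongrightarrow> (LINT x|lborel. cutoff 0 0 * frechet_derivative f (at x) v + 0 * f x)"
    unfolding frechet_cutoff_mult[OF sm]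
  proof (rule integral_dominated_convergence[where w = "\<lambda>x. cmod (frechet_derivative f (at x) v) + B * cmod (f x)"])
    show "integrable lborel (\<lambda>x. cmod (frechet_derivative f (at x) v) + B * cmod (f x))"
      using int by (intro Bochner_Integration.integrable_add integrable_mult_right integrable_norm)
    show "AE x in lborel. (\<lambda>n. cutoff n x * frechet_derivative f (at x) v + frechet_derivative (cutoff n) (at x) v * f x)
        \<longlonglongrightarrow> cutoff 0 0 * frechet_derivative f (at x) v + 0 * f x"
      by (intro AE_I2 tendsto_intros cutoff_tendsto frechet_cutoff_tendsto)
    show "AE x in lborel. cmod (cutoff n x * frechet_derivative f (at x) v + frechet_derivative (cutoff n) (at x) v * f x)
        \<le> cmod (frechet_derivative f (at x) v) + B * cmod (f x)" for n
    proof (rule AE_I2)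
      fix x
      show "cmod (cutoff n x * frechet_derivative f (at x) v + frechet_derivative (cutoff n) (at x) v * f x)
        \<le> cmod (frechet_derivative f (at x) v) + B * cmod (f x)"
        using norm_cutoff_le[of n x] B[of n x]
        by (intro norm_triangle_le add_mono) (auto simp: norm_mult intro: mult_left_le_one_le mult_right_mono)
    qed
  qed measurable
  moreover have "(LINT x|lborel. frechet_derivative (\<lambda>x. cutoff n x * f x) (at x) v) = 0" for n
    by (rule integral_frechet_test[OF test_function_mult[OF test_function_cutoff sm]])
  ultimately have "(\<lambda>n. 0) \<longlonglongrightarrow> cutoff 0 0 * (LINT x|lborel. frechet_derivative f (at x) v)" by simp
  from LIMSEQ_unique[OF this tendsto_const] show ?thesis using cutoff_0_nonzero by simp
qed

lemma smooth_cis_inner: "smooth (\<lambda>x. cis (s * (x \<bullet> \<xi>)))"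
  unfolding smooth_def cis_conv_exp
proof (intro allI C_k_exp C_k_bounded_linear)
  show "bounded_linear (\<lambda>x. \<i> * complex_of_real (s * (x \<bullet> \<xi>)))"
    by (intro bounded_linear_const_mult bounded_linear_compose[OF bounded_linear_of_real]
        bounded_linear_inner_left)
qed

lemma frechet_cis_inner:
  "frechet_derivative (\<lambda>x. cis (s * (x \<bullet> \<xi>))) (at x) v = \<i> * of_real (s * (v \<bullet> \<xi>)) * cis (s * (x \<bullet> \<xi>))"
proof -
  let ?q = "\<lambda>x. \<i> * complex_of_real (s * (x \<bullet> \<xi>))"
  have "bounded_linear ?q"
    by (intro bounded_linear_const_mult bounded_linear_compose[OF bounded_linear_of_real]
        bounded_linear_inner_left)
  hence "(?q has_derivative ?q) (at x)" by (rule bounded_linear_imp_has_derivative)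
  from has_derivative_compose[OF this, of exp "(*) (exp (?q x))"] DERIV_exp[of "?q x"]
  have "((\<lambda>x. exp (?q x)) has_derivative (\<lambda>v. exp (?q x) * ?q v)) (at x)"
    by (simp add: has_field_derivative_def)
  from frechet_derivative_at[OF this, symmetric] show ?thesis
    by (simp add: cis_conv_exp mult.commute)
qed

text \<open>Integration by parts, in the form that the derivative of \<psi> times the exponential
  integrates to zero.\<close>

lemma ft_frechet:
  assumes sm: "smooth \<psi>" and int: "integrable lborel \<psi>" "integrable lborel (\<lambda>x. frechet_derivative \<psi> (at x) v)"
  shows "ft s (\<lambda>x. frechet_derivative \<psi> (at x) v) \<xi> = - (\<i> * of_real (s * (v \<bullet> \<xi>))) * ft s \<psi> \<xi>"
proof -
  have d: "frechet_derivative (\<lambda>x. \<psi> x * cis (s * (x \<bullet> \<xi>))) (at x) v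
     = \<i> * of_real (s * (v \<bullet> \<xi>)) * (\<psi> x * cis (s * (x \<bullet> \<xi>))) + frechet_derivative \<psi> (at x) v * cis (s * (x \<bullet> \<xi>))" for x
    by (subst frechet_derivative_times[OF smooth_C_k[OF sm] smooth_C_k[OF smooth_cis_inner]])
      (simp add: frechet_cis_inner mult_ac)
  have "(LINT x|lborel. frechet_derivative (\<lambda>x. \<psi> x * cis (s * (x \<bullet> \<xi>))) (at x) v) = 0"
  proof (rule integral_frechet_0)
    show "smooth (\<lambda>x. \<psi> x * cis (s * (x \<bullet> \<xi>)))" by (intro smooth_mult sm smooth_cis_inner)
  qed (unfold d, auto intro!: integrable_mult_cis int Bochner_Integration.integrable_add integrable_mult_right)
  hence "\<i> * of_real (s * (v \<bullet> \<xi>)) * (LINT x|lborel. \<psi> x * cis (s * (x \<bullet> \<xi>)))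
      + (LINT x|lborel. frechet_derivative \<psi> (at x) v * cis (s * (x \<bullet> \<xi>))) = 0"
    unfolding d by (subst (asm) Bochner_Integration.integral_add)
      (auto intro!: integrable_mult_cis int integrable_mult_right)
  hence e: "(LINT x|lborel. frechet_derivative \<psi> (at x) v * cis (s * (x \<bullet> \<xi>)))
      = - (\<i> * of_real (s * (v \<bullet> \<xi>)) * (LINT x|lborel. \<psi> x * cis (s * (x \<bullet> \<xi>))))"
    by (simp only: add_eq_0_iff)
  show ?thesis unfolding ft_def e by (simp only: mult_ac mult_minus_left mult_minus_right)
qed

section \<open>Gaussian test functions\<close>

lemma integrable_gaussian_shift:
  assumes "a > 0"
  shows "integrable lborel (\<lambda>y::real^3. exp (- (a * (norm (y - x))\<^sup>2)))"
  using lborel_translate(1)[of "\<lambda>y::real^3. exp (- (a * (norm y)\<^sup>2))" "- x"] gaussian_real(1)[OF assms] by simp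

lemma square_integrable_gaussian_shift:
  assumes "a > 0"
  shows "square_integrable (\<lambda>y. complex_of_real (exp (- (a * (norm (y - x))\<^sup>2))))"
proof -
  have "(cmod (complex_of_real (exp (- (a * (norm (y - x))\<^sup>2)))))\<^sup>2 = exp (- (2 * a * (norm (y - x))\<^sup>2))" for y :: "real^3"
    by (simp add: exp_double[symmetric])
  thus ?thesis
    using integrable_gaussian_shift[of "2 * a" x] assms by (simp add: square_integrable_def)
qed

text \<open>Translates of a Gaussian serve as tests for the symbol of a weak derivative: their
  transforms are explicit and nowhere zero, and the translation appears in them only as a
  modulation.\<close>

definition gauss_bump :: "real^3 \<Rightarrow> real^3 \<Rightarrow> complex" where
  "gauss_bump x y = exp (- of_real ((norm (y - x))\<^sup>2 / 2))"

lemma gauss_bump_eq: "gauss_bump x y = of_real (exp (- (1 / 2 * (norm (y - x))\<^sup>2)))"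
  by (simp add: gauss_bump_def exp_of_real[symmetric])

lemma gauss_exponent_derivative:
  fixes x y :: "real^3"
  shows "((\<lambda>y. - complex_of_real ((norm (y - x))\<^sup>2 / 2)) has_derivative (\<lambda>v. - complex_of_real ((y - x) \<bullet> v))) (at y)"
proof -
  have "((\<lambda>y. (y - x) \<bullet> (y - x) / 2) has_derivative (\<lambda>v. (y - x) \<bullet> v)) (at y)"
    by (auto intro!: derivative_eq_intros simp: inner_commute)
  from has_derivative_minus[OF has_derivative_of_real[OF this, where 'a = complex]]
  show ?thesis by (simp add: power2_norm_eq_inner)
qed

lemma smooth_gauss_bump: "smooth (gauss_bump x)"
  unfolding smooth_def gauss_bump_def [abs_def]
proof (intro allI C_k_exp)
  fix n
  show "C_k n (\<lambda>y. - complex_of_real ((norm (y - x))\<^sup>2 / 2))"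
  proof (cases n)
    case 0
    thus ?thesis by (auto intro!: continuous_intros)
  next
    case (Suc k)
    show ?thesis unfolding Suc
    proof (rule C_k_SucI[OF gauss_exponent_derivative])
      fix v
      have "C_k k (\<lambda>y. - complex_of_real (y \<bullet> v) + complex_of_real (x \<bullet> v))"
        by (intro C_k_add C_k_const C_k_bounded_linear bounded_linear_minus
            bounded_linear_compose[OF bounded_linear_of_real] bounded_linear_inner_left)
      thus "C_k k (\<lambda>y. - complex_of_real ((y - x) \<bullet> v))" by (simp add: inner_diff_left)
    qed
  qed
qed

lemma frechet_gauss_bump: "frechet_derivative (gauss_bump x) (at y) v = - of_real ((y - x) \<bullet> v) * gauss_bump x y"
proof -
  let ?q = "\<lambda>y. - complex_of_real ((norm (y - x))\<^sup>2 / 2)"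
  from has_derivative_compose[OF gauss_exponent_derivative, of exp "(*) (exp (?q y))" y x] DERIV_exp[of "?q y"]
  have "(gauss_bump x has_derivative (\<lambda>v. gauss_bump x y * - complex_of_real ((y - x) \<bullet> v))) (at y)"
    by (simp add: has_field_derivative_def gauss_bump_def [abs_def])
  from frechet_derivative_at[OF this, symmetric] show ?thesis by simp
qed

lemma le_exp_square: "t \<le> 2 * exp (t\<^sup>2 / 4 :: real)"
proof -
  have "0 \<le> (t - 1)\<^sup>2" by simp
  hence "t \<le> 2 * (1 + t\<^sup>2 / 4)" by (simp add: power2_diff)
  also have "\<dots> \<le> 2 * exp (t\<^sup>2 / 4)" by (intro mult_left_mono exp_ge_add_one_self) simp
  finally show ?thesis .
qed

text \<open>The linear factor produced by differentiating a Gaussian is absorbed by giving up half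
  of the exponent.\<close>

lemma mult_gauss_le:
  fixes c t :: real
  assumes "\<bar>c\<bar> \<le> t"
  shows "\<bar>c\<bar> * exp (- (t\<^sup>2 / 2)) \<le> 2 * exp (- (1 / 4 * t\<^sup>2))"
proof -
  have "\<bar>c\<bar> * exp (- (t\<^sup>2 / 2)) \<le> (2 * exp (t\<^sup>2 / 4)) * exp (- (t\<^sup>2 / 2))"
    using le_exp_square[of t] assms by (intro mult_right_mono) auto
  also have "\<dots> = 2 * exp (- (1 / 4 * t\<^sup>2))"
    by (simp add: exp_add[symmetric])
  finally show ?thesis .
qed

lemma norm_frechet_gauss_bump:
  assumes "norm v \<le> 1"
  shows "cmod (frechet_derivative (gauss_bump x) (at y) v) \<le> 2 * exp (- (1 / 4 * (norm (y - x))\<^sup>2))"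
proof -
  have "\<bar>(y - x) \<bullet> v\<bar> \<le> norm (y - x)"
    using Cauchy_Schwarz_ineq2[of "y - x" v] mult_left_mono[OF assms norm_ge_zero[of "y - x"]] by simp
  from mult_gauss_le[OF this] show ?thesis
    by (simp add: frechet_gauss_bump gauss_bump_eq norm_mult)
qed

lemma gauss_bump_integrable:
  "integrable lborel (gauss_bump x)" "square_integrable (gauss_bump x)"
  using integrable_gaussian_shift[of "1/2" x] square_integrable_gaussian_shift[of "1/2" x]
  by (simp_all only: gauss_bump_eq [abs_def] complex_of_real_integrable_eq zero_less_divide_iff zero_less_one zero_less_numeral simp_thms)

lemma frechet_gauss_bump_integrable:
  assumes "norm v \<le> 1"
  shows "integrable lborel (\<lambda>y. frechet_derivative (gauss_bump x) (at y) v)"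
    "square_integrable (\<lambda>y. frechet_derivative (gauss_bump x) (at y) v)"
proof -
  note [measurable] = smooth_measurable[OF smooth_frechet[OF smooth_gauss_bump]]
  show "integrable lborel (\<lambda>y. frechet_derivative (gauss_bump x) (at y) v)"
  proof (rule Bochner_Integration.integrable_bound)
    show "integrable lborel (\<lambda>y. 2 * exp (- (1 / 4 * (norm (y - x))\<^sup>2)))"
      by (intro integrable_mult_right integrable_gaussian_shift) simp
    show "AE y in lborel. norm (frechet_derivative (gauss_bump x) (at y) v) \<le> norm (2 * exp (- (1 / 4 * (norm (y - x))\<^sup>2)))"
      using norm_frechet_gauss_bump[OF assms] by (intro AE_I2) (simp add: abs_mult)
  qed measurable
  show "square_integrable (\<lambda>y. frechet_derivative (gauss_bump x) (at y) v)"
    by (rule square_integrable_bounded_by[OF square_integrable_gaussian_shift[of "1 / 4" x], of _ 2])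
      (use norm_frechet_gauss_bump[OF assms] in \<open>auto intro!: AE_I2\<close>)
qed

lemma ft_gauss_bump:
  assumes s: "s\<^sup>2 = 1"
  obtains k where "k \<noteq> 0" "\<And>x \<xi>. ft s (gauss_bump x) \<xi> = k * cis (s * (x \<bullet> \<xi>)) * of_real (exp (- ((norm \<xi>)\<^sup>2 / 2)))"
proof -
  have s1: "\<bar>s\<bar> = 1" using s by (auto simp: power2_eq_1_iff)
  have "ft s (gauss_bump x) \<xi> = of_real (unitary_factor * sqrt (2 * pi) ^ 3) * cis (s * (x \<bullet> \<xi>)) * of_real (exp (- ((norm \<xi>)\<^sup>2 / 2)))" for x \<xi>
  proof -
    note [measurable] = smooth_measurable[OF smooth_gauss_bump]
    have "(LINT y|lborel. gauss_bump x y * cis (s * (y \<bullet> \<xi>)))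
        = (LINT y|lborel. gauss_bump x (x + y) * cis (s * ((x + y) \<bullet> \<xi>)))"
      by (rule lborel_translate(2)[symmetric]) measurable
    also have "\<dots> = (LINT y|lborel. cis (s * (x \<bullet> \<xi>)) * (cis ((s *\<^sub>R \<xi>) \<bullet> y) * complex_of_real (exp (- (1/2 * (norm y)\<^sup>2)))))"
    proof (rule Bochner_Integration.integral_cong)
      fix y :: "real^3"
      have "cis (s * ((x + y) \<bullet> \<xi>)) = cis (s * (x \<bullet> \<xi>)) * cis ((s *\<^sub>R \<xi>) \<bullet> y)"
        by (simp only: inner_add_left distrib_left cis_mult inner_scaleR_left inner_commute[of \<xi> y])
      thus "gauss_bump x (x + y) * cis (s * ((x + y) \<bullet> \<xi>))
          = cis (s * (x \<bullet> \<xi>)) * (cis ((s *\<^sub>R \<xi>) \<bullet> y) * complex_of_real (exp (- (1/2 * (norm y)\<^sup>2))))"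
        by (simp add: gauss_bump_eq)
    qed simp
    also have "\<dots> = cis (s * (x \<bullet> \<xi>)) * (LINT y|lborel. cis ((s *\<^sub>R \<xi>) \<bullet> y) * complex_of_real (exp (- (1/2 * (norm y)\<^sup>2))))"
      by (rule integral_mult_right_zero)
    also have "(LINT y|lborel. cis ((s *\<^sub>R \<xi>) \<bullet> y) * complex_of_real (exp (- (1/2 * (norm y)\<^sup>2))))
        = of_real (sqrt (2 * pi) ^ 3 * exp (- ((norm \<xi>)\<^sup>2 / 2)))"
      by (subst gaussian_real(2)) (simp_all add: s1 mult.commute)
    finally show ?thesis by (simp add: ft_def)
  qed
  moreover have "complex_of_real (unitary_factor * sqrt (2 * pi) ^ 3) \<noteq> 0" by simp
  ultimately show ?thesis by (rule that[rotated])
qed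

lemma pair_cutoff_tendsto:
  assumes "square_integrable \<psi>"
  shows "(\<lambda>n. pair f (abs_l2 (\<lambda>x. cutoff n x * \<psi> x))) \<longlonglongrightarrow> cutoff 0 0 * pair f (abs_l2 \<psi>)"
proof -
  note [measurable] = smooth_measurable[OF test_function_smooth[OF test_function_cutoff]]
    square_integrable_measurable[OF assms]
  have "(\<lambda>n. abs_l2 (\<lambda>x. cutoff n x * \<psi> x)) \<longlonglongrightarrow> abs_l2 (\<lambda>x. cutoff 0 0 * \<psi> x)"
  proof (rule l2_dominated_convergence(3)[OF assms, where C = 1])
    show "AE x in lborel. (\<lambda>n. cutoff n x * \<psi> x) \<longlonglongrightarrow> cutoff 0 0 * \<psi> x"
      by (intro AE_I2 tendsto_intros cutoff_tendsto)
    show "AE x in lborel. cmod (cutoff n x * \<psi> x) \<le> 1 * cmod (\<psi> x)" for n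
      using norm_cutoff_le by (intro AE_I2) (auto simp: norm_mult intro!: mult_left_le_one_le)
  qed measurable
  hence "(\<lambda>n. pair f (abs_l2 (\<lambda>x. cutoff n x * \<psi> x))) \<longlonglongrightarrow> pair f (abs_l2 (\<lambda>x. cutoff 0 0 * \<psi> x))"
    by (intro tendsto_pair tendsto_const)
  also have "pair f (abs_l2 (\<lambda>x. cutoff 0 0 * \<psi> x)) = cutoff 0 0 * pair f (abs_l2 \<psi>)"
    unfolding pair_abs_right[OF assms] pair_abs_right[OF square_integrable_bdd_mult[OF bdd_fun_const assms]]
      integral_mult_right_zero[symmetric] by (simp only: mult.left_commute)
  finally show ?thesis .
qed

lemma pair_frechet_cutoff_tendsto:
  assumes "square_integrable \<psi>"
  shows "(\<lambda>n. pair f (abs_l2 (\<lambda>x. frechet_derivative (cutoff n) (at x) v * \<psi> x))) \<longlonglongrightarrow> 0"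
proof -
  note [measurable] = smooth_measurable[OF smooth_frechet[OF test_function_smooth[OF test_function_cutoff]]]
    square_integrable_measurable[OF assms]
  obtain B where B: "\<And>n x. cmod (frechet_derivative (cutoff n) (at x) v) \<le> B"
    using frechet_cutoff_bounded by blast
  have "(\<lambda>n. abs_l2 (\<lambda>x. frechet_derivative (cutoff n) (at x) v * \<psi> x)) \<longlonglongrightarrow> abs_l2 (\<lambda>x. 0 * \<psi> x)"
  proof (rule l2_dominated_convergence(3)[OF assms, where C = B])
    show "AE x in lborel. (\<lambda>n. frechet_derivative (cutoff n) (at x) v * \<psi> x) \<longlonglongrightarrow> 0 * \<psi> x"
      by (intro AE_I2 tendsto_intros frechet_cutoff_tendsto)
    show "AE x in lborel. cmod (frechet_derivative (cutoff n) (at x) v * \<psi> x) \<le> B * cmod (\<psi> x)" for n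
      using B by (intro AE_I2) (auto simp: norm_mult intro!: mult_right_mono)
  qed measurable
  hence "(\<lambda>n. pair f (abs_l2 (\<lambda>x. frechet_derivative (cutoff n) (at x) v * \<psi> x))) \<longlonglongrightarrow> pair f (abs_l2 (\<lambda>x. 0 * \<psi> x))"
    by (intro tendsto_pair tendsto_const)
  also have "pair f (abs_l2 (\<lambda>x. 0 * \<psi> x)) = 0"
    by (simp add: pair_abs_right square_integrable_0)
  finally show ?thesis .
qed

text \<open>Enlarges the class of admissible tests beyond compact support, so that Gaussians may be
  used. The identity is tested with \<open>cutoff n\<close> times \<psi>; in the limit the constant
  \<open>cutoff 0 0\<close> multiplies both sides.\<close>

lemma weak_partial_smooth:
  assumes w: "weak_partial j f g" and sm: "smooth \<psi>" and si: "square_integrable \<psi>"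
    "square_integrable (\<lambda>x. frechet_derivative \<psi> (at x) (axis j 1))"
  shows "pair f (abs_l2 (\<lambda>x. frechet_derivative \<psi> (at x) (axis j 1))) = - pair g (abs_l2 \<psi>)"
proof -
  let ?d = "\<lambda>\<psi> x. frechet_derivative \<psi> (at x) (axis j 1)"
  have bd: "bdd_fun (cutoff n)" "bdd_fun (?d (cutoff n))" for n
  proof -
    show "bdd_fun (cutoff n)"
      by (rule bdd_funI[OF smooth_measurable[OF test_function_smooth[OF test_function_cutoff]] norm_cutoff_le])
    obtain B where "\<And>n x. cmod (?d (cutoff n) x) \<le> B" using frechet_cutoff_bounded by blast
    thus "bdd_fun (?d (cutoff n))"
      by (intro bdd_funI[OF smooth_measurable[OF smooth_frechet[OF test_function_smooth[OF test_function_cutoff]]]])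
  qed
  have "pair f (abs_l2 (\<lambda>x. cutoff n x * ?d \<psi> x)) + pair f (abs_l2 (\<lambda>x. ?d (cutoff n) x * \<psi> x))
      = - pair g (abs_l2 (\<lambda>x. cutoff n x * \<psi> x))" for n
  proof -
    have "pair f (abs_l2 (?d (\<lambda>x. cutoff n x * \<psi> x))) = - pair g (abs_l2 (\<lambda>x. cutoff n x * \<psi> x))"
      using w test_function_mult[OF test_function_cutoff sm] by (simp add: weak_partial_iff_pair)
    also have "abs_l2 (?d (\<lambda>x. cutoff n x * \<psi> x)) = abs_l2 (\<lambda>x. cutoff n x * ?d \<psi> x) + abs_l2 (\<lambda>x. ?d (cutoff n) x * \<psi> x)"
      by (simp add: frechet_cutoff_mult[OF sm] abs_l2_add square_integrable_bdd_mult bd si)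
    finally show ?thesis by (simp add: bounded_bilinear.add_right[OF bounded_bilinear_pair])
  qed
  moreover have "(\<lambda>n. pair f (abs_l2 (\<lambda>x. cutoff n x * ?d \<psi> x)) + pair f (abs_l2 (\<lambda>x. ?d (cutoff n) x * \<psi> x)))
      \<longlonglongrightarrow> cutoff 0 0 * pair f (abs_l2 (?d \<psi>)) + 0"
    by (intro tendsto_add pair_cutoff_tendsto pair_frechet_cutoff_tendsto si)
  moreover have "(\<lambda>n. - pair g (abs_l2 (\<lambda>x. cutoff n x * \<psi> x))) \<longlonglongrightarrow> - (cutoff 0 0 * pair g (abs_l2 \<psi>))"
    by (intro tendsto_minus pair_cutoff_tendsto si)
  ultimately have "cutoff 0 0 * pair f (abs_l2 (?d \<psi>)) + 0 = - (cutoff 0 0 * pair g (abs_l2 \<psi>))"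
    by (simp add: LIMSEQ_unique)
  hence "cutoff 0 0 * pair f (abs_l2 (?d \<psi>)) = cutoff 0 0 * - pair g (abs_l2 \<psi>)" by simp
  thus ?thesis using cutoff_0_nonzero by (simp only: mult_cancel_left) simp
qed

section \<open>Weak derivatives as Fourier multipliers\<close>

lemma norm_axis_le: "norm (axis j 1 :: real^3) \<le> 1"
  by simp

lemma inner_axis_1: "(axis j 1 :: real^3) \<bullet> \<xi> = \<xi> $ j"
  by (simp add: inner_axis' )

text \<open>Testing with the Gaussian centred at x says that the transform of one fixed function
  \<open>D\<close> vanishes at x, where x is arbitrary. Plancherel then gives \<open>D\<close> = 0,
  and the Gaussian weight in \<open>D\<close> can be divided out.\<close>

lemma weak_partial_fourier:
  assumes w: "weak_partial j f g"
  shows "AE \<xi> in lborel. rep_l2 (fourier g) \<xi> = \<i> * of_real (\<xi> $ j) * rep_l2 (fourier f) \<xi>"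
proof -
  have s: "(1::real)\<^sup>2 = 1" "(- 1::real)\<^sup>2 = 1" by simp_all
  obtain k where k: "k \<noteq> 0" "\<And>x \<xi>. ft 1 (gauss_bump x) \<xi> = k * cis (x \<bullet> \<xi>) * of_real (exp (- ((norm \<xi>)\<^sup>2 / 2)))"
    using ft_gauss_bump[OF s(1)] by auto
  define F where "F = rep_l2 (fourier f)"
  define G where "G = rep_l2 (fourier g)"
  define E where "E \<xi> = complex_of_real (exp (- ((norm \<xi>)\<^sup>2 / 2)))" for \<xi> :: "real^3"
  define E1 where "E1 \<xi> = \<i> * of_real (\<xi> $ j) * E \<xi>" for \<xi> :: "real^3"
  \<comment> \<open>\<open>F\<close> and \<open>G\<close> are only square integrable; the weights
    \<open>E\<close> and \<open>E1\<close> make \<open>D\<close> integrable as well, so that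
    \<open>ft 1 D\<close> is also its L^2 transform.\<close>
  define D where "D \<xi> = F \<xi> * E1 \<xi> - G \<xi> * E \<xi>" for \<xi>
  have [measurable]: "F \<in> borel_measurable borel" "G \<in> borel_measurable borel" "E \<in> borel_measurable borel"
    "E1 \<in> borel_measurable borel"
    unfolding F_def G_def E_def [abs_def] E1_def [abs_def] by measurable
  have bE: "cmod (E \<xi>) \<le> 1" for \<xi> by (simp add: E_def)
  have bE1: "cmod (E1 \<xi>) \<le> 2 * exp (- (1 / 4 * (norm \<xi>)\<^sup>2))" for \<xi>
    using mult_gauss_le[OF component_le_norm_cart[of \<xi> j]] by (simp add: E1_def E_def norm_mult)
  have bE1': "cmod (E1 \<xi>) \<le> 2" for \<xi> by (rule order_trans[OF bE1]) simp
  have siE: "square_integrable E" "square_integrable E1"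
  proof -
    show "square_integrable E" using square_integrable_gaussian_shift[of "1/2" 0] by (simp add: E_def [abs_def])
    show "square_integrable E1"
      by (rule square_integrable_bounded_by[OF square_integrable_gaussian_shift[of "1/4" 0], of _ 2])
        (use bE1 in auto)
  qed
  have siFG: "square_integrable F" "square_integrable G" unfolding F_def G_def by (rule square_integrable_rep)+
  have siD: "square_integrable D"
  proof -
    have "square_integrable (\<lambda>\<xi>. E1 \<xi> * F \<xi>)" "square_integrable (\<lambda>\<xi>. E \<xi> * G \<xi>)"
      by (auto intro!: square_integrable_bdd_mult siFG bdd_funI[OF _ bE1'] bdd_funI[OF _ bE])
    from square_integrable_diff[OF this] show ?thesis by (simp add: D_def [abs_def] mult.commute)
  qed
  have intD: "integrable lborel D"
    unfolding D_def [abs_def]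
    by (intro Bochner_Integration.integrable_diff square_integrable_mult siFG siE)
  have inv: "fourier_sign 1 (abs_l2 F) = f" "fourier_sign 1 (abs_l2 G) = g"
    using fourier_sign_inverse[OF s(2)] by (simp_all add: F_def G_def abs_rep_l2 fourier_def)
  have "ft 1 D x = 0" for x
  proof -
    let ?\<psi> = "gauss_bump x"
    let ?d = "\<lambda>y. frechet_derivative ?\<psi> (at y) (axis j 1)"
    note i1 = gauss_bump_integrable[of x] and i2 = frechet_gauss_bump_integrable[OF norm_axis_le[of j], of x]
    have "pair f (abs_l2 ?d) = - pair g (abs_l2 ?\<psi>)"
      by (rule weak_partial_smooth[OF w smooth_gauss_bump i1(2) i2(2)])
    moreover have "pair g (abs_l2 ?\<psi>) = (LINT \<xi>|lborel. k * (G \<xi> * E \<xi> * cis (\<xi> \<bullet> x)))"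
    proof -
      have "pair (fourier_sign 1 (abs_l2 G)) (abs_l2 ?\<psi>) = pair (abs_l2 G) (abs_l2 (ft 1 ?\<psi>))"
        by (simp add: pair_fourier_sign fourier_sign_abs i1)
      also have "\<dots> = (LINT \<xi>|lborel. G \<xi> * ft 1 ?\<psi> \<xi>)"
        by (intro pair_abs siFG ft_contraction i1 s)
      finally show ?thesis by (simp add: inv k(2) E_def inner_commute mult_ac)
    qed
    moreover have "pair f (abs_l2 ?d) = (LINT \<xi>|lborel. k * - (F \<xi> * E1 \<xi> * cis (\<xi> \<bullet> x)))"
    proof -
      have "pair (fourier_sign 1 (abs_l2 F)) (abs_l2 ?d) = pair (abs_l2 F) (abs_l2 (ft 1 ?d))"
        by (simp add: pair_fourier_sign fourier_sign_abs i2)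
      also have "\<dots> = (LINT \<xi>|lborel. F \<xi> * ft 1 ?d \<xi>)"
        by (intro pair_abs siFG ft_contraction i2 s)
      also have "ft 1 ?d = (\<lambda>\<xi>. - (\<i> * of_real (\<xi> $ j)) * ft 1 ?\<psi> \<xi>)"
        by (intro ext) (simp add: ft_frechet[OF smooth_gauss_bump i1(1) i2(1)] inner_axis_1)
      finally show ?thesis by (simp add: inv k(2) E_def E1_def inner_commute mult_ac)
    qed
    ultimately have "k * (LINT \<xi>|lborel. F \<xi> * E1 \<xi> * cis (\<xi> \<bullet> x)) = k * (LINT \<xi>|lborel. G \<xi> * E \<xi> * cis (\<xi> \<bullet> x))"
      by simp
    hence "(LINT \<xi>|lborel. F \<xi> * E1 \<xi> * cis (\<xi> \<bullet> x)) - (LINT \<xi>|lborel. G \<xi> * E \<xi> * cis (\<xi> \<bullet> x)) = 0"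
      using k(1) by simp
    moreover have "integrable lborel (\<lambda>\<xi>. F \<xi> * E1 \<xi> * cis (\<xi> \<bullet> x))" "integrable lborel (\<lambda>\<xi>. G \<xi> * E \<xi> * cis (\<xi> \<bullet> x))"
      using integrable_mult_cis[OF square_integrable_mult[OF siFG(1) siE(2)], of 1 x]
        integrable_mult_cis[OF square_integrable_mult[OF siFG(2) siE(1)], of 1 x] by simp_all
    ultimately show ?thesis by (simp add: ft_def D_def left_diff_distrib)
  qed
  hence "ft 1 D = (\<lambda>_. 0)" by (intro ext)
  hence "fourier_sign 1 (abs_l2 D) = abs_l2 (\<lambda>_. 0)"
    by (simp add: fourier_sign_abs[OF intD siD])
  hence "norm (abs_l2 D) = 0"
    using norm_fourier_sign[OF s(1), of "abs_l2 D"] by (simp add: zero_l2_def[symmetric])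
  hence "(\<integral>\<^sup>+x. ennreal ((cmod (D x))\<^sup>2) \<partial>lborel) = 0"
    by (simp only: nn_integral_norm_abs_l2[OF siD]) simp
  hence "AE \<xi> in lborel. ennreal ((cmod (D \<xi>))\<^sup>2) = 0"
    using square_integrable_measurable[OF siD] by (subst (asm) nn_integral_0_iff_AE) auto
  thus ?thesis
  proof eventually_elim
    case (elim \<xi>)
    hence "E \<xi> * (\<i> * of_real (\<xi> $ j) * F \<xi>) = E \<xi> * G \<xi>" by (simp add: D_def E1_def mult_ac)
    moreover have "E \<xi> \<noteq> 0" by (simp add: E_def)
    ultimately show ?case by (simp only: mult_cancel_left F_def G_def) simp
  qed
qed

text \<open>Converse of \<open>weak_partial_fourier\<close>: transferring the transform to the test
  function turns its derivative into a factor -i \<xi>_j, which is then moved onto the transform of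
  \<open>f\<close>.\<close>

lemma weak_partial_fourierI:
  assumes "square_integrable (\<lambda>\<xi>. \<i> * of_real (\<xi> $ j) * rep_l2 (fourier f) \<xi>)" (is "square_integrable ?m")
  shows "weak_partial j f (inverse_fourier (abs_l2 ?m))"
  unfolding weak_partial_iff_pair
proof (intro allI impI)
  fix \<psi> :: "real^3 \<Rightarrow> complex" assume t: "test_function \<psi>"
  let ?d = "\<lambda>y. frechet_derivative \<psi> (at y) (axis j 1)"
  let ?F = "rep_l2 (fourier f)"
  have s: "(1::real)\<^sup>2 = 1" "(- 1::real)\<^sup>2 = 1" by simp_all
  have inv: "fourier_sign 1 (abs_l2 ?F) = f"
    using fourier_sign_inverse[OF s(2)] by (simp add: abs_rep_l2 fourier_def)
  note i = test_function_integrable[OF t] test_function_derivative(1)[OF t]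
  note di = test_function_integrable[OF test_function_frechet[OF t]] test_function_derivative(2)[OF t]
  have "pair (fourier_sign 1 (abs_l2 ?F)) (abs_l2 ?d) = pair (abs_l2 ?F) (abs_l2 (ft 1 ?d))"
    by (simp add: pair_fourier_sign fourier_sign_abs di)
  also have "\<dots> = (LINT \<xi>|lborel. ?F \<xi> * ft 1 ?d \<xi>)"
    by (intro pair_abs square_integrable_rep ft_contraction di s)
  also have "\<dots> = - (LINT \<xi>|lborel. ?m \<xi> * ft 1 \<psi> \<xi>)"
    by (simp add: ft_frechet[OF test_function_smooth[OF t] i(1) di(1)] inner_axis_1 mult_ac)
  also have "(LINT \<xi>|lborel. ?m \<xi> * ft 1 \<psi> \<xi>) = pair (abs_l2 ?m) (abs_l2 (ft 1 \<psi>))"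
    by (rule pair_abs[symmetric]) (intro assms ft_contraction i s)+
  also have "\<dots> = pair (inverse_fourier (abs_l2 ?m)) (abs_l2 \<psi>)"
    by (simp add: pair_fourier_sign fourier_sign_abs i inverse_fourier_def)
  finally show "pair f (abs_l2 ?d) = - pair (inverse_fourier (abs_l2 ?m)) (abs_l2 \<psi>)"
    by (simp add: inv)
qed

section \<open>The Schroedinger group and multipliers on the Sobolev space\<close>

lemma sign_sq: "(1::real)\<^sup>2 = 1" "(- 1::real)\<^sup>2 = 1"
  by simp_all

lemma fourier_inverse_fourier [simp]: "fourier (inverse_fourier f) = f"
  using fourier_sign_inverse[OF sign_sq(1)] by (simp add: fourier_def inverse_fourier_def)

lemma inverse_fourier_fourier [simp]: "inverse_fourier (fourier f) = f"
  using fourier_sign_inverse[OF sign_sq(2)] by (simp add: fourier_def inverse_fourier_def)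

lemma bounded_linear_fourier: "bounded_linear fourier" "bounded_linear inverse_fourier"
  unfolding fourier_def inverse_fourier_def by (rule bounded_linear_fourier_sign; simp)+

lemma norm_fourier [simp]: "norm (fourier f) = norm f" "norm (inverse_fourier f) = norm f"
  unfolding fourier_def inverse_fourier_def by (rule norm_fourier_sign; simp)+

abbreviation flow_multiplier :: "real \<Rightarrow> real^3 \<Rightarrow> complex" where
  "flow_multiplier t \<equiv> (\<lambda>\<xi>. cis (- t * (norm \<xi>)\<^sup>2))"

definition free_flow :: "real \<Rightarrow> l2 \<Rightarrow> l2" where
  "free_flow t f = inverse_fourier (l2_mult (flow_multiplier t) (fourier f))"

lemma bdd_fun_flow_multiplier: "bdd_fun (flow_multiplier t)"
  by (rule bdd_fun_cis) simp

lemma bounded_linear_free_flow: "bounded_linear (free_flow t)"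
  unfolding free_flow_def [abs_def]
  by (intro bounded_linear_compose[OF bounded_linear_fourier(2)] bounded_linear_compose[OF bounded_linear_l2_mult[OF bdd_fun_flow_multiplier]]
      bounded_linear_fourier(1))

lemma norm_free_flow [simp]: "norm (free_flow t f) = norm f"
proof -
  have "norm (l2_mult (flow_multiplier t) (fourier f)) = norm (fourier f)"
    by (rule norm_l2_mult_cis) simp
  thus ?thesis by (simp add: free_flow_def)
qed

lemma free_flow_free_flow [simp]: "free_flow s (free_flow t f) = free_flow (s + t) f"
  unfolding free_flow_def fourier_inverse_fourier
    l2_mult_mult[OF bdd_fun_flow_multiplier bdd_fun_flow_multiplier] cis_mult
  by (simp add: algebra_simps)

lemma free_flow_0 [simp]: "free_flow 0 f = f"
  by (simp add: free_flow_def l2_mult_1)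

lemma free_flow_cmult: "free_flow t (l2_mult (\<lambda>_. c) f) = l2_mult (\<lambda>_. c) (free_flow t f)"
  unfolding free_flow_def fourier_def inverse_fourier_def fourier_sign_cmult[OF sign_sq(2)]
    fourier_sign_cmult[OF sign_sq(1), symmetric] l2_mult_mult[OF bdd_fun_const bdd_fun_flow_multiplier]
    l2_mult_mult[OF bdd_fun_flow_multiplier bdd_fun_const] by (simp add: mult.commute)

text \<open>Isometries are equicontinuous, so strong continuity in time upgrades to joint continuity
  in time and vector.\<close>

lemma isometries_tendsto:
  fixes S :: "real \<Rightarrow> 'a::real_normed_vector \<Rightarrow> 'a"
  assumes lin: "\<And>t. bounded_linear (S t)" and iso: "\<And>t f. norm (S t f) = norm f"
    and t: "(\<lambda>n. S (t n) f\<^sub>0) \<longlonglongrightarrow> S t\<^sub>0 f\<^sub>0" and f: "f \<longlonglongrightarrow> f\<^sub>0"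
  shows "(\<lambda>n. S (t n) (f n)) \<longlonglongrightarrow> S t\<^sub>0 f\<^sub>0"
proof -
  have "(\<lambda>n. norm (S (t n) (f n - f\<^sub>0))) \<longlonglongrightarrow> 0"
    using tendsto_norm_zero[OF LIM_zero[OF f]] by (simp add: iso)
  from tendsto_add[OF tendsto_norm_zero_cancel[OF this] t] show ?thesis
    by (simp add: bounded_linear.linear[OF lin] linear_diff)
qed

lemma free_flow_tendsto:
  assumes "t \<longlonglongrightarrow> t\<^sub>0"
  shows "(\<lambda>n. free_flow (t n) f) \<longlonglongrightarrow> free_flow t\<^sub>0 f"
proof -
  have "(\<lambda>n. abs_l2 (\<lambda>\<xi>. flow_multiplier (t n) \<xi> * rep_l2 (fourier f) \<xi>))
      \<longlonglongrightarrow> abs_l2 (\<lambda>\<xi>. flow_multiplier t\<^sub>0 \<xi> * rep_l2 (fourier f) \<xi>)"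
  proof (rule l2_dominated_convergence(3)[OF square_integrable_rep[of "fourier f"], where C = 1])
    show "AE \<xi> in lborel. (\<lambda>n. flow_multiplier (t n) \<xi> * rep_l2 (fourier f) \<xi>) \<longlonglongrightarrow> flow_multiplier t\<^sub>0 \<xi> * rep_l2 (fourier f) \<xi>"
      unfolding cis_conv_exp by (intro AE_I2 tendsto_intros assms)
  qed (auto simp: norm_mult)
  thus ?thesis
    unfolding free_flow_def l2_mult_def by (rule bounded_linear.tendsto[OF bounded_linear_fourier(2)])
qed

text \<open>On the frequency side the flow and the derivative are both multiplications and commute.
  The product with i \<xi>_j stays square integrable because the flow multiplier is unimodular; this
  makes \<open>schroedinger_group\<close> well defined on \<open>h1\<close>.\<close>

lemma weak_partial_free_flow:
  assumes w: "weak_partial j f g"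
  shows "weak_partial j (free_flow t f) (free_flow t g)"
proof -
  have F: "fourier (free_flow t f) = l2_mult (flow_multiplier t) (fourier f)" by (simp add: free_flow_def)
  have ae: "AE \<xi> in lborel. \<i> * of_real (\<xi> $ j) * rep_l2 (fourier (free_flow t f)) \<xi> = flow_multiplier t \<xi> * rep_l2 (fourier g) \<xi>"
    using rep_l2_mult[OF bdd_fun_flow_multiplier, of t "fourier f"] weak_partial_fourier[OF w]
    unfolding F by eventually_elim simp
  have si: "square_integrable (\<lambda>\<xi>. \<i> * of_real (\<xi> $ j) * rep_l2 (fourier (free_flow t f)) \<xi>)"
  proof (rule square_integrable_bounded_by[OF square_integrable_rep[of "fourier g"]])
    show "AE \<xi> in lborel. cmod (\<i> * of_real (\<xi> $ j) * rep_l2 (fourier (free_flow t f)) \<xi>) \<le> 1 * cmod (rep_l2 (fourier g) \<xi>)"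
      using ae
    proof eventually_elim
      case (elim \<xi>)
      show ?case unfolding elim by (simp add: norm_mult)
    qed
  qed measurable
  have "abs_l2 (\<lambda>\<xi>. \<i> * of_real (\<xi> $ j) * rep_l2 (fourier (free_flow t f)) \<xi>) = l2_mult (flow_multiplier t) (fourier g)"
    unfolding l2_mult_def
    by (rule abs_l2_eqI[OF si square_integrable_bdd_mult[OF bdd_fun_flow_multiplier square_integrable_rep] ae])
  with weak_partial_fourierI[OF si] show ?thesis by (simp add: free_flow_def)
qed

lemma h1_eqI: "l2_of_h1 f = l2_of_h1 g \<Longrightarrow> f = g"
  by (simp add: l2_of_h1_inject)

lemma schroedinger_group_eq: "schroedinger_group t f = h1_of_l2 (free_flow t (l2_of_h1 f))"
  by (simp add: schroedinger_group_def free_flow_def)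

lemma l2_of_h1_schroedinger [simp]: "l2_of_h1 (schroedinger_group t f) = free_flow t (l2_of_h1 f)"
  unfolding schroedinger_group_eq
  by (rule l2_of_h1_of_l2(1)) (rule weak_partial_free_flow[OF weak_partial_partial])

lemma partial_schroedinger [simp]: "partial j (schroedinger_group t f) = free_flow t (partial j f)"
  unfolding schroedinger_group_eq
  by (rule l2_of_h1_of_l2(2)) (rule weak_partial_free_flow[OF weak_partial_partial])

lemma norm_schroedinger [simp]: "norm (schroedinger_group t f) = norm f"
  by (rule power2_eq_imp_eq) (simp_all add: norm_h1_sq)

lemma bounded_linear_schroedinger: "bounded_linear (schroedinger_group t)"
proof -
  interpret a: bounded_linear "free_flow t" by (rule bounded_linear_free_flow)
  show ?thesis
    by (rule bounded_linear_intro[of _ 1])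
      (auto intro!: h1_eqI simp: plus_h1.rep_eq scaleR_h1.rep_eq a.add a.scaleR)
qed

lemma schroedinger_schroedinger [simp]: "schroedinger_group s (schroedinger_group t f) = schroedinger_group (s + t) f"
  by (rule h1_eqI) simp

lemma schroedinger_tendsto:
  assumes "t \<longlonglongrightarrow> t\<^sub>0" "f \<longlonglongrightarrow> f\<^sub>0"
  shows "(\<lambda>n. schroedinger_group (t n) (f n)) \<longlonglongrightarrow> schroedinger_group t\<^sub>0 f\<^sub>0"
  by (rule isometries_tendsto[OF bounded_linear_schroedinger norm_schroedinger _ assms(2)], rule tendsto_h1I)
    (simp_all add: free_flow_tendsto assms)

lemma continuous_on_schroedinger:
  fixes t :: "'a::metric_space \<Rightarrow> real"
  assumes "continuous_on S t" "continuous_on S f"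
  shows "continuous_on S (\<lambda>x. schroedinger_group (t x) (f x))"
  using assms unfolding continuous_on_sequentially
  by (auto simp: o_def intro!: schroedinger_tendsto)

section \<open>Multiplication operators on H^1\<close>

definition smooth_multiplier :: "(real^3 \<Rightarrow> complex) \<Rightarrow> bool" where
  "smooth_multiplier m \<longleftrightarrow> smooth m \<and> bdd_fun m \<and> (\<forall>j. bdd_fun (\<lambda>x. frechet_derivative m (at x) (axis j 1)))"

text \<open>The product rule is applied to the test function: \<psi> times \<open>m\<close> is again
  a test function because \<psi> has compact support, and the term with the derivative of
  \<open>m\<close> is moved to the other side.\<close>

lemma weak_partial_l2_mult:
  assumes m: "smooth_multiplier m" and w: "weak_partial j f g"
  shows "weak_partial j (l2_mult m f) (l2_mult m g + l2_mult (\<lambda>x. frechet_derivative m (at x) (axis j 1)) f)"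
  unfolding weak_partial_iff_pair
proof (intro allI impI)
  fix \<psi> :: "real^3 \<Rightarrow> complex" assume t: "test_function \<psi>"
  let ?d = "\<lambda>\<psi> x. frechet_derivative \<psi> (at x) (axis j 1)"
  have m': "smooth m" "bdd_fun m" "bdd_fun (?d m)" using m by (auto simp: smooth_multiplier_def)
  note si = test_function_derivative[OF t]
  have tm: "test_function (\<lambda>x. \<psi> x * m x)" by (rule test_function_mult[OF t m'(1)])
  have "pair (l2_mult m f) (abs_l2 (?d \<psi>)) = pair f (abs_l2 (\<lambda>x. m x * ?d \<psi> x))"
    by (simp add: pair_l2_mult m' l2_mult_bdd_abs si)
  also have "(\<lambda>x. m x * ?d \<psi> x) = (\<lambda>x. ?d (\<lambda>x. \<psi> x * m x) x - ?d m x * \<psi> x)"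
    by (subst frechet_derivative_times[OF smooth_C_k[OF test_function_smooth[OF t]] smooth_C_k[OF m'(1)]])
      (simp add: mult.commute)
  also have "abs_l2 \<dots> = abs_l2 (?d (\<lambda>x. \<psi> x * m x)) - abs_l2 (\<lambda>x. ?d m x * \<psi> x)"
    by (rule abs_l2_diff[symmetric, OF test_function_derivative(2)[OF tm] square_integrable_bdd_mult[OF m'(3) si(1)]])
  also have "pair f \<dots> = pair f (abs_l2 (?d (\<lambda>x. \<psi> x * m x))) - pair f (abs_l2 (\<lambda>x. ?d m x * \<psi> x))"
    by (rule bounded_bilinear.diff_right[OF bounded_bilinear_pair])
  also have "pair f (abs_l2 (?d (\<lambda>x. \<psi> x * m x))) = - pair g (abs_l2 (\<lambda>x. m x * \<psi> x))"
    using w tm by (simp add: weak_partial_iff_pair mult.commute)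
  also have "abs_l2 (\<lambda>x. m x * \<psi> x) = l2_mult m (abs_l2 \<psi>)"
    by (simp add: l2_mult_bdd_abs m' si)
  also have "abs_l2 (\<lambda>x. ?d m x * \<psi> x) = l2_mult (?d m) (abs_l2 \<psi>)"
    by (simp add: l2_mult_bdd_abs m' si)
  finally show "pair (l2_mult m f) (abs_l2 (?d \<psi>)) = - pair (l2_mult m g + l2_mult (?d m) f) (abs_l2 \<psi>)"
    by (simp add: pair_l2_mult m' bounded_bilinear.add_left[OF bounded_bilinear_pair])
qed

lemma l2_of_h1_mult: "smooth_multiplier m \<Longrightarrow> l2_of_h1 (h1_mult m f) = l2_mult m (l2_of_h1 f)"
  unfolding h1_mult_def by (rule l2_of_h1_of_l2(1)) (rule weak_partial_l2_mult[OF _ weak_partial_partial])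

lemma partial_h1_mult:
  "smooth_multiplier m \<Longrightarrow> partial j (h1_mult m f)
    = l2_mult m (partial j f) + l2_mult (\<lambda>x. frechet_derivative m (at x) (axis j 1)) (l2_of_h1 f)"
  unfolding h1_mult_def by (rule l2_of_h1_of_l2(2)) (rule weak_partial_l2_mult[OF _ weak_partial_partial])

lemma smooth_multiplier_bdd: "smooth_multiplier m \<Longrightarrow> bdd_fun m"
  by (simp add: smooth_multiplier_def)

lemma bounded_linear_h1_mult:
  assumes m: "smooth_multiplier m"
  shows "bounded_linear (h1_mult m)"
proof -
  let ?d = "\<lambda>j x. frechet_derivative m (at x) (axis j 1)"
  interpret a: bounded_linear "l2_mult m" by (rule bounded_linear_l2_mult[OF smooth_multiplier_bdd[OF m]])
  obtain K where K: "\<And>f. norm (l2_mult m f) \<le> norm f * K" "K > 0" using a.pos_bounded by blast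
  have "\<exists>L>0. \<forall>f. norm (l2_mult (?d j) f) \<le> norm f * L" for j
    using bounded_linear.pos_bounded[OF bounded_linear_l2_mult] m by (auto simp: smooth_multiplier_def)
  then obtain L where L: "\<And>j. L j > 0" "\<And>j f. norm (l2_mult (?d j) f) \<le> norm f * L j" by metis
  show ?thesis
  proof (rule bounded_linear_intro[of _ "K + (\<Sum>j\<in>UNIV. (K + L j))"])
    fix f g :: h1 and r :: real
    show "h1_mult m (f + g) = h1_mult m f + h1_mult m g"
      by (rule h1_eqI) (simp add: l2_of_h1_mult m plus_h1.rep_eq a.add)
    show "h1_mult m (r *\<^sub>R f) = r *\<^sub>R h1_mult m f"
      by (rule h1_eqI) (simp add: l2_of_h1_mult m scaleR_h1.rep_eq a.scaleR)
    have "norm (h1_mult m f) \<le> norm (l2_mult m (l2_of_h1 f))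
        + (\<Sum>j\<in>UNIV. norm (l2_mult m (partial j f) + l2_mult (?d j) (l2_of_h1 f)))"
      using norm_h1_le[of "h1_mult m f"] by (simp add: l2_of_h1_mult partial_h1_mult m)
    also have "\<dots> \<le> norm f * K + (\<Sum>j\<in>UNIV. norm f * K + norm f * L j)"
    proof (intro add_mono sum_mono norm_triangle_le)
      show "norm (l2_mult m (l2_of_h1 f)) \<le> norm f * K"
        using K(1)[of "l2_of_h1 f"] mult_right_mono[OF norm_l2_of_h1_le[of f], of K] K(2) by linarith
      show "norm (l2_mult m (partial j f)) \<le> norm f * K" for j
        using K(1)[of "partial j f"] mult_right_mono[OF norm_partial_le[of j f], of K] K(2) by linarith
      show "norm (l2_mult (?d j) (l2_of_h1 f)) \<le> norm f * L j" for j
        using L(2)[of j "l2_of_h1 f"] mult_right_mono[OF norm_l2_of_h1_le[of f], of "L j"] L(1)[of j] by linarith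
    qed
    also have "\<dots> = norm f * (K + (\<Sum>j\<in>UNIV. (K + L j)))"
      by (simp add: distrib_left sum_distrib_left)
    finally show "norm (h1_mult m f) \<le> norm f * (K + (\<Sum>j\<in>UNIV. (K + L j)))" .
  qed
qed

lemma smooth_const: "smooth (\<lambda>_. c)"
  by (simp add: smooth_def)

lemma smooth_multiplier_const: "smooth_multiplier (\<lambda>_. c)"
  by (simp add: smooth_multiplier_def smooth_const bdd_fun_const frechet_derivative_const)

lemma bdd_fun_add:
  assumes "bdd_fun f" "bdd_fun g"
  shows "bdd_fun (\<lambda>x. f x + g x)"
proof -
  obtain C where C: "\<And>x. cmod (f x) \<le> C" using assms(1) by (auto simp: bdd_fun_def)
  obtain C' where C': "\<And>x. cmod (g x) \<le> C'" using assms(2) by (auto simp: bdd_fun_def)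
  show ?thesis
    by (rule bdd_funI[of _ "C + C'"])
      (use assms C C' in \<open>auto intro: bdd_fun_measurable norm_triangle_le add_mono borel_measurable_add\<close>)
qed

lemma smooth_multiplier_mult:
  assumes "smooth_multiplier m" "smooth_multiplier m'"
  shows "smooth_multiplier (\<lambda>x. m x * m' x)"
proof -
  have s: "smooth m" "smooth m'" using assms by (auto simp: smooth_multiplier_def)
  show ?thesis
    using assms by (auto simp: smooth_multiplier_def smooth_mult frechet_derivative_times[OF smooth_C_k[OF s(1)] smooth_C_k[OF s(2)]]
        intro!: bdd_fun_mult bdd_fun_add)
qed

lemma h1_mult_h1_mult:
  assumes "smooth_multiplier m" "smooth_multiplier m'"
  shows "h1_mult m (h1_mult m' f) = h1_mult (\<lambda>x. m x * m' x) f"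
  by (rule h1_eqI) (simp add: l2_of_h1_mult assms smooth_multiplier_mult l2_mult_mult smooth_multiplier_bdd)

lemma h1_mult_const_schroedinger:
  "h1_mult (\<lambda>_. c) (schroedinger_group t f) = schroedinger_group t (h1_mult (\<lambda>_. c) f)"
  by (rule h1_eqI) (simp add: l2_of_h1_mult smooth_multiplier_const free_flow_cmult)

section \<open>The Schroedinger kernel and unique continuation\<close>

definition kernel_factor :: "real \<Rightarrow> complex" where
  "kernel_factor t = of_real (unitary_factor\<^sup>2) * csqrt (of_real pi / (\<i> * of_real t)) ^ 3"

text \<open>The integral form of the free Schroedinger flow. Its kernel has constant modulus, so it
  is usable for integrable \<open>g\<close>.\<close>

definition fresnel :: "real \<Rightarrow> (real^3 \<Rightarrow> complex) \<Rightarrow> real^3 \<Rightarrow> complex" where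
  "fresnel t g x = kernel_factor t * (LINT y|lborel. g y * cis ((norm (y - x))\<^sup>2 / (4 * t)))"

lemma kernel_factor_nonzero: "t \<noteq> 0 \<Longrightarrow> kernel_factor t \<noteq> 0"
  by (simp add: kernel_factor_def)

lemma gauss_kernel_imag: "t \<noteq> 0 \<Longrightarrow> gauss_kernel (\<i> * of_real t) w = kernel_factor t * cis ((norm w)\<^sup>2 / (4 * t))"
proof -
  assume t: "t \<noteq> 0"
  have "- complex_of_real q / (4 * (\<i> * of_real t)) = \<i> * of_real (q / (4 * t))" for q
    using t by (simp add: complex_eq_iff Re_divide Im_divide power2_eq_square)
  thus ?thesis by (simp only: gauss_kernel_def kernel_factor_def cis_conv_exp mult.assoc)
qed

text \<open>Since Re(1/z) is positive, the exponential is at most one. The bound is uniform up to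
  the imaginary axis as long as z keeps away from 0, and so serves as majorant when z tends to
  it.\<close>

lemma norm_gauss_kernel_le:
  assumes "Re z > 0" "cmod z \<ge> a" "a > 0"
  shows "cmod (gauss_kernel z w) \<le> unitary_factor\<^sup>2 * sqrt (pi / a) ^ 3"
proof -
  have "cmod (csqrt (of_real pi / z)) \<le> sqrt (pi / a)"
    using assms by (auto simp: norm_divide intro!: divide_left_mono mult_pos_pos)
  hence "cmod (csqrt (of_real pi / z)) ^ 3 \<le> sqrt (pi / a) ^ 3" by (intro power_mono) auto
  moreover have "cmod (exp (- of_real ((norm w)\<^sup>2) / (4 * z))) \<le> 1"
  proof -
    have "Re (- of_real ((norm w)\<^sup>2) / (4 * z)) = - ((norm w)\<^sup>2 / 4 * (Re z / (cmod z)\<^sup>2))"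
    proof -
      have "Re (- complex_of_real q / (4 * z)) = - (q / 4 * (Re z / (cmod z)\<^sup>2))" for q
      proof -
        have *: "(Re (4 * z))\<^sup>2 + (Im (4 * z))\<^sup>2 = 16 * (cmod z)\<^sup>2"
          by (simp add: cmod_power2 power_mult_distrib)
        show ?thesis unfolding Re_divide * by simp
      qed
      thus ?thesis .
    qed
    also have "\<dots> \<le> 0" using assms by auto
    finally show ?thesis by (simp only: norm_exp_eq_Re exp_le_one_iff)
  qed
  ultimately have "cmod (csqrt (of_real pi / z)) ^ 3 * cmod (exp (- of_real ((norm w)\<^sup>2) / (4 * z))) \<le> sqrt (pi / a) ^ 3 * 1"
    using assms by (intro mult_mono) auto
  thus ?thesis
    unfolding gauss_kernel_def norm_mult norm_power norm_of_real by (simp add: mult_left_mono del: norm_csqrt)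
qed

lemma gauss_kernel_tendsto:
  assumes "z \<longlonglongrightarrow> \<i> * of_real t" "t \<noteq> 0"
  shows "(\<lambda>n. gauss_kernel (z n) w) \<longlonglongrightarrow> gauss_kernel (\<i> * of_real t) w"
proof -
  \<comment> \<open>The limit is purely imaginary and nonzero, so the principal root is continuous
    there.\<close>
  have "complex_of_real pi / (\<i> * of_real t) \<notin> \<real>\<^sub>\<le>\<^sub>0"
    using assms(2) by (auto simp: complex_nonpos_Reals_iff Im_divide)
  from continuous_at_csqrt[OF this]
  have "(\<lambda>n. csqrt (of_real pi / z n)) \<longlonglongrightarrow> csqrt (of_real pi / (\<i> * of_real t))"
    by (rule isCont_tendsto_compose) (intro tendsto_intros assms; simp add: assms)
  thus ?thesis
    unfolding gauss_kernel_def by (intro tendsto_intros assms) (simp_all add: assms)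
qed

lemma measurable_gauss_kernel [measurable]: "gauss_kernel z \<in> borel_measurable borel"
  unfolding gauss_kernel_def [abs_def] by measurable

lemma measurable_fresnel [measurable]:
  assumes [measurable]: "g \<in> borel_measurable borel"
  shows "fresnel t g \<in> borel_measurable borel"
  unfolding fresnel_def [abs_def] by measurable

text \<open>Regularization with z tending to it: the limit in L^2 is the flow, the pointwise limit
  of the kernel integrals is \<open>fresnel\<close>.\<close>

lemma free_flow_fresnel:
  assumes t: "t \<noteq> 0" and int: "integrable lborel g" and si: "square_integrable g"
  shows "square_integrable (fresnel t g)" "free_flow t (abs_l2 g) = abs_l2 (fresnel t g)"
proof -
  have [measurable]: "g \<in> borel_measurable borel" using si by (rule square_integrable_measurable)
  define z where "z n = of_real (inverse (real (Suc n))) + \<i> * complex_of_real t" for n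
  have Re_z: "Re (z n) > 0" for n by (simp add: z_def)
  have "z \<longlonglongrightarrow> of_real 0 + \<i> * complex_of_real t"
    unfolding z_def by (intro tendsto_intros LIMSEQ_inverse_real_of_nat)
  hence z: "z \<longlonglongrightarrow> \<i> * of_real t" by simp
  have zt: "cmod (z n) \<ge> \<bar>t\<bar>" for n
    using abs_Im_le_cmod[of "z n"] by (simp add: z_def)
  note reg = gauss_regularization[OF int si sign_sq(2) Re_z z]
  have eq: "fourier_sign (- (- 1)) (l2_mult (\<lambda>\<xi>. exp (- (\<i> * of_real t) * of_real ((norm \<xi>)\<^sup>2))) (fourier_sign (- 1) (abs_l2 g)))
      = free_flow t (abs_l2 g)"
    by (simp add: free_flow_def fourier_def inverse_fourier_def cis_conv_exp mult.assoc)
  let ?C = "unitary_factor\<^sup>2 * sqrt (pi / \<bar>t\<bar>) ^ 3"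
  have pt: "(\<lambda>n. LINT y|lborel. g y * gauss_kernel (z n) (y - x)) \<longlonglongrightarrow> fresnel t g x" for x
  proof -
    have "(\<lambda>n. LINT y|lborel. g y * gauss_kernel (z n) (y - x)) \<longlonglongrightarrow> (LINT y|lborel. g y * gauss_kernel (\<i> * of_real t) (y - x))"
    proof (rule integral_dominated_convergence[where w = "\<lambda>y. ?C * cmod (g y)"])
      show "integrable lborel (\<lambda>y. ?C * cmod (g y))" using int by (intro integrable_mult_right integrable_norm)
      show "AE y in lborel. (\<lambda>n. g y * gauss_kernel (z n) (y - x)) \<longlonglongrightarrow> g y * gauss_kernel (\<i> * of_real t) (y - x)"
        by (intro AE_I2 tendsto_intros gauss_kernel_tendsto z t)
      show "AE y in lborel. cmod (g y * gauss_kernel (z n) (y - x)) \<le> ?C * cmod (g y)" for n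
      proof (rule AE_I2)
        fix y
        have "cmod (gauss_kernel (z n) (y - x)) \<le> ?C"
          using t by (intro norm_gauss_kernel_le Re_z zt) simp
        from mult_right_mono[OF this norm_ge_zero[of "g y"]]
        show "cmod (g y * gauss_kernel (z n) (y - x)) \<le> ?C * cmod (g y)" by (simp only: norm_mult mult.commute)
      qed
    qed measurable
    also have "(LINT y|lborel. g y * gauss_kernel (\<i> * of_real t) (y - x))
        = (LINT y|lborel. kernel_factor t * (g y * cis ((norm (y - x))\<^sup>2 / (4 * t))))"
      by (simp only: gauss_kernel_imag[OF t] mult.left_commute)
    also have "\<dots> = fresnel t g x" unfolding fresnel_def by (rule integral_mult_right_zero)
    finally show ?thesis .
  qed
  have "(\<lambda>n. abs_l2 (\<lambda>x. LINT y|lborel. g y * gauss_kernel (z n) (y - x))) \<longlonglongrightarrow> free_flow t (abs_l2 g)"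
    using reg(2) unfolding eq by simp
  from l2_tendsto_AE_unique[OF this, of "fresnel t g"]
  show "square_integrable (fresnel t g)" "free_flow t (abs_l2 g) = abs_l2 (fresnel t g)"
    using reg(1) pt by auto
qed

text \<open>The Fourier transform of a compactly supported function is entire along every line, so it cannot
  vanish near infinity.\<close>
lemma ft_bounded_support_unique:
  assumes int: "integrable lborel h" and si: "square_integrable h"
    and supp: "\<And>y. norm y > r \<Longrightarrow> h y = 0" and zero: "\<And>\<xi>. norm \<xi> > \<rho> \<Longrightarrow> ft (- 1) h \<xi> = 0"
  shows "abs_l2 h = 0"
proof -
  have [measurable]: "h \<in> borel_measurable borel" using si by (rule square_integrable_measurable)
  define v where "v = (axis 1 1 :: real^3)"
  have nv: "norm v = 1" by (simp add: v_def)
  have "ft (- 1) h \<xi> = 0" for \<xi>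
  proof -
    \<comment> \<open>Up to the normalizing constant, \<open>G z\<close> is the transform at \<xi> +
      z v with complex \<open>z\<close>; bounded support keeps the growing exponential bounded on
      each ball.\<close>
    define F where "F z y = h y * exp (- \<i> * (of_real (y \<bullet> \<xi>) + z * of_real (y \<bullet> v)))" for z y
    define G where "G z = (LINT y|lborel. F z y)" for z
    have hol: "G holomorphic_on ball 0 s" for s
      unfolding G_def
    proof (rule holomorphic_on_lebesgue_integral)
      show "integrable lborel (\<lambda>y. cmod (h y) * exp (s * \<bar>r\<bar>))"
        using int by (intro integrable_mult_left integrable_norm)
      show "cmod (F z y) \<le> cmod (h y) * exp (s * \<bar>r\<bar>)" if "z \<in> ball 0 s" for z y
      proof (cases "norm y > r")
        case False
        have "Re (- \<i> * (of_real (y \<bullet> \<xi>) + z * of_real (y \<bullet> v))) = Im z * (y \<bullet> v)" by simp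
        also have "\<dots> \<le> \<bar>Im z\<bar> * \<bar>y \<bullet> v\<bar>" by (simp flip: abs_mult)
        also have "\<dots> \<le> s * \<bar>r\<bar>"
        proof (rule mult_mono)
          show "\<bar>Im z\<bar> \<le> s" using that abs_Im_le_cmod[of z] by simp
          show "\<bar>y \<bullet> v\<bar> \<le> \<bar>r\<bar>" using Cauchy_Schwarz_ineq2[of y v] False nv by simp
          show "0 \<le> s" using that norm_ge_zero[of z] by (simp del: norm_ge_zero)
        qed simp
        finally show ?thesis unfolding F_def norm_mult norm_exp_eq_Re by (intro mult_left_mono) simp_all
      qed (simp add: F_def supp)
    qed (auto simp: F_def intro!: holomorphic_intros)
    have real: "of_real unitary_factor * G (of_real x) = ft (- 1) h (\<xi> + x *\<^sub>R v)" for x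
      by (simp add: G_def F_def ft_def cis_conv_exp inner_add_right algebra_simps)
    \<comment> \<open>Beyond this value the point \<xi> + x v has norm greater than \<rho>, so the
      transform is known to vanish there.\<close>
    define x\<^sub>0 where "x\<^sub>0 = \<bar>\<rho>\<bar> + norm \<xi> + 1"
    have G0: "G z = 0" if z: "z \<in> of_real ` {x\<^sub>0..}" for z
    proof -
      obtain x where x: "z = of_real x" "x \<ge> x\<^sub>0" using z by auto
      have "norm (x *\<^sub>R v) \<le> norm (\<xi> + x *\<^sub>R v) + norm \<xi>" using norm_triangle_ineq4[of "\<xi> + x *\<^sub>R v" \<xi>] by simp
      hence "norm (\<xi> + x *\<^sub>R v) > \<rho>" using x nv by (simp add: x\<^sub>0_def)
      from zero[OF this] real[of x] show ?thesis by (simp add: x)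
    qed
    have "G 0 = 0"
    \<comment> \<open>The ball is large enough to contain both the origin and an interval of known
      zeros.\<close>
    proof (rule analytic_continuation[OF hol[of "x\<^sub>0 + 3"]])
      show "open (ball (0::complex) (x\<^sub>0 + 3))" "connected (ball (0::complex) (x\<^sub>0 + 3))" by simp_all
      have x0: "x\<^sub>0 > 0" unfolding x\<^sub>0_def using norm_ge_zero[of \<xi>] by linarith
      show "complex_of_real ` {x\<^sub>0<..<x\<^sub>0 + 3} \<subseteq> ball 0 (x\<^sub>0 + 3)" using x0 by auto
      show "complex_of_real (x\<^sub>0 + 1) \<in> ball 0 (x\<^sub>0 + 3)" using x0 by (simp del: of_real_add)
      show "(0::complex) \<in> ball 0 (x\<^sub>0 + 3)" using x0 by simp
      show "G z = 0" if "z \<in> complex_of_real ` {x\<^sub>0<..<x\<^sub>0 + 3}" for z using G0 that by auto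
      show "complex_of_real (x\<^sub>0 + 1) islimpt complex_of_real ` {x\<^sub>0<..<x\<^sub>0 + 3}"
        by (rule islimpt_of_real_interval) simp_all
    qed
    with real[of 0] show ?thesis by simp
  qed
  hence "ft (- 1) h = (\<lambda>_. 0)" by (intro ext)
  hence "norm (abs_l2 h) = norm (abs_l2 (\<lambda>_. 0))"
    using norm_fourier_sign[OF sign_sq(2), of "abs_l2 h"] by (simp add: fourier_sign_abs[OF int si])
  thus ?thesis by (simp add: zero_l2_def[symmetric])
qed

lemma continuous_ft:
  assumes int: "integrable lborel h"
  shows "continuous_on UNIV (ft s h)"
proof (intro continuous_at_imp_continuous_on ballI)
  fix \<xi> :: "real^3"
  have [measurable]: "h \<in> borel_measurable borel" using borel_measurable_integrable[OF int] by simp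
  show "isCont (ft s h) \<xi>"
    unfolding continuous_at_sequentially
  proof (intro allI impI)
    fix X assume X: "X \<longlonglongrightarrow> \<xi>"
    show "(ft s h \<circ> X) \<longlonglongrightarrow> ft s h \<xi>"
      unfolding ft_def o_def
    proof (intro tendsto_mult tendsto_const integral_dominated_convergence[where w = "\<lambda>y. cmod (h y)"])
      show "AE x in lborel. (\<lambda>n. h x * cis (s * (x \<bullet> X n))) \<longlonglongrightarrow> h x * cis (s * (x \<bullet> \<xi>))"
        unfolding cis_conv_exp by (intro AE_I2 tendsto_intros X)
    qed (use int in \<open>auto simp: norm_mult\<close>)
  qed
qed

text \<open>A continuous function that is nonzero at a point of \<open>U\<close> is nonzero on an
  open neighbourhood, which is not a null set.\<close>

lemma AE_zero_open_imp_zero: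
  fixes F :: "real^3 \<Rightarrow> complex"
  assumes cont: "continuous_on UNIV F" and ae: "AE x in lborel. x \<in> U \<longrightarrow> F x = 0" and U: "open U" "x \<in> U"
  shows "F x = 0"
proof (rule ccontr)
  assume nz: "F x \<noteq> 0"
  define S where "S = U \<inter> F -` (- {0})"
  have "open S" unfolding S_def using cont U(1) by (intro open_Int open_vimage) auto
  moreover have "x \<in> S" using nz U by (simp add: S_def)
  ultimately have "\<not> negligible S" using open_not_negligible by blast
  moreover have "S \<in> null_sets lborel"
  proof -
    have "S \<in> sets lborel" using \<open>open S\<close> by simp
    moreover have "AE x in lborel. x \<notin> S" using ae by eventually_elim (auto simp: S_def)
    ultimately show ?thesis by (simp add: AE_iff_null_sets)
  qed
  ultimately show False
    by (simp add: negligible_iff_null_sets null_sets_completionI)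
qed

text \<open>Expanding |y - x|^2 splits the phase into a part in x, a part in y and the exponent of a
  Fourier transform evaluated at x / (2t).\<close>

lemma fresnel_eq_ft:
  assumes t: "t \<noteq> 0"
  shows "fresnel t g x = kernel_factor t * of_real (1 / unitary_factor) * cis ((norm x)\<^sup>2 / (4 * t))
      * ft (- 1) (\<lambda>y. g y * cis ((norm y)\<^sup>2 / (4 * t))) ((1 / (2 * t)) *\<^sub>R x)"
proof -
  have "cis ((norm (y - x))\<^sup>2 / (4 * t)) = cis ((norm x)\<^sup>2 / (4 * t)) * (cis ((norm y)\<^sup>2 / (4 * t)) * cis (- 1 * (y \<bullet> ((1 / (2 * t)) *\<^sub>R x))))" for y
  proof -
    have "(norm (y - x))\<^sup>2 = (norm x)\<^sup>2 + ((norm y)\<^sup>2 - 2 * (y \<bullet> x))"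
      by (simp add: power2_norm_eq_inner inner_diff inner_commute)
    hence "(norm (y - x))\<^sup>2 / (4 * t) = (norm x)\<^sup>2 / (4 * t) + ((norm y)\<^sup>2 / (4 * t) + (- 1 * (y \<bullet> ((1 / (2 * t)) *\<^sub>R x))))"
      using t by (simp add: field_simps)
    thus ?thesis by (simp only: cis_mult)
  qed
  hence "(LINT y|lborel. g y * cis ((norm (y - x))\<^sup>2 / (4 * t)))
      = (LINT y|lborel. cis ((norm x)\<^sup>2 / (4 * t)) * (g y * cis ((norm y)\<^sup>2 / (4 * t)) * cis (- 1 * (y \<bullet> ((1 / (2 * t)) *\<^sub>R x)))))"
    by (simp only: mult_ac)
  also have "\<dots> = cis ((norm x)\<^sup>2 / (4 * t)) * (LINT y|lborel. g y * cis ((norm y)\<^sup>2 / (4 * t)) * cis (- 1 * (y \<bullet> ((1 / (2 * t)) *\<^sub>R x))))"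
    by (rule integral_mult_right_zero)
  finally have *: "(LINT y|lborel. g y * cis ((norm (y - x))\<^sup>2 / (4 * t)))
      = cis ((norm x)\<^sup>2 / (4 * t)) * (LINT y|lborel. g y * cis ((norm y)\<^sup>2 / (4 * t)) * cis (- 1 * (y \<bullet> ((1 / (2 * t)) *\<^sub>R x))))" .
  have "complex_of_real (1 / unitary_factor) * of_real unitary_factor = 1"
    unfolding of_real_mult[symmetric] by simp
  thus ?thesis unfolding fresnel_def * ft_def by (simp add: mult_ac)
qed

text \<open>Multiplying \<open>g\<close> by the unimodular phase in y changes neither its support
  nor its norm and reduces the claim to a Fourier transform vanishing near infinity. Continuity of
  that transform removes the exceptional null set.\<close>

lemma fresnel_unique_continuation:
  assumes t: "t \<noteq> 0" and int: "integrable lborel g" and si: "square_integrable g"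
    and supp: "\<And>y. norm y > r \<Longrightarrow> g y = 0" and ae: "AE x in lborel. norm x > r \<longrightarrow> fresnel t g x = 0"
  shows "abs_l2 g = 0"
proof -
  have [measurable]: "g \<in> borel_measurable borel" using si by (rule square_integrable_measurable)
  define c where "c y = cis ((norm y)\<^sup>2 / (4 * t))" for y :: "real^3"
  have c: "bdd_fun c" unfolding c_def [abs_def] by (rule bdd_fun_cis) simp
  have int': "integrable lborel (\<lambda>y. g y * c y)"
    by (rule Bochner_Integration.integrable_bound[OF int]) (auto simp: norm_mult c_def)
  have si': "square_integrable (\<lambda>y. g y * c y)"
    using square_integrable_bdd_mult[OF c si] by (simp add: mult.commute)
  define H where "H x = ft (- 1) (\<lambda>y. g y * c y) ((1 / (2 * t)) *\<^sub>R x)" for x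
  have H: "fresnel t g x = kernel_factor t * of_real (1 / unitary_factor) * c x * H x" for x
    unfolding H_def c_def by (rule fresnel_eq_ft[OF t])
  have "continuous_on UNIV H"
    unfolding H_def [abs_def]
    by (rule continuous_on_compose2[OF continuous_ft[OF int']]) (auto intro!: continuous_intros)
  moreover have "AE x in lborel. x \<in> {x. norm x > r} \<longrightarrow> H x = 0"
    using ae by eventually_elim (auto simp: H kernel_factor_nonzero[OF t] c_def)
  moreover have "open {x::real^3. norm x > r}" by (intro open_Collect_less continuous_intros)
  ultimately have H0: "H x = 0" if "norm x > r" for x using AE_zero_open_imp_zero[of H "{x. norm x > r}" x] that by simp
  have "abs_l2 (\<lambda>y. g y * c y) = 0"
  \<comment> \<open>The second radius accounts for the dilation by 1 / (2t) in the argument of the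
    transform.\<close>
  proof (rule ft_bounded_support_unique[OF int' si', of r "r / \<bar>2 * t\<bar>"])
    show "g y * c y = 0" if "norm y > r" for y using supp[OF that] by simp
    show "ft (- 1) (\<lambda>y. g y * c y) \<xi> = 0" if "norm \<xi> > r / \<bar>2 * t\<bar>" for \<xi>
      using H0[of "(2 * t) *\<^sub>R \<xi>"] that t by (simp add: H_def pos_divide_less_eq mult_ac)
  qed
  moreover have "norm (abs_l2 (\<lambda>y. g y * c y)) = norm (abs_l2 g)"
  proof -
    have "l2_mult c (abs_l2 g) = abs_l2 (\<lambda>y. g y * c y)"
      using l2_mult_bdd_abs[OF c si] by (simp add: mult.commute)
    moreover have "norm (l2_mult c (abs_l2 g)) = norm (abs_l2 g)"
      unfolding c_def [abs_def] by (rule norm_l2_mult_cis) simp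
    ultimately show ?thesis by simp
  qed
  ultimately show ?thesis by simp
qed

section \<open>Two-time observability\<close>

definition ball_proj :: "real \<Rightarrow> l2 \<Rightarrow> l2" where
  "ball_proj r = l2_mult (indicator (cball 0 r))"

lemma bdd_fun_indicator_cball: "bdd_fun (indicator (cball 0 r))"
  by (rule bdd_funI[of _ 1], rule borel_measurable_indicator, simp, simp add: indicator_def)

lemma bounded_linear_ball_proj: "bounded_linear (ball_proj r)"
  unfolding ball_proj_def by (rule bounded_linear_l2_mult[OF bdd_fun_indicator_cball])

lemma ball_proj_pythagoras: "(norm w)\<^sup>2 = (norm (ball_proj r w))\<^sup>2 + (norm (w - ball_proj r w))\<^sup>2"
proof -
  let ?f = "rep_l2 w" and ?g = "\<lambda>x. indicator (cball 0 r) x * rep_l2 w x"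
  have si: "square_integrable ?f" "square_integrable ?g"
    by (rule square_integrable_rep, rule square_integrable_bdd_mult[OF bdd_fun_indicator_cball square_integrable_rep])
  have P: "ball_proj r w = abs_l2 ?g" by (simp add: ball_proj_def l2_mult_def)
  have D: "w - ball_proj r w = abs_l2 (\<lambda>x. ?f x - ?g x)"
    using abs_l2_diff[OF si] by (simp add: P abs_rep_l2)
  have "(norm w)\<^sup>2 = (LINT x|lborel. (cmod (?g x))\<^sup>2 + (cmod (?f x - ?g x))\<^sup>2)"
    unfolding norm_l2_sq by (intro Bochner_Integration.integral_cong) (auto simp: indicator_def)
  also have "\<dots> = (LINT x|lborel. (cmod (?g x))\<^sup>2) + (LINT x|lborel. (cmod (?f x - ?g x))\<^sup>2)"
    using si square_integrable_diff[OF si] by (intro Bochner_Integration.integral_add) (auto simp: square_integrable_def)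
  also have "\<dots> = (norm (ball_proj r w))\<^sup>2 + (norm (w - ball_proj r w))\<^sup>2"
    using si square_integrable_diff[OF si] unfolding D unfolding P by (simp add: norm_abs_l2_sq)
  finally show ?thesis .
qed

lemma norm_ball_proj_le: "norm (ball_proj r w) \<le> norm w"
  by (rule power2_le_imp_le) (use ball_proj_pythagoras[of w r] in auto)

text \<open>By Pythagoras the part outside the ball has squared norm 1 - |P v|^2.\<close>

lemma ball_proj_asymptotic:
  assumes "\<And>n. norm (v n) = 1" "(\<lambda>n. norm (ball_proj r (v n))) \<longlonglongrightarrow> 1"
  shows "(\<lambda>n. v n - ball_proj r (v n)) \<longlonglongrightarrow> 0"
proof (rule tendsto_norm_zero_cancel)
  have "(\<lambda>n. sqrt (1 - (norm (ball_proj r (v n)))\<^sup>2)) \<longlonglongrightarrow> sqrt (1 - 1\<^sup>2)"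
    by (intro tendsto_intros assms)
  moreover have "sqrt (1 - (norm (ball_proj r (v n)))\<^sup>2) = norm (v n - ball_proj r (v n))" for n
    using ball_proj_pythagoras[of "v n" r] by (simp add: assms real_sqrt_unique)
  ultimately show "(\<lambda>n. norm (v n - ball_proj r (v n))) \<longlonglongrightarrow> 0" by simp
qed

lemma norm_cis_diff_le: "cmod (cis a - cis b) \<le> \<bar>a - b\<bar>"
proof -
  have "cis a - cis b = cis b * (cis (a - b) - 1)" by (simp add: right_diff_distrib cis_mult)
  hence "cmod (cis a - cis b) = cmod (cis (a - b) - 1)" by (simp add: norm_mult)
  also have "\<dots> \<le> \<bar>a - b\<bar>" using iexp_approx1[of "a - b" 0] by (simp add: cis_conv_exp)
  finally show ?thesis .
qed

text \<open>Cauchy-Schwarz against the indicator of the ball, whose norm is the constant. It bounds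
  the kernel integrals uniformly over the unit ball of L^2.\<close>

lemma integral_ball_le:
  obtains M where "M \<ge> 0" "\<And>w. (LINT x|lborel. cmod (indicator (cball 0 r) x * rep_l2 w x)) \<le> M * norm w"
proof -
  have si: "square_integrable (indicator (cball 0 r))" by (rule square_integrable_indicator) auto
  have "(LINT x|lborel. cmod (indicator (cball 0 r) x * rep_l2 w x)) \<le> norm (abs_l2 (indicator (cball 0 r))) * norm w" for w
  proof -
    have sn: "square_integrable (\<lambda>x. complex_of_real (cmod (rep_l2 w x)))"
      by (rule square_integrable_norm[OF square_integrable_rep])
    have "complex_of_real (LINT x|lborel. cmod (indicator (cball 0 r) x * rep_l2 w x))
        = (LINT x|lborel. complex_of_real (cmod (indicator (cball 0 r) x * rep_l2 w x)))"
      by (rule integral_complex_of_real[symmetric])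
    also have "\<dots> = pair (abs_l2 (indicator (cball 0 r))) (abs_l2 (\<lambda>x. complex_of_real (cmod (rep_l2 w x))))"
      unfolding pair_abs[OF si sn]
      by (intro Bochner_Integration.integral_cong) (auto simp: indicator_def)
    finally have "(LINT x|lborel. cmod (indicator (cball 0 r) x * rep_l2 w x))
        = cmod (pair (abs_l2 (indicator (cball 0 r))) (abs_l2 (\<lambda>x. complex_of_real (cmod (rep_l2 w x)))))"
      by (metis (no_types, lifting) norm_of_real abs_of_nonneg Bochner_Integration.integral_nonneg norm_ge_zero)
    also have "\<dots> \<le> norm (abs_l2 (indicator (cball 0 r))) * norm (abs_l2 (\<lambda>x. complex_of_real (cmod (rep_l2 w x))))"
      by (rule norm_pair_le)
    also have "norm (abs_l2 (\<lambda>x. complex_of_real (cmod (rep_l2 w x)))) \<le> 1 * norm (abs_l2 (rep_l2 w))"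
      by (rule norm_abs_l2_mono[OF sn square_integrable_rep]) auto
    finally show ?thesis by (simp add: abs_rep_l2 mult_left_mono)
  qed
  thus ?thesis by (intro that[of "norm (abs_l2 (indicator (cball 0 r)))"]) auto
qed

text \<open>For points in the ball, |y - x|^2 and |y - x'|^2 differ by at most 4 r |x - x'|;
  dividing by 4 |t| gives the Lipschitz constant of the phase. This is the equicontinuity behind
  compactness.\<close>

lemma fresnel_diff_le:
  assumes t: "t \<noteq> 0" and int: "integrable lborel g" and supp: "\<And>y. norm y > r \<Longrightarrow> g y = 0"
    and x: "norm x \<le> r" "norm x' \<le> r"
  shows "cmod (fresnel t g x - fresnel t g x') \<le> cmod (kernel_factor t) * (r / \<bar>t\<bar>) * norm (x - x') * (LINT y|lborel. cmod (g y))"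
proof -
  have [measurable]: "g \<in> borel_measurable borel" using borel_measurable_integrable[OF int] by simp
  have ic: "integrable lborel (\<lambda>y. g y * cis ((norm (y - x))\<^sup>2 / (4 * t)))" for x
    by (rule Bochner_Integration.integrable_bound[OF int]) (auto simp: norm_mult)
  have pt: "cmod (g y * cis ((norm (y - x))\<^sup>2 / (4 * t)) - g y * cis ((norm (y - x'))\<^sup>2 / (4 * t)))
      \<le> (r / \<bar>t\<bar>) * norm (x - x') * cmod (g y)" for y
  proof (cases "norm y > r")
    case False
    have "\<bar>(norm (y - x))\<^sup>2 - (norm (y - x'))\<^sup>2\<bar> = \<bar>norm (y - x) - norm (y - x')\<bar> * (norm (y - x) + norm (y - x'))"
    proof -
      have "(norm (y - x))\<^sup>2 - (norm (y - x'))\<^sup>2 = (norm (y - x) - norm (y - x')) * (norm (y - x) + norm (y - x'))"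
        by (simp add: power2_eq_square algebra_simps)
      thus ?thesis by (simp only: abs_mult) simp
    qed
    also have "\<dots> \<le> norm (x - x') * (4 * r)"
    proof (rule mult_mono)
      show "\<bar>norm (y - x) - norm (y - x')\<bar> \<le> norm (x - x')"
        using norm_triangle_ineq3[of "y - x" "y - x'"] by (simp add: norm_minus_commute)
      show "norm (y - x) + norm (y - x') \<le> 4 * r"
        using norm_triangle_ineq4[of y x] norm_triangle_ineq4[of y x'] x False by linarith
    qed auto
    finally have "\<bar>(norm (y - x))\<^sup>2 - (norm (y - x'))\<^sup>2\<bar> / (4 * \<bar>t\<bar>) \<le> norm (x - x') * (4 * r) / (4 * \<bar>t\<bar>)"
      using t by (intro divide_right_mono) auto
    hence "\<bar>(norm (y - x))\<^sup>2 / (4 * t) - (norm (y - x'))\<^sup>2 / (4 * t)\<bar> \<le> (r / \<bar>t\<bar>) * norm (x - x')"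
      by (simp add: diff_divide_distrib[symmetric] abs_mult mult.commute)
    hence "cmod (cis ((norm (y - x))\<^sup>2 / (4 * t)) - cis ((norm (y - x'))\<^sup>2 / (4 * t))) \<le> (r / \<bar>t\<bar>) * norm (x - x')"
      using norm_cis_diff_le order_trans by blast
    from mult_left_mono[OF this norm_ge_zero[of "g y"]] show ?thesis
      by (simp only: right_diff_distrib[symmetric] norm_mult mult.commute)
  qed (simp add: supp)
  have "fresnel t g x - fresnel t g x' = kernel_factor t * (LINT y|lborel. g y * cis ((norm (y - x))\<^sup>2 / (4 * t)) - g y * cis ((norm (y - x'))\<^sup>2 / (4 * t)))"
    by (simp add: fresnel_def Bochner_Integration.integral_diff ic right_diff_distrib)
  also have "cmod \<dots> = cmod (kernel_factor t) * cmod (LINT y|lborel. g y * cis ((norm (y - x))\<^sup>2 / (4 * t)) - g y * cis ((norm (y - x'))\<^sup>2 / (4 * t)))"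
    by (rule norm_mult)
  also have "cmod (LINT y|lborel. g y * cis ((norm (y - x))\<^sup>2 / (4 * t)) - g y * cis ((norm (y - x'))\<^sup>2 / (4 * t)))
      \<le> (LINT y|lborel. (r / \<bar>t\<bar>) * norm (x - x') * cmod (g y))"
    by (rule order_trans[OF integral_norm_bound Bochner_Integration.integral_mono[OF _ _ pt]])
      (intro integrable_norm Bochner_Integration.integrable_diff ic integrable_mult_right int)+
  also have "\<dots> = (r / \<bar>t\<bar>) * norm (x - x') * (LINT y|lborel. cmod (g y))" by (rule integral_mult_right_zero)
  finally show ?thesis by (simp add: mult_left_mono mult.assoc)
qed

lemma norm_fresnel_le: "cmod (fresnel t g x) \<le> cmod (kernel_factor t) * (LINT y|lborel. cmod (g y))"
proof -
  have "cmod (LINT y|lborel. g y * cis ((norm (y - x))\<^sup>2 / (4 * t))) \<le> (LINT y|lborel. cmod (g y * cis ((norm (y - x))\<^sup>2 / (4 * t))))"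
    by (rule integral_norm_bound)
  thus ?thesis by (simp add: fresnel_def norm_mult mult_left_mono)
qed

text \<open>The operator \<open>ball_proj r \<circ> free_flow t \<circ> ball_proj r\<close> has a smooth kernel and is therefore compact.\<close>
lemma ball_proj_flow_compact:
  assumes t: "t \<noteq> 0" and v: "\<And>n::nat. norm (v n) \<le> 1"
  obtains Z k where "strict_mono (k::nat \<Rightarrow> nat)"
    "(\<lambda>n. ball_proj r (free_flow t (ball_proj r (v (k n))))) \<longlonglongrightarrow> Z"
proof -
  let ?B = "cball (0::real^3) r"
  define g where "g n x = indicator ?B x * rep_l2 (v n) x" for n x
  have siB: "square_integrable (indicator ?B)" by (rule square_integrable_indicator) auto
  have si: "square_integrable (g n)" for n
    unfolding g_def [abs_def] by (rule square_integrable_bdd_mult[OF bdd_fun_indicator_cball square_integrable_rep])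
  have supp: "g n x = 0" if "norm x > r" for n x using that by (simp add: g_def)
  have int: "integrable lborel (g n)" for n
    by (rule integrable_bounded_support[OF si, of ?B]) (auto simp: g_def)
  have [measurable]: "g n \<in> borel_measurable borel" for n by (rule square_integrable_measurable[OF si])
  have P: "ball_proj r (v n) = abs_l2 (g n)" for n by (simp add: ball_proj_def l2_mult_def g_def [abs_def])
  obtain M where M: "M \<ge> 0" "\<And>w. (LINT x|lborel. cmod (indicator ?B x * rep_l2 w x)) \<le> M * norm w"
    using integral_ball_le[of r] by blast
  have gM: "(LINT x|lborel. cmod (g n x)) \<le> M" for n
    using M(2)[of "v n"] mult_left_mono[OF v[of n] M(1)] unfolding g_def by linarith
  define C where "C = cmod (kernel_factor t) * M"
  have bd: "cmod (fresnel t (g n) x) \<le> C" for n x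
    unfolding C_def by (rule order_trans[OF norm_fresnel_le]) (simp add: gM mult_left_mono)
  \<comment> \<open>The added 1 keeps \<open>L\<close> positive, so that e / L is a valid modulus.
    The absolute value of \<open>r\<close> covers a negative radius, for which the ball is
    empty.\<close>
  define L where "L = cmod (kernel_factor t) * (\<bar>r\<bar> / \<bar>t\<bar>) * M + 1"
  have L0: "L > 0" unfolding L_def using M(1) by (intro add_nonneg_pos mult_nonneg_nonneg) auto
  have lip: "cmod (fresnel t (g n) x - fresnel t (g n) x') \<le> L * norm (x - x')" if "x \<in> ?B" "x' \<in> ?B" for n x x'
  proof -
    have r: "r = \<bar>r\<bar>" using that norm_ge_zero[of x] by (simp del: norm_ge_zero)
    have "cmod (fresnel t (g n) x - fresnel t (g n) x') \<le> cmod (kernel_factor t) * (\<bar>r\<bar> / \<bar>t\<bar>) * norm (x - x') * (LINT y|lborel. cmod (g n y))"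
      using fresnel_diff_le[OF t int supp, where x = x and x' = x'] that r by simp
    also have "\<dots> \<le> cmod (kernel_factor t) * (\<bar>r\<bar> / \<bar>t\<bar>) * norm (x - x') * M"
      by (intro mult_left_mono gM mult_nonneg_nonneg) auto
    also have "\<dots> \<le> L * norm (x - x')" by (simp add: L_def algebra_simps)
    finally show ?thesis .
  qed
  obtain z k where z: "continuous_on ?B z" "strict_mono (k::nat \<Rightarrow> nat)"
    "\<And>e. 0 < e \<Longrightarrow> \<exists>N. \<forall>n x. n \<ge> N \<and> x \<in> ?B \<longrightarrow> norm (fresnel t (g (k n)) x - z x) < e"
  proof (rule Arzela_Ascoli[of ?B "\<lambda>n. fresnel t (g n)" C])
    show "compact ?B" by simp
    show "cmod (fresnel t (g n) x) \<le> C" for n x by (rule bd)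
    show "\<exists>d>0. \<forall>n y. y \<in> ?B \<and> norm (x - y) < d \<longrightarrow> norm (fresnel t (g n) x - fresnel t (g n) y) < e"
      if "x \<in> ?B" "0 < e" for x e
    proof (intro exI[of _ "e / L"] conjI allI impI)
      show "e / L > 0" using that L0 by simp
      show "norm (fresnel t (g n) x - fresnel t (g n) y) < e" if y: "y \<in> ?B \<and> norm (x - y) < e / L" for n y
      proof -
        have "L * norm (x - y) < e" using y L0 by (simp add: pos_less_divide_eq mult.commute)
        thus ?thesis using lip[OF \<open>x \<in> ?B\<close>, of y n] y by simp
      qed
    qed
  qed (rule that)
  define Z where "Z x = (if x \<in> ?B then z x else 0)" for x
  have PU: "ball_proj r (free_flow t (ball_proj r (v n))) = abs_l2 (\<lambda>x. indicator ?B x * fresnel t (g n) x)" for n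
    unfolding P free_flow_fresnel(2)[OF t int si] unfolding ball_proj_def
    by (rule l2_mult_bdd_abs[OF bdd_fun_indicator_cball free_flow_fresnel(1)[OF t int si]])
  have ptw: "(\<lambda>n. indicator ?B x * fresnel t (g (k n)) x) \<longlonglongrightarrow> Z x" for x
  proof (cases "x \<in> ?B")
    case True
    have "(\<lambda>n. fresnel t (g (k n)) x) \<longlonglongrightarrow> z x"
      unfolding LIMSEQ_iff using z(3) True by meson
    thus ?thesis using True by (simp add: Z_def)
  qed (simp add: Z_def)
  have m: "(\<lambda>x. indicator ?B x * fresnel t (g n) x) \<in> borel_measurable borel" for n
    by (intro borel_measurable_times borel_measurable_indicator measurable_fresnel) auto
  \<comment> \<open>Convergence on the ball upgrades to L^2 because the functions vanish outside it
    and share the bound \<open>C\<close>.\<close>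
  have "(\<lambda>n. abs_l2 (\<lambda>x. indicator ?B x * fresnel t (g (k n)) x)) \<longlonglongrightarrow> abs_l2 Z"
  proof (rule l2_dominated_convergence(3)[OF siB m])
    show "Z \<in> borel_measurable borel" by (rule borel_measurable_LIMSEQ_metric[OF m]) (rule ptw)
    show "AE x in lborel. (\<lambda>n. indicator ?B x * fresnel t (g (k n)) x) \<longlonglongrightarrow> Z x" using ptw by simp
    show "AE x in lborel. cmod (indicator ?B x * fresnel t (g (k n)) x) \<le> C * cmod (indicator ?B x)" for n
      using bd by (intro AE_I2) (auto simp: indicator_def)
  qed
  thus ?thesis using that[OF z(2), of "abs_l2 Z"] by (simp add: PU)
qed

text \<open>The limiting case of the uncertainty principle: a state cannot live in one ball at two
  different times.\<close>

lemma two_ball_unique: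
  assumes t: "t \<noteq> 0" and w: "ball_proj r w = w" "ball_proj r (free_flow t w) = free_flow t w"
  shows "w = 0"
proof -
  let ?B = "cball (0::real^3) r"
  define g where "g x = indicator ?B x * rep_l2 w x" for x
  have si: "square_integrable g"
    unfolding g_def [abs_def] by (rule square_integrable_bdd_mult[OF bdd_fun_indicator_cball square_integrable_rep])
  have int: "integrable lborel g"
    by (rule integrable_bounded_support[OF si, of ?B]) (auto simp: g_def)
  have g: "w = abs_l2 g" using w(1) by (simp add: ball_proj_def l2_mult_def g_def [abs_def])
  note fr = free_flow_fresnel[OF t int si]
  have "AE x in lborel. rep_l2 (ball_proj r (free_flow t w)) x = indicator ?B x * rep_l2 (free_flow t w) x"
    unfolding ball_proj_def by (rule rep_l2_mult[OF bdd_fun_indicator_cball])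
  moreover have "AE x in lborel. rep_l2 (free_flow t w) x = fresnel t g x"
    unfolding g fr(2) by (rule rep_abs_l2[OF fr(1)])
  ultimately have ae: "AE x in lborel. norm x > r \<longrightarrow> fresnel t g x = 0"
    unfolding w(2) by eventually_elim (auto simp: indicator_def split: if_splits)
  have "abs_l2 g = 0"
    by (rule fresnel_unique_continuation[OF t int si _ ae]) (simp add: g_def)
  thus ?thesis by (simp add: g)
qed

text \<open>Otherwise some unit vectors lose asymptotically no mass outside the ball at either time.
  Compactness of the truncated flow makes a subsequence converge in norm, and its limit is a unit
  vector living in the ball at both times, contrary to \<open>two_ball_unique\<close>.\<close>

lemma two_time_observability:
  assumes t: "t \<noteq> 0"
  obtains q where "0 \<le> q" "q < 1" "\<And>w. norm (ball_proj r w) + norm (ball_proj r (free_flow t w)) \<le> 2 * q * norm w"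
proof (rule ccontr)
  assume *: "\<not> thesis"
  interpret P: bounded_linear "ball_proj r" by (rule bounded_linear_ball_proj)
  interpret U: bounded_linear "free_flow t'" for t' by (rule bounded_linear_free_flow)
  define q where "q n = 1 - inverse (real (Suc n))" for n
  have q: "0 \<le> q n" "q n < 1" for n by (simp_all add: q_def field_simps)
  have "q \<longlonglongrightarrow> 1 - 0" unfolding q_def by (intro tendsto_intros LIMSEQ_inverse_real_of_nat)
  hence q1: "q \<longlonglongrightarrow> 1" by simp
  have "\<exists>w. \<not> norm (ball_proj r w) + norm (ball_proj r (free_flow t w)) \<le> 2 * q n * norm w" for n
    using * that[of "q n"] q[of n] by blast
  then obtain w where w: "\<And>n. norm (ball_proj r (w n)) + norm (ball_proj r (free_flow t (w n))) > 2 * q n * norm (w n)"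
    unfolding not_le by metis
  define v where "v n = (1 / norm (w n)) *\<^sub>R w n" for n
  have w0: "norm (w n) > 0" for n
  proof (rule ccontr)
    assume "\<not> norm (w n) > 0"
    hence "w n = 0" by simp
    thus False using w[of n] by (simp add: P.zero U.zero)
  qed
  have v: "norm (v n) = 1" for n using w0[of n] by (simp add: v_def)
  have Uv: "norm (free_flow t (v n)) = 1" for n by (simp add: v)
  have pq: "norm (ball_proj r (v n)) + norm (ball_proj r (free_flow t (v n))) > 2 * q n" for n
  proof -
    have "norm (ball_proj r (v n)) + norm (ball_proj r (free_flow t (v n)))
        = (norm (ball_proj r (w n)) + norm (ball_proj r (free_flow t (w n)))) / norm (w n)"
      using w0[of n] by (simp add: v_def P.scaleR U.scaleR add_divide_distrib)
    thus ?thesis using w[of n] w0[of n] by (simp add: pos_less_divide_eq)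
  qed
  \<comment> \<open>Each of the two norms is at most 1 while their sum exceeds 2 q, so each is
    squeezed between 2 q - 1 and 1.\<close>
  have lim: "(\<lambda>n. a n) \<longlonglongrightarrow> (1::real)" if "\<And>n. a n \<le> 1" "\<And>n. 2 * q n - 1 \<le> a n" for a
  proof (rule tendsto_sandwich[of "\<lambda>n. 2 * q n - 1" a _ "\<lambda>_. 1"])
    have "(\<lambda>n. 2 * q n - 1) \<longlonglongrightarrow> 2 * 1 - 1" by (intro tendsto_intros q1)
    thus "(\<lambda>n. 2 * q n - 1) \<longlonglongrightarrow> 1" by simp
  qed (use that in auto)
  have b: "norm (ball_proj r (v n)) \<le> 1" "norm (ball_proj r (free_flow t (v n))) \<le> 1" for n
    using norm_ball_proj_le[of r "v n"] norm_ball_proj_le[of r "free_flow t (v n)"] by (simp_all add: v)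
  have 1: "(\<lambda>n. v n - ball_proj r (v n)) \<longlonglongrightarrow> 0"
    by (rule ball_proj_asymptotic[OF v lim]) (use b pq in \<open>smt (verit)\<close>)+
  have 2: "(\<lambda>n. free_flow t (v n) - ball_proj r (free_flow t (v n))) \<longlonglongrightarrow> 0"
    by (rule ball_proj_asymptotic[OF Uv lim]) (use b pq in \<open>smt (verit)\<close>)+
  obtain Z k where k: "strict_mono (k::nat \<Rightarrow> nat)"
    and Z: "(\<lambda>n. ball_proj r (free_flow t (ball_proj r (v (k n))))) \<longlonglongrightarrow> Z"
  proof (rule ball_proj_flow_compact[OF t, of v r])
    show "norm (v n) \<le> 1" for n by (simp add: v)
  qed (rule that)
  have 1: "(\<lambda>n. v (k n) - ball_proj r (v (k n))) \<longlonglongrightarrow> 0"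
    using LIMSEQ_subseq_LIMSEQ[OF 1 k] by (simp add: o_def)
  have 2: "(\<lambda>n. free_flow t (v (k n)) - ball_proj r (free_flow t (v (k n)))) \<longlonglongrightarrow> 0"
    using LIMSEQ_subseq_LIMSEQ[OF 2 k] by (simp add: o_def)
  \<comment> \<open>Writing P for the projection and U for the flow, U v = (U v - P U v) + P U (v -
    P v) + P U P v. The first two terms vanish in the limit, the third converges by
    compactness.\<close>
  have "(\<lambda>n. (free_flow t (v (k n)) - ball_proj r (free_flow t (v (k n))))
      + ball_proj r (free_flow t (v (k n) - ball_proj r (v (k n))))
      + ball_proj r (free_flow t (ball_proj r (v (k n))))) \<longlonglongrightarrow> 0 + ball_proj r (free_flow t 0) + Z"
    by (intro tendsto_add 2 Z P.tendsto U.tendsto 1)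
  hence UZ: "(\<lambda>n. free_flow t (v (k n))) \<longlonglongrightarrow> Z"
    by (simp add: P.zero U.zero U.diff P.diff)
  \<comment> \<open>The flow is invertible, so convergence of \<open>free_flow t (v (k n))\<close>
    gives convergence of \<open>v (k n)\<close> itself.\<close>
  define w' where "w' = free_flow (- t) Z"
  have "(\<lambda>n. free_flow (- t) (free_flow t (v (k n)))) \<longlonglongrightarrow> w'"
    unfolding w'_def by (rule U.tendsto[OF UZ])
  hence vw: "(\<lambda>n. v (k n)) \<longlonglongrightarrow> w'" by simp
  have "(\<lambda>n. norm (v (k n))) \<longlonglongrightarrow> norm w'" by (rule tendsto_norm[OF vw])
  hence "norm w' = 1" by (simp add: v LIMSEQ_const_iff)
  moreover have "w' = 0"
  proof (rule two_ball_unique[OF t])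
    have "(\<lambda>n. v (k n) - ball_proj r (v (k n))) \<longlonglongrightarrow> w' - ball_proj r w'"
      by (intro tendsto_diff P.tendsto vw)
    from LIMSEQ_unique[OF this 1] show "ball_proj r w' = w'" by simp
    have "(\<lambda>n. free_flow t (v (k n)) - ball_proj r (free_flow t (v (k n)))) \<longlonglongrightarrow> free_flow t w' - ball_proj r (free_flow t w')"
      by (intro tendsto_diff P.tendsto U.tendsto vw)
    from LIMSEQ_unique[OF this 2] show "ball_proj r (free_flow t w') = free_flow t w'" by simp
  qed
  ultimately show False by simp
qed

section \<open>The control\<close>

text \<open>Neumann series with the contraction measured by \<open>N\<close> and the convergence by
  the norm. Keeping the two apart allows a weighted functional in place of the given norm of
  \<open>h1\<close>.\<close>

lemma bounded_linear_fixed_point: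
  fixes A :: "'a::banach \<Rightarrow> 'a" and N :: "'a \<Rightarrow> real"
  assumes A: "bounded_linear A" and q: "0 \<le> q" "q < 1"
    and N: "\<And>f. N (A f) \<le> q * N f" "\<And>f. norm f \<le> K * N f" and K: "K \<ge> 0"
  shows "\<exists>g. g = u + A g"
proof -
  have Nn: "N ((A ^^ n) u) \<le> q ^ n * N u" for n
  proof (induction n)
    case (Suc n)
    have "N (A ((A ^^ n) u)) \<le> q * N ((A ^^ n) u)" by (rule N)
    also have "\<dots> \<le> q * (q ^ n * N u)" using Suc q by (intro mult_left_mono)
    finally show ?case by (simp add: mult.assoc)
  qed simp
  have bd: "norm ((A ^^ n) u) \<le> K * N u * q ^ n" for n
    using N(2)[of "(A ^^ n) u"] mult_left_mono[OF Nn[of n] K] by (simp add: mult_ac)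
  have sm: "summable (\<lambda>n. (A ^^ n) u)"
    by (rule summable_comparison_test[of _ "\<lambda>n. K * N u * q ^ n"])
      (use bd q in \<open>auto intro!: summable_mult summable_geometric\<close>)
  have "A (\<Sum>n. (A ^^ n) u) = (\<Sum>n. A ((A ^^ n) u))"
    by (rule bounded_linear.suminf[OF A sm])
  also have "\<dots> = (\<Sum>n. (A ^^ n) u) - u"
    using suminf_split_head[OF sm] by simp
  finally show ?thesis by (intro exI[of _ "\<Sum>n. (A ^^ n) u"]) simp
qed

section \<open>The averaged operator on L^2\<close>

lemma free_flow_tendsto_joint:
  "t \<longlonglongrightarrow> t\<^sub>0 \<Longrightarrow> f \<longlonglongrightarrow> f\<^sub>0 \<Longrightarrow> (\<lambda>n. free_flow (t n) (f n)) \<longlonglongrightarrow> free_flow t\<^sub>0 f\<^sub>0"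
  by (rule isometries_tendsto[OF bounded_linear_free_flow norm_free_flow free_flow_tendsto])

lemma continuous_on_free_flow:
  fixes t :: "'a::metric_space \<Rightarrow> real"
  assumes "continuous_on S t" "continuous_on S f"
  shows "continuous_on S (\<lambda>x. free_flow (t x) (f x))"
  using assms unfolding continuous_on_sequentially
  by (auto simp: o_def intro!: free_flow_tendsto_joint)

definition conj_flow :: "(real^3 \<Rightarrow> complex) \<Rightarrow> real \<Rightarrow> l2 \<Rightarrow> l2" where
  "conj_flow m t f = free_flow (- t) (l2_mult m (free_flow t f))"

text \<open>For m = \<kappa> this is the operator to be contracted. The multiplier is left free
  because the partial derivatives of \<kappa> enter in the same way when the average is
  differentiated.\<close>

definition flow_average :: "real \<Rightarrow> (real^3 \<Rightarrow> complex) \<Rightarrow> l2 \<Rightarrow> l2" where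
  "flow_average T m f = (1 / T) *\<^sub>R integral {0..T} (\<lambda>t. conj_flow m t f)"

lemma continuous_on_conj_flow: "bdd_fun m \<Longrightarrow> continuous_on S (\<lambda>t. conj_flow m t f)"
  unfolding conj_flow_def
  by (intro continuous_on_free_flow continuous_intros
      bounded_linear.continuous_on[OF bounded_linear_l2_mult])

lemma norm_conj_flow [simp]: "norm (conj_flow m t f) = norm (l2_mult m (free_flow t f))"
  by (simp add: conj_flow_def)

lemma norm_flow_average_le:
  assumes m: "bdd_fun m" "\<And>x. cmod (m x) \<le> C" and T: "T > 0"
  shows "norm (flow_average T m f) \<le> C * norm f"
proof -
  have "norm (integral {0..T} (\<lambda>t. conj_flow m t f)) \<le> (C * norm f) * (T - 0)"
  proof (rule integral_bound)
    show "continuous_on {0..T} (\<lambda>t. conj_flow m t f)" by (rule continuous_on_conj_flow[OF m(1)])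
    show "norm (conj_flow m t f) \<le> C * norm f" for t
      using norm_l2_mult_le[OF bdd_fun_measurable[OF m(1)] m(2), of "free_flow t f"] by simp
  qed (use T in auto)
  thus ?thesis using T by (simp add: flow_average_def field_simps)
qed

text \<open>Pairing the times \<open>t\<close> and \<open>t + T / 2\<close> turns the two-time estimate into a contraction of the average.\<close>
lemma flow_average_contraction:
  assumes \<kappa>: "\<And>x. cmod (\<kappa> x) \<le> indicator (cball 0 r) x" "\<kappa> \<in> borel_measurable borel" and T: "T > 0"
  obtains q where "0 \<le> q" "q < 1" "\<And>f. norm (flow_average T \<kappa> f) \<le> q * norm f"
proof -
  have bdd: "bdd_fun \<kappa>"
    by (rule bdd_funI[OF \<kappa>(2), of 1]) (rule order_trans[OF \<kappa>(1)], simp add: indicator_def)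
  have le: "norm (l2_mult \<kappa> w) \<le> norm (ball_proj r w)" for w
  proof -
    have "norm (abs_l2 (\<lambda>x. \<kappa> x * rep_l2 w x)) \<le> 1 * norm (abs_l2 (\<lambda>x. indicator (cball 0 r) x * rep_l2 w x))"
    proof (rule norm_abs_l2_mono)
      show "AE x in lborel. cmod (\<kappa> x * rep_l2 w x) \<le> 1 * cmod (indicator (cball 0 r) x * rep_l2 w x)"
      proof (rule AE_I2)
        fix x
        show "cmod (\<kappa> x * rep_l2 w x) \<le> 1 * cmod (indicator (cball 0 r) x * rep_l2 w x)"
          using mult_right_mono[OF \<kappa>(1)[of x] norm_ge_zero[of "rep_l2 w x"]]
          by (cases "x \<in> cball 0 r") (simp_all add: norm_mult)
      qed
    qed (auto intro: square_integrable_bdd_mult[OF bdd] square_integrable_bdd_mult[OF bdd_fun_indicator_cball] square_integrable_rep)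
    thus ?thesis by (simp add: l2_mult_def ball_proj_def)
  qed
  obtain q where q: "0 \<le> q" "q < 1" "\<And>w. norm (ball_proj r w) + norm (ball_proj r (free_flow (T / 2) w)) \<le> 2 * q * norm w"
    using two_time_observability[of "T / 2" r] T by auto
  have "norm (flow_average T \<kappa> f) \<le> q * norm f" for f
  proof -
    let ?F = "\<lambda>t. conj_flow \<kappa> t f"
    have cont: "continuous_on S ?F" for S by (rule continuous_on_conj_flow[OF bdd])
    have cont2: "continuous_on S (\<lambda>t. ?F (T / 2 + t))" for S
      by (rule continuous_on_compose2[OF cont[of UNIV]]) (auto intro!: continuous_intros)
    have "integral {0..T} ?F = integral {0..T / 2} ?F + integral {T / 2..T} ?F"
      using T by (intro Henstock_Kurzweil_Integration.integral_combine[symmetric] integrable_continuous_interval cont) auto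
    also have "integral {T / 2..T} ?F = integral {0..T / 2} (\<lambda>t. ?F (T / 2 + t))"
      using integral_shift_Icc_real[of 0 "T / 2" ?F "T / 2"] by (simp add: o_def)
    also have "integral {0..T / 2} ?F + integral {0..T / 2} (\<lambda>t. ?F (T / 2 + t)) = integral {0..T / 2} (\<lambda>t. ?F t + ?F (T / 2 + t))"
      by (intro Henstock_Kurzweil_Integration.integral_add[symmetric] integrable_continuous_interval cont cont2)
    also have "norm \<dots> \<le> (2 * q * norm f) * (T / 2 - 0)"
    proof (rule integral_bound)
      show "continuous_on {0..T / 2} (\<lambda>t. ?F t + ?F (T / 2 + t))" by (intro continuous_on_add cont cont2)
      fix t
      \<comment> \<open>The outer flows are isometries and drop out, and by the group law the later
        state is the flow over T / 2 of the earlier one, so the two-time estimate applies to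
        \<open>free_flow t f\<close>.\<close>
      have "norm (?F t + ?F (T / 2 + t)) \<le> norm (l2_mult \<kappa> (free_flow t f)) + norm (l2_mult \<kappa> (free_flow (T / 2) (free_flow t f)))"
        by (rule norm_triangle_le) simp
      also have "\<dots> \<le> norm (ball_proj r (free_flow t f)) + norm (ball_proj r (free_flow (T / 2) (free_flow t f)))"
        by (intro add_mono le)
      also have "\<dots> \<le> 2 * q * norm (free_flow t f)" by (rule q)
      finally show "norm (?F t + ?F (T / 2 + t)) \<le> 2 * q * norm f" by simp
    qed (use T in auto)
    finally show ?thesis using T by (simp add: flow_average_def field_simps)
  qed
  with q(1,2) show ?thesis by (rule that)
qed

section \<open>The averaged operator on H^1\<close>

definition conj_group :: "(real^3 \<Rightarrow> complex) \<Rightarrow> real \<Rightarrow> h1 \<Rightarrow> h1" where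
  "conj_group m t f = schroedinger_group (- t) (h1_mult m (schroedinger_group t f))"

definition group_average :: "real \<Rightarrow> (real^3 \<Rightarrow> complex) \<Rightarrow> h1 \<Rightarrow> h1" where
  "group_average T m f = (1 / T) *\<^sub>R integral {0..T} (\<lambda>t. conj_group m t f)"

lemma continuous_on_conj_group: "smooth_multiplier m \<Longrightarrow> continuous_on S (\<lambda>t. conj_group m t f)"
  unfolding conj_group_def
  by (intro continuous_on_schroedinger continuous_intros
      bounded_linear.continuous_on[OF bounded_linear_h1_mult])

lemma bounded_linear_conj_group: "smooth_multiplier m \<Longrightarrow> bounded_linear (conj_group m t)"
  unfolding conj_group_def [abs_def]
  by (intro bounded_linear_compose[OF bounded_linear_schroedinger] bounded_linear_compose[OF bounded_linear_h1_mult]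
      bounded_linear_schroedinger)

lemma bounded_linear_group_average:
  assumes m: "smooth_multiplier m" and T: "T > 0"
  shows "bounded_linear (group_average T m)"
proof -
  interpret a: bounded_linear "conj_group m t" for t by (rule bounded_linear_conj_group[OF m])
  interpret b: bounded_linear "h1_mult m" by (rule bounded_linear_h1_mult[OF m])
  obtain K where K: "\<And>f. norm (h1_mult m f) \<le> norm f * K" using b.bounded by blast
  have int: "(\<lambda>t. conj_group m t f) integrable_on {0..T}" for f
    by (intro integrable_continuous_interval continuous_on_conj_group m)
  show ?thesis
  proof (rule bounded_linear_intro[of _ K])
    fix f g :: h1 and r :: real
    show "group_average T m (f + g) = group_average T m f + group_average T m g"
      by (simp add: group_average_def a.add Henstock_Kurzweil_Integration.integral_add int scaleR_add_right)
    show "group_average T m (r *\<^sub>R f) = r *\<^sub>R group_average T m f"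
      by (simp add: group_average_def a.scaleR)
    have "norm (integral {0..T} (\<lambda>t. conj_group m t f)) \<le> (norm f * K) * (T - 0)"
    proof (rule integral_bound)
      show "continuous_on {0..T} (\<lambda>t. conj_group m t f)" by (rule continuous_on_conj_group[OF m])
      show "norm (conj_group m t f) \<le> norm f * K" for t
        using K[of "schroedinger_group t f"] by (simp add: conj_group_def)
    qed (use T in auto)
    thus "norm (group_average T m f) \<le> norm f * K"
      using T by (simp add: group_average_def field_simps)
  qed
qed

text \<open>Bounded linear maps pass through the time integral and derivatives commute with the
  flow, so the product rule for \<partial>_j (m f) is the sole source of the second term, an average
  applied to \<open>l2_of_h1 f\<close> without derivatives.\<close>

lemma group_average_components:
  assumes m: "smooth_multiplier m"
  shows "l2_of_h1 (group_average T m f) = flow_average T m (l2_of_h1 f)"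
    and "partial j (group_average T m f) = flow_average T m (partial j f)
      + flow_average T (\<lambda>x. frechet_derivative m (at x) (axis j 1)) (l2_of_h1 f)"
proof -
  let ?d = "\<lambda>x. frechet_derivative m (at x) (axis j 1)"
  interpret a: bounded_linear l2_of_h1 by (rule bounded_linear_l2_of_h1)
  interpret b: bounded_linear "partial j" by (rule bounded_linear_partial)
  interpret c: bounded_linear "free_flow t" for t by (rule bounded_linear_free_flow)
  have bd: "bdd_fun m" "bdd_fun ?d" using m by (auto simp: smooth_multiplier_def)
  have int: "(\<lambda>t. conj_group m t f) integrable_on {0..T}"
    by (intro integrable_continuous_interval continuous_on_conj_group m)
  have "l2_of_h1 (integral {0..T} (\<lambda>t. conj_group m t f)) = integral {0..T} (\<lambda>t. l2_of_h1 (conj_group m t f))"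
    using integral_linear[OF int bounded_linear_l2_of_h1] by (simp add: o_def)
  thus "l2_of_h1 (group_average T m f) = flow_average T m (l2_of_h1 f)"
    by (simp add: group_average_def flow_average_def a.scaleR conj_group_def conj_flow_def l2_of_h1_mult m)
  have "partial j (integral {0..T} (\<lambda>t. conj_group m t f)) = integral {0..T} (\<lambda>t. partial j (conj_group m t f))"
    using integral_linear[OF int bounded_linear_partial] by (simp add: o_def)
  also have "\<dots> = integral {0..T} (\<lambda>t. conj_flow m t (partial j f) + conj_flow ?d t (l2_of_h1 f))"
    by (simp add: conj_group_def conj_flow_def partial_h1_mult m c.add)
  also have "\<dots> = integral {0..T} (\<lambda>t. conj_flow m t (partial j f)) + integral {0..T} (\<lambda>t. conj_flow ?d t (l2_of_h1 f))"
    by (intro Henstock_Kurzweil_Integration.integral_add integrable_continuous_interval continuous_on_conj_flow bd)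
  finally show "partial j (group_average T m f) = flow_average T m (partial j f) + flow_average T ?d (l2_of_h1 f)"
    by (simp add: group_average_def flow_average_def b.scaleR scaleR_add_right)
qed

text \<open>Differentiation commutes with the average up to a bounded term without derivatives; weighting the
  gradient by a small \<open>\<delta>\<close> makes that term negligible, so the contraction passes from \<open>L\<^sup>2\<close> to \<open>H\<^sup>1\<close>.\<close>
lemma group_average_fixed_point:
  assumes \<kappa>: "\<And>x. cmod (\<kappa> x) \<le> indicator (cball 0 r) x" "smooth_multiplier \<kappa>" and T: "T > 0"
  shows "\<exists>g. g = u + group_average T \<kappa> g"
proof -
  let ?d = "\<lambda>j x. frechet_derivative \<kappa> (at x) (axis j 1)"
  have bd: "bdd_fun \<kappa>" "bdd_fun (?d j)" for j using \<kappa>(2) by (auto simp: smooth_multiplier_def)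
  obtain q where q: "0 \<le> q" "q < 1" "\<And>f. norm (flow_average T \<kappa> f) \<le> q * norm f"
    using flow_average_contraction[OF \<kappa>(1) bdd_fun_measurable[OF bd(1)] T] by blast
  have "\<forall>j. \<exists>C. \<forall>x. cmod (?d j x) \<le> C" using bd(2) by (simp add: bdd_fun_def)
  then obtain C where C: "\<And>j x. cmod (?d j x) \<le> C j" by metis
  have C0: "C j \<ge> 0" for j using C[of 0 j] norm_ge_zero order_trans by blast
  define S where "S = (\<Sum>j\<in>UNIV. C j)"
  have S: "S \<ge> 0" unfolding S_def by (intro sum_nonneg C0)
  \<comment> \<open>Small enough that q + \<delta> S is at most (1 + q) / 2, the midpoint between
    \<open>q\<close> and 1. The term S + 1 avoids division by zero, and \<delta> at most 1 lets 1 /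
    \<delta> compare \<open>N\<close> with the norm of \<open>h1\<close>.\<close>
  define \<delta> where "\<delta> = min 1 ((1 - q) / (2 * (S + 1)))"
  have \<delta>: "0 < \<delta>" "\<delta> \<le> 1" using q S by (simp_all add: \<delta>_def)
  have "\<delta> * S \<le> (1 - q) / (2 * (S + 1)) * (S + 1)" using q S by (intro mult_mono) (auto simp: \<delta>_def)
  also have "\<dots> = (1 - q) / 2" using S by (simp add: field_simps)
  finally have \<delta>S: "\<delta> * S \<le> (1 - q) / 2" .
  define N where "N f = norm (l2_of_h1 f) + \<delta> * (\<Sum>j\<in>UNIV. norm (partial j f))" for f
  let ?q = "(1 + q) / 2"
  show ?thesis
  proof (rule bounded_linear_fixed_point[OF bounded_linear_group_average[OF \<kappa>(2) T], of ?q N "1 / \<delta>"])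
    fix f :: h1
    have "N (group_average T \<kappa> f) \<le> q * norm (l2_of_h1 f) + \<delta> * (\<Sum>j\<in>UNIV. q * norm (partial j f) + C j * norm (l2_of_h1 f))"
      unfolding N_def group_average_components[OF \<kappa>(2)]
      using \<delta>(1) by (intro add_mono mult_left_mono sum_mono norm_triangle_le q norm_flow_average_le[OF bd(2) C T]) auto
    also have "\<dots> = (q + \<delta> * S) * norm (l2_of_h1 f) + q * (\<delta> * (\<Sum>j\<in>UNIV. norm (partial j f)))"
      by (simp add: S_def sum.distrib sum_distrib_left sum_distrib_right algebra_simps)
    also have "\<dots> \<le> ?q * norm (l2_of_h1 f) + ?q * (\<delta> * (\<Sum>j\<in>UNIV. norm (partial j f)))"
      using \<delta>S q \<delta> by (intro add_mono mult_right_mono) (auto simp: field_simps sum_nonneg)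
    also have "\<dots> = ?q * N f" by (simp only: N_def distrib_left)
    finally show "N (group_average T \<kappa> f) \<le> ?q * N f" .
    have "norm f \<le> norm (l2_of_h1 f) + (\<Sum>j\<in>UNIV. norm (partial j f))" by (rule norm_h1_le)
    also have "\<dots> \<le> (1 / \<delta>) * norm (l2_of_h1 f) + (\<Sum>j\<in>UNIV. norm (partial j f))"
      using \<delta> mult_right_mono[of 1 "1 / \<delta>" "norm (l2_of_h1 f)"] by simp
    also have "\<dots> = (1 / \<delta>) * N f" using \<delta> by (simp add: N_def field_simps)
    finally show "norm f \<le> 1 / \<delta> * N f" .
  qed (use q \<delta> in auto)
qed

section \<open>Smooth cut-offs as multipliers\<close>

lemma C_k_of_real:
  fixes f :: "'a::real_normed_vector \<Rightarrow> real"
  shows "C_k n f \<Longrightarrow> C_k n (\<lambda>x. complex_of_real (f x))"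
proof (induction n arbitrary: f)
  case 0
  thus ?case by (auto intro: continuous_intros)
next
  case (Suc n)
  show ?case
  proof (rule C_k_SucI[where f' = "\<lambda>x v. complex_of_real (frechet_derivative f (at x) v)"])
    show "((\<lambda>x. complex_of_real (f x)) has_derivative (\<lambda>v. complex_of_real (frechet_derivative f (at x) v))) (at x)" for x
      by (rule has_derivative_of_real[OF C_k_has_derivative[OF Suc.prems]])
    show "C_k n (\<lambda>x. complex_of_real (frechet_derivative f (at x) v))" for v
      using Suc.prems by (intro Suc.IH) simp
  qed
qed

lemma smooth_one_minus:
  fixes f :: "'a::real_normed_vector \<Rightarrow> complex"
  assumes "smooth f"
  shows "smooth (\<lambda>x. 1 - f x)"
    "frechet_derivative (\<lambda>x. 1 - f x) (at x) v = - frechet_derivative f (at x) v"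
proof -
  have "C_k n (\<lambda>x. 1 + (- 1) * f x)" for n
    by (intro C_k_add C_k_mult C_k_const smooth_C_k assms)
  thus "smooth (\<lambda>x. 1 - f x)" by (simp add: smooth_def)
  have "((\<lambda>x. 1 - f x) has_derivative (\<lambda>v. 0 - frechet_derivative f (at x) v)) (at x)"
    by (intro has_derivative_diff has_derivative_const C_k_has_derivative[OF smooth_C_k[OF assms, of "Suc 0"]])
  from frechet_derivative_at[OF this, symmetric]
  show "frechet_derivative (\<lambda>x. 1 - f x) (at x) v = - frechet_derivative f (at x) v" by simp
qed

lemma smooth_multiplier_test:
  assumes t: "test_function m"
  shows "smooth_multiplier m"
proof -
  have "bdd_fun \<psi>" if "test_function \<psi>" for \<psi>
    using test_function_bounded[OF that] bdd_funI[OF smooth_measurable[OF test_function_smooth[OF that]]] by metis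
  thus ?thesis
    using t test_function_frechet[OF t] by (simp add: smooth_multiplier_def test_function_smooth)
qed

lemma smooth_multiplier_one_minus:
  assumes "smooth_multiplier m"
  shows "smooth_multiplier (\<lambda>x. 1 - m x)"
proof -
  have s: "smooth m" using assms by (simp add: smooth_multiplier_def)
  have neg: "bdd_fun (\<lambda>x. - f x)" if "bdd_fun f" for f
    using bdd_fun_mult[OF bdd_fun_const[of "- 1"] that] by simp
  have "bdd_fun (\<lambda>x. 1 + - m x)"
    using assms by (intro bdd_fun_add bdd_fun_const neg smooth_multiplier_bdd)
  thus ?thesis
    using assms by (auto simp: smooth_multiplier_def smooth_one_minus[OF s] intro: neg)
qed

lemma l2_mult_one_minus:
  assumes "bdd_fun m"
  shows "l2_mult (\<lambda>x. 1 - m x) f = f - l2_mult m f"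
  using abs_l2_diff[OF square_integrable_rep[of f] square_integrable_bdd_mult[OF assms square_integrable_rep[of f]]]
  by (simp add: l2_mult_def abs_rep_l2 left_diff_distrib)

lemma h1_mult_scaleR: "h1_mult (\<lambda>_. of_real r) f = r *\<^sub>R f"
  by (rule h1_eqI) (simp add: l2_of_h1_mult smooth_multiplier_const l2_mult_scaleR scaleR_h1.rep_eq)

lemma h1_mult_one_minus:
  assumes m: "smooth_multiplier m"
  shows "h1_mult (\<lambda>x. 1 - m x) f = f - h1_mult m f"
  by (rule h1_eqI)
    (simp add: l2_of_h1_mult m smooth_multiplier_one_minus l2_mult_one_minus smooth_multiplier_bdd minus_h1.rep_eq)

text \<open>With this control the Duhamel integrand is the flow at time t applied to a vector
  depending on \<tau> alone. The solution is therefore the flow of the initial state minus a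
  primitive \<open>Y\<close>, and the equation for \<open>g\<close> says precisely that
  \<open>Y T\<close> is the initial state.\<close>

lemma control_to_zero:
  assumes mult: "smooth_multiplier (\<lambda>x. complex_of_real (\<phi> x))"
    and \<kappa>: "\<kappa> = (\<lambda>x. 1 - complex_of_real (\<phi> x) * complex_of_real (\<phi> x))"
    and g: "g = u\<^sub>0 + group_average T \<kappa> g" and T: "T > 0"
    and h: "h = (\<lambda>t. h1_mult (\<lambda>x. - \<i> / of_real T * complex_of_real (\<phi> x)) (schroedinger_group t g))"
  shows "continuous_on UNIV h" "\<exists>u. is_solution \<phi> u\<^sub>0 h u \<and> u T = 0"
proof -
  let ?m = "\<lambda>x. complex_of_real (\<phi> x)"
  \<comment> \<open>The factor -i meets the -i in front of the Duhamel integral, so the control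
    enters with a minus sign; 1 / T turns the time integral into the mean.\<close>
  let ?c = "- \<i> / of_real T :: complex"
  have mc: "smooth_multiplier (\<lambda>x. ?c * ?m x)"
    by (intro smooth_multiplier_mult smooth_multiplier_const mult)
  have mm: "smooth_multiplier (\<lambda>x. ?m x * ?m x)" by (intro smooth_multiplier_mult mult)
  have k: "smooth_multiplier \<kappa>" unfolding \<kappa> by (rule smooth_multiplier_one_minus[OF mm])
  show "continuous_on UNIV h"
    unfolding h by (intro bounded_linear.continuous_on[OF bounded_linear_h1_mult[OF mc]] continuous_on_schroedinger continuous_intros)
  interpret E: bounded_linear "schroedinger_group t" for t by (rule bounded_linear_schroedinger)
  have Q: "h1_mult (\<lambda>x. ?m x * ?m x) f = f - h1_mult \<kappa> f" for f
    using h1_mult_one_minus[OF k, of f] by (simp add: \<kappa>)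
  define W where "W \<tau> = (1 / T) *\<^sub>R (g - conj_group \<kappa> \<tau> g)" for \<tau>
  have contW: "continuous_on S W" for S
    unfolding W_def by (intro continuous_intros continuous_on_conj_group k)
  define Y where "Y t = integral {0..t} W" for t
  define u where "u t = schroedinger_group t (u\<^sub>0 - Y t)" for t
  define I where "I t = h1_mult (\<lambda>_. - \<i>) (schroedinger_group t (Y t))" for t
  have integrand: "schroedinger_group (t - \<tau>) (h1_mult ?m (h \<tau>)) = h1_mult (\<lambda>_. - \<i>) (schroedinger_group t (W \<tau>))" for t \<tau>
  proof -
    have "h1_mult ?m (h \<tau>) = h1_mult (\<lambda>x. - \<i> * (of_real (1 / T) * (?m x * ?m x))) (schroedinger_group \<tau> g)"
    proof -
      have "(\<lambda>x. ?m x * (?c * ?m x)) = (\<lambda>x. - \<i> * (of_real (1 / T) * (?m x * ?m x)))"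
        by (simp add: fun_eq_iff)
      thus ?thesis unfolding h h1_mult_h1_mult[OF mult mc] by (simp only:)
    qed
    also have "\<dots> = h1_mult (\<lambda>_. - \<i>) (h1_mult (\<lambda>_. of_real (1 / T)) (h1_mult (\<lambda>x. ?m x * ?m x) (schroedinger_group \<tau> g)))"
      by (simp only: h1_mult_h1_mult[OF smooth_multiplier_const mm]
          h1_mult_h1_mult[OF smooth_multiplier_const smooth_multiplier_mult[OF smooth_multiplier_const mm]])
    also have "\<dots> = h1_mult (\<lambda>_. - \<i>) ((1 / T) *\<^sub>R (schroedinger_group \<tau> g - h1_mult \<kappa> (schroedinger_group \<tau> g)))"
      by (simp only: h1_mult_scaleR Q)
    also have "schroedinger_group (t - \<tau>) \<dots> = h1_mult (\<lambda>_. - \<i>) ((1 / T) *\<^sub>R (schroedinger_group t g - schroedinger_group (t - \<tau>) (h1_mult \<kappa> (schroedinger_group \<tau> g))))"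
      by (simp only: h1_mult_const_schroedinger[symmetric] E.scaleR E.diff schroedinger_schroedinger diff_add_cancel)
    also have "(1 / T) *\<^sub>R (schroedinger_group t g - schroedinger_group (t - \<tau>) (h1_mult \<kappa> (schroedinger_group \<tau> g))) = schroedinger_group t (W \<tau>)"
      by (simp add: W_def E.scaleR E.diff conj_group_def)
    finally show ?thesis .
  qed
  have "(W has_integral Y t) {0..t}" for t
    unfolding Y_def by (intro integrable_integral integrable_continuous_interval contW)
  from has_integral_linear[OF this bounded_linear_compose[OF bounded_linear_h1_mult[OF smooth_multiplier_const] bounded_linear_schroedinger]]
  have int: "((\<lambda>\<tau>. schroedinger_group (t - \<tau>) (h1_mult ?m (h \<tau>))) has_integral I t) {0..t}" for t
    unfolding integrand I_def by (simp add: o_def)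
  have u: "u t = schroedinger_group t u\<^sub>0 - h1_mult (\<lambda>_. \<i>) (I t)" for t
  proof -
    have "h1_mult (\<lambda>_. \<i>) (I t) = h1_mult (\<lambda>_. of_real 1) (schroedinger_group t (Y t))"
      unfolding I_def by (simp add: h1_mult_h1_mult smooth_multiplier_const)
    thus ?thesis by (simp only: h1_mult_scaleR u_def E.diff scaleR_one)
  qed
  have "continuous_on {0..} Y"
  \<comment> \<open>The primitive is known to be continuous on compact intervals only; the endpoint
    t + 1 makes such an interval a neighbourhood of t within the half-line.\<close>
  proof (rule continuous_on_eq_continuous_within[THEN iffD2], intro ballI)
    fix t :: real assume t: "t \<in> {0..}"
    have "continuous_on {0..t + 1} Y"
      unfolding Y_def by (intro indefinite_integral_continuous_1 integrable_continuous_interval contW)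
    hence "continuous (at t within {0..t + 1}) Y"
      using t by (auto simp: continuous_on_eq_continuous_within)
    moreover have "at t within {0..t + 1} = at t within {0..}"
      by (rule at_within_nhd[of _ "{..<t + 1}"]) auto
    ultimately show "continuous (at t within {0..}) Y" by simp
  qed
  hence "continuous_on {0..} u"
    unfolding u_def by (intro continuous_on_schroedinger continuous_intros)
  hence sol: "is_solution \<phi> u\<^sub>0 h u"
    unfolding is_solution_def using int u by blast
  have "Y T = (1 / T) *\<^sub>R (integral {0..T} (\<lambda>_. g) - integral {0..T} (\<lambda>\<tau>. conj_group \<kappa> \<tau> g))"
    unfolding Y_def W_def
    by (simp add: Henstock_Kurzweil_Integration.integral_diff integrable_continuous_interval continuous_on_conj_group k)
  also have "\<dots> = g - group_average T \<kappa> g"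
    using T by (simp add: group_average_def scaleR_diff_right)
  also have "\<dots> = u\<^sub>0" using g by (metis add_diff_cancel_right')
  finally have "u T = 0" by (simp add: u_def E.zero)
  with sol show "\<exists>u. is_solution \<phi> u\<^sub>0 h u \<and> u T = 0" by blast
qed

text \<open>The cylinder over the open ball is itself one of the open sets whose union is removed in
  \<open>spacetime_support\<close>.\<close>

lemma spacetime_support_h1_mult:
  assumes m: "smooth_multiplier m" and zero: "\<And>x. norm x < R \<Longrightarrow> m x = 0"
  shows "spacetime_support (\<lambda>t. h1_mult m (f t)) \<subseteq> UNIV \<times> (- ball 0 R)"
proof -
  let ?U = "UNIV \<times> ball 0 R :: (real \<times> (real^3)) set"
  have "AE x in lborel. (s, x) \<in> ?U \<longrightarrow> rep_l2 (l2_of_h1 (h1_mult m (f s))) x = 0" for s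
    using rep_l2_mult[OF smooth_multiplier_bdd[OF m], of "l2_of_h1 (f s)"]
    unfolding l2_of_h1_mult[OF m] by eventually_elim (simp add: zero)
  hence "?U \<in> {U. open U \<and> (\<forall>s. AE x in lborel. (s, x) \<in> U \<longrightarrow> rep_l2 (l2_of_h1 (h1_mult m (f s))) x = 0)}"
    by (simp add: open_Times)
  hence "spacetime_support (\<lambda>t. h1_mult m (f t)) \<subseteq> - ?U"
    unfolding spacetime_support_def by (intro Compl_anti_mono Union_upper)
  also have "- ?U = UNIV \<times> (- ball 0 R)" by (auto simp del: mem_ball)
  finally show ?thesis .
qed

theorem theorem1p2:
  shows "\<exists>R\<^sub>0>0. \<forall>R\<ge>R\<^sub>0. \<forall>\<phi> :: real^3 \<Rightarrow> real.
    smooth \<phi> \<longrightarrow> range \<phi> \<subseteq> {0..1} \<longrightarrow>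
    (\<forall>x. norm x \<le> R \<longrightarrow> \<phi> x = 0) \<longrightarrow> (\<forall>x. norm x \<ge> R + 1 \<longrightarrow> \<phi> x = 1) \<longrightarrow>
    (\<forall>u\<^sub>0 :: h1. \<forall>T>0. \<exists>h :: real \<Rightarrow> h1.
       continuous_on UNIV h \<and> spacetime_support h \<subseteq> UNIV \<times> (- ball 0 R) \<and>
       (\<exists>u. is_solution \<phi> u\<^sub>0 h u \<and> u T = 0))"
\<comment> \<open>The contraction constant may depend on R, so an arbitrary positive threshold
  serves.\<close>
proof (intro exI[of _ 1] conjI allI impI)
  fix R :: real and \<phi> :: "real^3 \<Rightarrow> real" and u\<^sub>0 :: h1 and T :: real
  assume sm: "smooth \<phi>" and range: "range \<phi> \<subseteq> {0..1}" and zero: "\<forall>x. norm x \<le> R \<longrightarrow> \<phi> x = 0"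
    and one: "\<forall>x. norm x \<ge> R + 1 \<longrightarrow> \<phi> x = 1" and T: "T > 0"
  let ?m = "\<lambda>x. complex_of_real (\<phi> x)"
  define \<kappa> where "\<kappa> x = 1 - ?m x * ?m x" for x
  have \<phi>: "0 \<le> \<phi> x" "\<phi> x \<le> 1" for x using range by (auto simp: image_subset_iff)
  have sm': "smooth ?m" using sm by (simp add: smooth_def C_k_of_real)
  have mult: "smooth_multiplier ?m"
  proof -
    \<comment> \<open>Not \<phi> but 1 - \<phi> has compact support. As a test function it is
      bounded together with its gradient, and \<phi> inherits these bounds.\<close>
    have "{x. 1 - ?m x \<noteq> 0} \<subseteq> cball 0 (R + 1)"
    proof
      fix x assume "x \<in> {x. 1 - ?m x \<noteq> 0}"
      hence "\<phi> x \<noteq> 1" by auto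
      hence "\<not> norm x \<ge> R + 1" using one by blast
      thus "x \<in> cball 0 (R + 1)" by simp
    qed
    hence "test_function (\<lambda>x. 1 - ?m x)"
      using smooth_one_minus(1)[OF sm'] bounded_subset[OF bounded_cball] by (auto simp: test_function_iff)
    from smooth_multiplier_one_minus[OF smooth_multiplier_test[OF this]] show ?thesis by simp
  qed
  have k: "smooth_multiplier \<kappa>"
    unfolding \<kappa>_def [abs_def] by (intro smooth_multiplier_one_minus smooth_multiplier_mult mult)
  have "cmod (\<kappa> x) \<le> indicator (cball 0 (R + 1)) x" for x
  proof (cases "norm x \<le> R + 1")
    case True
    have "\<kappa> x = of_real (1 - \<phi> x * \<phi> x)" by (simp add: \<kappa>_def)
    hence "cmod (\<kappa> x) = \<bar>1 - \<phi> x * \<phi> x\<bar>" by (simp only: norm_of_real)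
    also have "\<dots> \<le> 1" using \<phi>[of x] mult_le_one[of "\<phi> x" "\<phi> x"] by simp
    finally show ?thesis using True by simp
  qed (use one in \<open>simp add: \<kappa>_def\<close>)
  from group_average_fixed_point[OF this k T, of u\<^sub>0]
  obtain g where g: "g = u\<^sub>0 + group_average T \<kappa> g" by blast
  let ?h = "\<lambda>t. h1_mult (\<lambda>x. - \<i> / of_real T * ?m x) (schroedinger_group t g)"
  have "spacetime_support ?h \<subseteq> UNIV \<times> (- ball 0 R)"
    by (rule spacetime_support_h1_mult[OF smooth_multiplier_mult[OF smooth_multiplier_const mult]]) (simp add: zero)
  with control_to_zero[OF mult _ g T refl]
  show "\<exists>h. continuous_on UNIV h \<and> spacetime_support h \<subseteq> UNIV \<times> (- ball 0 R) \<and> (\<exists>u. is_solution \<phi> u\<^sub>0 h u \<and> u T = 0)"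
    by (intro exI[of _ ?h]) (simp add: \<kappa>_def [abs_def])
qed simp

end
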